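(* Let $\mathcal C$ be an idempotent-complete triangulated category and let $\mathbb M$ be a stably separable monad on $\mathcal C$. Then the Eilenberg--Moore category $\mathbb M\text{-}\mathsf{Mod}_{\mathcal C}$ has a unique triangulation such that a triangle is distinguished if and only if its image under the forgetful functor is distinguished in $\mathcal C$. The free and forgetful functors are triangulated functors.
   Context: A triangulation is in the sense of Verdier (axioms TR1--TR3 and the octahedral axiom TR4); no enhancement or higher triangulation on $\mathcal C$ is assumed. A triangulated functor is an additive functor $F$ with a natural isomorphism $F\Sigma\cong\Sigma F$ sending distinguished triangles to distinguished triangles; a morphism of triangulated functors is a natural transformation compatible with these suspension isomorphisms. A monad $\mathbb M=(M,\eta,\mu)$ on $\mathcal C$ is an additive endofunctor $M$ with natural transformations $\eta:\operatorname{Id}\Rightarrow M$, $\mu:M^2\Rightarrow M$ such that $\mu_X M(\mu_X)=\mu_X\mu_{M(X)}$ and $\mu_XM(\eta_X)=1_{M(X)}=\mu_X\eta_{M(X)}$. An $M$-module is $(X,\rho)$ with $\rho:M(X)\to X$, $\rho\eta_X=1_X$, $\rho M(\rho)=\rho\mu_X$; a morphism $a:(X,\rho_X)\to(Y,\rho_Y)$ satisfies $a\rho_X=\rho_YM(a)$. These form the Eilenberg--Moore category $\mathbb M\text{-}\mathsf{Mod}_{\mathcal C}$. The forgetful functor sends $(X,\rho)$ to $X$ and the free functor sends $X$ to $(M(X),\mu_X)$. When $M$ is exact, the suspension of $\mathcal C$ induces a suspension on $\mathbb M\text{-}\mathsf{Mod}_{\mathcal C}$ via $M\Sigma\cong\Sigma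 M$. The monad is separable if there is a natural transformation $\sigma:M\Rightarrow M^2$ with $\mu_X\sigma_X=1_{M(X)}$ and $M(\mu_X)\sigma_{M(X)}=\sigma_X\mu_X=\mu_{M(X)}M(\sigma_X)$ for all $X$; it is stably separable if moreover $\mathcal C$ is triangulated, $M$ is exact, and $\eta,\mu,\sigma$ are morphisms of triangulated functors. *)

theory Defs
  imports "HOL-Algebra.Group"
begin

text \<open>
  A category with an addition on its Hom-sets. Hom-sets of different pairs of objects may
  overlap, so that module morphisms below can simply be morphisms of the base category.
  Composition, addition and functors act on bare morphisms; this costs no generality, as the
  Hom-sets of any category can be made disjoint by recording source and target.
\<close>

record ('o, 'm) add_cat =
  Obj :: "'o set"
  Hom :: "'o \<Rightarrow> 'o \<Rightarrow> 'm set"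
  ident :: "'o \<Rightarrow> 'm"
  comp :: "'m \<Rightarrow> 'm \<Rightarrow> 'm" (infixl "\<cdot>\<index>" 70)
  zero_mor :: "'o \<Rightarrow> 'o \<Rightarrow> 'm"
  add_mor :: "'m \<Rightarrow> 'm \<Rightarrow> 'm"

locale category =
  fixes C :: "('o, 'm) add_cat" (structure)
  assumes Hom_Obj: "f \<in> Hom C X Y \<Longrightarrow> X \<in> Obj C \<and> Y \<in> Obj C"
    and ident_Hom: "X \<in> Obj C \<Longrightarrow> ident C X \<in> Hom C X X"
    and comp_Hom: "\<lbrakk>f \<in> Hom C X Y; g \<in> Hom C Y Z\<rbrakk> \<Longrightarrow> g \<cdot> f \<in> Hom C X Z"
    and comp_ident: "f \<in> Hom C X Y \<Longrightarrow> f \<cdot> ident C X = f"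
    and ident_comp: "f \<in> Hom C X Y \<Longrightarrow> ident C Y \<cdot> f = f"
    and comp_assoc:
      "\<lbrakk>f \<in> Hom C X Y; g \<in> Hom C Y Z; h \<in> Hom C Z W\<rbrakk> \<Longrightarrow> h \<cdot> (g \<cdot> f) = (h \<cdot> g) \<cdot> f"

definition is_iso :: "('o, 'm) add_cat \<Rightarrow> 'o \<Rightarrow> 'o \<Rightarrow> 'm \<Rightarrow> bool" where
  "is_iso C X Y f \<longleftrightarrow>
     f \<in> Hom C X Y \<and> (\<exists>g\<in>Hom C Y X. g \<cdot>\<^bsub>C\<^esub> f = ident C X \<and> f \<cdot>\<^bsub>C\<^esub> g = ident C Y)"

definition is_zero_object :: "('o, 'm) add_cat \<Rightarrow> 'o \<Rightarrow> bool" where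
  "is_zero_object C Z \<longleftrightarrow>
     Z \<in> Obj C \<and> (\<forall>X\<in>Obj C. (\<exists>!f. f \<in> Hom C X Z) \<and> (\<exists>!f. f \<in> Hom C Z X))"

definition Hom_group :: "('o, 'm) add_cat \<Rightarrow> 'o \<Rightarrow> 'o \<Rightarrow> 'm monoid" where
  "Hom_group C X Y = \<lparr>carrier = Hom C X Y, monoid.mult = add_mor C, one = zero_mor C X Y\<rparr>"

definition neg_mor :: "('o, 'm) add_cat \<Rightarrow> 'o \<Rightarrow> 'o \<Rightarrow> 'm \<Rightarrow> 'm" where
  "neg_mor C X Y f = inv\<^bsub>Hom_group C X Y\<^esub> f"

definition is_biproduct ::
    "('o, 'm) add_cat \<Rightarrow> 'o \<Rightarrow> 'o \<Rightarrow> 'o \<Rightarrow> 'm \<Rightarrow> 'm \<Rightarrow> 'm \<Rightarrow> 'm \<Rightarrow> bool" where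
  "is_biproduct C X Y B i1 i2 p1 p2 \<longleftrightarrow>
     i1 \<in> Hom C X B \<and> i2 \<in> Hom C Y B \<and> p1 \<in> Hom C B X \<and> p2 \<in> Hom C B Y \<and>
     p1 \<cdot>\<^bsub>C\<^esub> i1 = ident C X \<and> p2 \<cdot>\<^bsub>C\<^esub> i2 = ident C Y \<and>
     p1 \<cdot>\<^bsub>C\<^esub> i2 = zero_mor C Y X \<and> p2 \<cdot>\<^bsub>C\<^esub> i1 = zero_mor C X Y \<and>
     add_mor C (i1 \<cdot>\<^bsub>C\<^esub> p1) (i2 \<cdot>\<^bsub>C\<^esub> p2) = ident C B"

locale additive_category = category +
  assumes Hom_comm_group: "\<lbrakk>X \<in> Obj C; Y \<in> Obj C\<rbrakk> \<Longrightarrow> comm_group (Hom_group C X Y)"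
    and comp_add: "\<lbrakk>f \<in> Hom C X Y; f' \<in> Hom C X Y; g \<in> Hom C Y Z\<rbrakk>
      \<Longrightarrow> g \<cdot> add_mor C f f' = add_mor C (g \<cdot> f) (g \<cdot> f')"
    and add_comp: "\<lbrakk>f \<in> Hom C X Y; g \<in> Hom C Y Z; g' \<in> Hom C Y Z\<rbrakk>
      \<Longrightarrow> add_mor C g g' \<cdot> f = add_mor C (g \<cdot> f) (g' \<cdot> f)"
    and zero_object_ex: "\<exists>Z. is_zero_object C Z"
    and biproduct_ex: "\<lbrakk>X \<in> Obj C; Y \<in> Obj C\<rbrakk>
      \<Longrightarrow> \<exists>B i1 i2 p1 p2. is_biproduct C X Y B i1 i2 p1 p2"

definition idempotent_complete :: "('o, 'm) add_cat \<Rightarrow> bool" where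
  "idempotent_complete C \<longleftrightarrow>
     (\<forall>X\<in>Obj C. \<forall>e\<in>Hom C X X. e \<cdot>\<^bsub>C\<^esub> e = e \<longrightarrow>
        (\<exists>Y\<in>Obj C. \<exists>p\<in>Hom C X Y. \<exists>i\<in>Hom C Y X.
           i \<cdot>\<^bsub>C\<^esub> p = e \<and> p \<cdot>\<^bsub>C\<^esub> i = ident C Y))"

record ('o, 'm, 'p, 'n) func =
  ob :: "'o \<Rightarrow> 'p"
  ar :: "'m \<Rightarrow> 'n"

definition id_func :: "('o, 'm, 'o, 'm) func" where
  "id_func = \<lparr>ob = (\<lambda>X. X), ar = (\<lambda>f. f)\<rparr>"

definition comp_func ::
    "('p, 'n, 'q, 'k) func \<Rightarrow> ('o, 'm, 'p, 'n) func \<Rightarrow> ('o, 'm, 'q, 'k) func"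
    (infixl "\<circ>\<^sub>F" 75) where
  "G \<circ>\<^sub>F F = \<lparr>ob = (\<lambda>X. ob G (ob F X)), ar = (\<lambda>f. ar G (ar F f))\<rparr>"

locale is_functor = C: category C + D: category D
  for C :: "('o, 'm) add_cat" and D :: "('p, 'n) add_cat" +
  fixes F :: "('o, 'm, 'p, 'n) func"
  assumes ob_Obj: "X \<in> Obj C \<Longrightarrow> ob F X \<in> Obj D"
    and ar_Hom: "f \<in> Hom C X Y \<Longrightarrow> ar F f \<in> Hom D (ob F X) (ob F Y)"
    and ar_ident: "X \<in> Obj C \<Longrightarrow> ar F (ident C X) = ident D (ob F X)"
    and ar_comp: "\<lbrakk>f \<in> Hom C X Y; g \<in> Hom C Y Z\<rbrakk> \<Longrightarrow> ar F (g \<cdot>\<^bsub>C\<^esub> f) = ar F g \<cdot>\<^bsub>D\<^esub> ar F f"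

locale additive_functor = is_functor C D F + C: additive_category C + D: additive_category D
  for C :: "('o, 'm) add_cat" and D :: "('p, 'n) add_cat" and F +
  assumes ar_add: "\<lbrakk>f \<in> Hom C X Y; g \<in> Hom C X Y\<rbrakk>
    \<Longrightarrow> ar F (add_mor C f g) = add_mor D (ar F f) (ar F g)"

locale nat_trans = F: is_functor C D F + G: is_functor C D G
  for C :: "('o, 'm) add_cat" and D :: "('p, 'n) add_cat" and F G +
  fixes \<tau> :: "'o \<Rightarrow> 'n"
  assumes component: "X \<in> Obj C \<Longrightarrow> \<tau> X \<in> Hom D (ob F X) (ob G X)"
    and naturality: "f \<in> Hom C X Y \<Longrightarrow> \<tau> Y \<cdot>\<^bsub>D\<^esub> ar F f = ar G f \<cdot>\<^bsub>D\<^esub> \<tau> X"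

locale nat_iso = nat_trans +
  assumes component_iso: "X \<in> Obj C \<Longrightarrow> is_iso D (ob F X) (ob G X) (\<tau> X)"

definition is_equivalence ::
    "('o, 'm) add_cat \<Rightarrow> ('p, 'n) add_cat \<Rightarrow> ('o, 'm, 'p, 'n) func \<Rightarrow> bool" where
  "is_equivalence C D F \<longleftrightarrow>
     is_functor C D F \<and>
     (\<exists>G \<alpha> \<beta>. is_functor D C G \<and> nat_iso C C (G \<circ>\<^sub>F F) id_func \<alpha> \<and> nat_iso D D (F \<circ>\<^sub>F G) id_func \<beta>)"

text \<open>\<open>Triangle X Y Z f g h\<close> stands for the diagram
  \<open>X \<rightarrow> Y \<rightarrow> Z \<rightarrow> \<Sigma> X\<close> with arrows \<open>f\<close>, \<open>g\<close>, \<open>h\<close>.\<close>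

datatype ('o, 'm) triangle = Triangle 'o 'o 'o 'm 'm 'm

fun is_triangle ::
    "('o, 'm) add_cat \<Rightarrow> ('o, 'm, 'o, 'm) func \<Rightarrow> ('o, 'm) triangle \<Rightarrow> bool" where
  "is_triangle C \<Sigma> (Triangle X Y Z f g h) \<longleftrightarrow>
     f \<in> Hom C X Y \<and> g \<in> Hom C Y Z \<and> h \<in> Hom C Z (ob \<Sigma> X)"

fun is_triangle_morphism ::
    "('o, 'm) add_cat \<Rightarrow> ('o, 'm, 'o, 'm) func \<Rightarrow> ('o, 'm) triangle \<Rightarrow> ('o, 'm) triangle
      \<Rightarrow> 'm \<Rightarrow> 'm \<Rightarrow> 'm \<Rightarrow> bool" where
  "is_triangle_morphism C \<Sigma> (Triangle X Y Z f g h) (Triangle X' Y' Z' f' g' h') a b c \<longleftrightarrow>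
     a \<in> Hom C X X' \<and> b \<in> Hom C Y Y' \<and> c \<in> Hom C Z Z' \<and>
     b \<cdot>\<^bsub>C\<^esub> f = f' \<cdot>\<^bsub>C\<^esub> a \<and> c \<cdot>\<^bsub>C\<^esub> g = g' \<cdot>\<^bsub>C\<^esub> b \<and> ar \<Sigma> a \<cdot>\<^bsub>C\<^esub> h = h' \<cdot>\<^bsub>C\<^esub> c"

fun is_triangle_iso ::
    "('o, 'm) add_cat \<Rightarrow> ('o, 'm, 'o, 'm) func \<Rightarrow> ('o, 'm) triangle \<Rightarrow> ('o, 'm) triangle
      \<Rightarrow> 'm \<Rightarrow> 'm \<Rightarrow> 'm \<Rightarrow> bool" where
  "is_triangle_iso C \<Sigma> (Triangle X Y Z f g h) (Triangle X' Y' Z' f' g' h') a b c \<longleftrightarrow>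
     is_triangle_morphism C \<Sigma> (Triangle X Y Z f g h) (Triangle X' Y' Z' f' g' h') a b c \<and>
     is_iso C X X' a \<and> is_iso C Y Y' b \<and> is_iso C Z Z' c"

text \<open>The suspension is an additive self-equivalence, not necessarily an automorphism of categories.\<close>

locale triangulated_category = additive_category C + \<Sigma>: additive_functor C C \<Sigma>
  for C :: "('o, 'm) add_cat" (structure) and \<Sigma> :: "('o, 'm, 'o, 'm) func" +
  fixes \<Delta> :: "('o, 'm) triangle set"
  assumes \<Sigma>_equivalence: "is_equivalence C C \<Sigma>"
    and dist_triangle: "T \<in> \<Delta> \<Longrightarrow> is_triangle C \<Sigma> T"
    and TR1_iso: "\<lbrakk>T \<in> \<Delta>; is_triangle C \<Sigma> T'; is_triangle_iso C \<Sigma> T T' a b c\<rbrakk> \<Longrightarrow> T' \<in> \<Delta>"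
    and TR1_ident: "\<lbrakk>X \<in> Obj C; is_zero_object C Z\<rbrakk>
      \<Longrightarrow> Triangle X X Z (ident C X) (zero_mor C X Z) (zero_mor C Z (ob \<Sigma> X)) \<in> \<Delta>"
    and TR1_cone: "f \<in> Hom C X Y \<Longrightarrow> \<exists>Z g h. Triangle X Y Z f g h \<in> \<Delta>"
    and TR2: "is_triangle C \<Sigma> (Triangle X Y Z f g h)
      \<Longrightarrow> Triangle X Y Z f g h \<in> \<Delta> \<longleftrightarrow>
          Triangle Y Z (ob \<Sigma> X) g h (neg_mor C (ob \<Sigma> X) (ob \<Sigma> Y) (ar \<Sigma> f)) \<in> \<Delta>"
    and TR3: "\<lbrakk>Triangle X Y Z f g h \<in> \<Delta>; Triangle X' Y' Z' f' g' h' \<in> \<Delta>;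
        a \<in> Hom C X X'; b \<in> Hom C Y Y'; b \<cdot> f = f' \<cdot> a\<rbrakk>
      \<Longrightarrow> \<exists>c. is_triangle_morphism C \<Sigma> (Triangle X Y Z f g h) (Triangle X' Y' Z' f' g' h') a b c"
    and TR4: "\<lbrakk>Triangle X Y Z' f i i' \<in> \<Delta>; Triangle Y Z X' g j j' \<in> \<Delta>;
        Triangle X Z Y' (g \<cdot> f) k k' \<in> \<Delta>\<rbrakk>
      \<Longrightarrow> \<exists>u v. Triangle Z' Y' X' u v (ar \<Sigma> i \<cdot> j') \<in> \<Delta> \<and>
            u \<cdot> i = k \<cdot> g \<and> k' \<cdot> u = i' \<and> v \<cdot> k = j \<and> j' \<cdot> v = ar \<Sigma> f \<cdot> k'"

text \<open>Image of a triangle under a functor \<open>F\<close> with suspension comparison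
  \<open>\<phi> : F \<Sigma> \<rightarrow> \<Sigma> F\<close>.\<close>

fun map_triangle ::
    "('p, 'n) add_cat \<Rightarrow> ('o, 'm, 'p, 'n) func \<Rightarrow> ('o \<Rightarrow> 'n) \<Rightarrow> ('o, 'm) triangle
      \<Rightarrow> ('p, 'n) triangle" where
  "map_triangle D F \<phi> (Triangle X Y Z f g h) =
     Triangle (ob F X) (ob F Y) (ob F Z) (ar F f) (ar F g) (\<phi> X \<cdot>\<^bsub>D\<^esub> ar F h)"

locale triangulated_functor =
  C: triangulated_category C \<Sigma> \<Delta> + D: triangulated_category D \<Sigma>' \<Delta>' +
  additive_functor C D F + nat_iso C D "F \<circ>\<^sub>F \<Sigma>" "\<Sigma>' \<circ>\<^sub>F F" \<phi>
  for C :: "('o, 'm) add_cat" and \<Sigma> \<Delta> and D :: "('p, 'n) add_cat" and \<Sigma>' \<Delta>' and F \<phi> +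
  assumes map_dist: "T \<in> \<Delta> \<Longrightarrow> map_triangle D F \<phi> T \<in> \<Delta>'"

definition id_comparison ::
    "('o, 'm) add_cat \<Rightarrow> ('o, 'm, 'o, 'm) func \<Rightarrow> 'o \<Rightarrow> 'm" where
  "id_comparison C \<Sigma> X = ident C (ob \<Sigma> X)"

definition comp_comparison ::
    "('q, 'k) add_cat \<Rightarrow> ('p, 'n, 'q, 'k) func \<Rightarrow> ('p \<Rightarrow> 'k) \<Rightarrow>
     ('o, 'm, 'p, 'n) func \<Rightarrow> ('o \<Rightarrow> 'n) \<Rightarrow> 'o \<Rightarrow> 'k" where
  "comp_comparison E G \<psi> F \<phi> X = \<psi> (ob F X) \<cdot>\<^bsub>E\<^esub> ar G (\<phi> X)"

locale triangulated_nat_trans =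
  F: triangulated_functor C \<Sigma> \<Delta> D \<Sigma>' \<Delta>' F \<phi> + G: triangulated_functor C \<Sigma> \<Delta> D \<Sigma>' \<Delta>' G \<psi> +
  nat_trans C D F G \<tau>
  for C :: "('o, 'm) add_cat" and \<Sigma> \<Delta> and D :: "('p, 'n) add_cat" and \<Sigma>' \<Delta>' and F \<phi> G \<psi> \<tau> +
  assumes suspension_compat:
    "X \<in> Obj C \<Longrightarrow> \<psi> X \<cdot>\<^bsub>D\<^esub> \<tau> (ob \<Sigma> X) = ar \<Sigma>' (\<tau> X) \<cdot>\<^bsub>D\<^esub> \<phi> X"

locale monad =
  additive_functor C C M + \<eta>: nat_trans C C id_func M \<eta> + \<mu>: nat_trans C C "M \<circ>\<^sub>F M" M \<mu>
  for C :: "('o, 'm) add_cat" (structure) and M \<eta> \<mu> +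
  assumes assoc: "X \<in> Obj C \<Longrightarrow> \<mu> X \<cdot> ar M (\<mu> X) = \<mu> X \<cdot> \<mu> (ob M X)"
    and left_unit: "X \<in> Obj C \<Longrightarrow> \<mu> X \<cdot> ar M (\<eta> X) = ident C (ob M X)"
    and right_unit: "X \<in> Obj C \<Longrightarrow> \<mu> X \<cdot> \<eta> (ob M X) = ident C (ob M X)"

locale separability_section = monad C M \<eta> \<mu> + \<sigma>: nat_trans C C M "M \<circ>\<^sub>F M" \<sigma>
  for C :: "('o, 'm) add_cat" (structure) and M \<eta> \<mu> \<sigma> +
  assumes sect: "X \<in> Obj C \<Longrightarrow> \<mu> X \<cdot> \<sigma> X = ident C (ob M X)"
    and left_linear: "X \<in> Obj C \<Longrightarrow> ar M (\<mu> X) \<cdot> \<sigma> (ob M X) = \<sigma> X \<cdot> \<mu> X"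
    and right_linear: "X \<in> Obj C \<Longrightarrow> \<mu> (ob M X) \<cdot> ar M (\<sigma> X) = \<sigma> X \<cdot> \<mu> X"

definition stably_separable ::
    "('o, 'm) add_cat \<Rightarrow> ('o, 'm, 'o, 'm) func \<Rightarrow> ('o, 'm) triangle set \<Rightarrow>
     ('o, 'm, 'o, 'm) func \<Rightarrow> ('o \<Rightarrow> 'm) \<Rightarrow> ('o \<Rightarrow> 'm) \<Rightarrow> ('o \<Rightarrow> 'm) \<Rightarrow> bool" where
  "stably_separable C \<Sigma> \<Delta> M \<phi> \<eta> \<mu> \<longleftrightarrow>
     triangulated_category C \<Sigma> \<Delta> \<and> monad C M \<eta> \<mu> \<and>
     triangulated_functor C \<Sigma> \<Delta> C \<Sigma> \<Delta> M \<phi> \<and>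
     triangulated_nat_trans C \<Sigma> \<Delta> C \<Sigma> \<Delta> id_func (id_comparison C \<Sigma>) M \<phi> \<eta> \<and>
     triangulated_nat_trans C \<Sigma> \<Delta> C \<Sigma> \<Delta> (M \<circ>\<^sub>F M) (comp_comparison C M \<phi> M \<phi>) M \<phi> \<mu> \<and>
     (\<exists>\<sigma>. separability_section C M \<eta> \<mu> \<sigma> \<and>
        triangulated_nat_trans C \<Sigma> \<Delta> C \<Sigma> \<Delta> M \<phi> (M \<circ>\<^sub>F M) (comp_comparison C M \<phi> M \<phi>) \<sigma>)"

definition EM_Obj ::
    "('o, 'm) add_cat \<Rightarrow> ('o, 'm, 'o, 'm) func \<Rightarrow> ('o \<Rightarrow> 'm) \<Rightarrow> ('o \<Rightarrow> 'm) \<Rightarrow> ('o \<times> 'm) set" where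
  "EM_Obj C M \<eta> \<mu> =
     {(X, \<rho>). X \<in> Obj C \<and> \<rho> \<in> Hom C (ob M X) X \<and>
        \<rho> \<cdot>\<^bsub>C\<^esub> \<eta> X = ident C X \<and> \<rho> \<cdot>\<^bsub>C\<^esub> ar M \<rho> = \<rho> \<cdot>\<^bsub>C\<^esub> \<mu> X}"

definition EM_category ::
    "('o, 'm) add_cat \<Rightarrow> ('o, 'm, 'o, 'm) func \<Rightarrow> ('o \<Rightarrow> 'm) \<Rightarrow> ('o \<Rightarrow> 'm)
      \<Rightarrow> ('o \<times> 'm, 'm) add_cat" where
  "EM_category C M \<eta> \<mu> =
     \<lparr>Obj = EM_Obj C M \<eta> \<mu>,
      Hom = (\<lambda>(X, \<rho>) (Y, \<rho>').
        {a \<in> Hom C X Y. (X, \<rho>) \<in> EM_Obj C M \<eta> \<mu> \<and> (Y, \<rho>') \<in> EM_Obj C M \<eta> \<mu> \<and>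
           a \<cdot>\<^bsub>C\<^esub> \<rho> = \<rho>' \<cdot>\<^bsub>C\<^esub> ar M a}),
      ident = (\<lambda>(X, \<rho>). ident C X),
      comp = comp C,
      zero_mor = (\<lambda>(X, \<rho>) (Y, \<rho>'). zero_mor C X Y),
      add_mor = add_mor C\<rparr>"

definition EM_suspension ::
    "('o, 'm) add_cat \<Rightarrow> ('o, 'm, 'o, 'm) func \<Rightarrow> ('o \<Rightarrow> 'm)
      \<Rightarrow> ('o \<times> 'm, 'm, 'o \<times> 'm, 'm) func" where
  "EM_suspension C \<Sigma> \<phi> =
     \<lparr>ob = (\<lambda>(X, \<rho>). (ob \<Sigma> X, ar \<Sigma> \<rho> \<cdot>\<^bsub>C\<^esub> \<phi> X)), ar = (\<lambda>a. ar \<Sigma> a)\<rparr>"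

definition forgetful_functor :: "('o \<times> 'm, 'm, 'o, 'm) func" where
  "forgetful_functor = \<lparr>ob = fst, ar = (\<lambda>a. a)\<rparr>"

definition free_functor ::
    "('o, 'm, 'o, 'm) func \<Rightarrow> ('o \<Rightarrow> 'm) \<Rightarrow> ('o, 'm, 'o \<times> 'm, 'm) func" where
  "free_functor M \<mu> = \<lparr>ob = (\<lambda>X. (ob M X, \<mu> X)), ar = (\<lambda>f. ar M f)\<rparr>"

text \<open>The forgetful functor commutes strictly with suspension, so its comparison is the identity.\<close>

definition forgetful_comparison ::
    "('o, 'm) add_cat \<Rightarrow> ('o, 'm, 'o, 'm) func \<Rightarrow> 'o \<times> 'm \<Rightarrow> 'm" where
  "forgetful_comparison C \<Sigma> A = ident C (ob \<Sigma> (fst A))"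

definition detected_by_forgetful ::
    "('o, 'm) add_cat \<Rightarrow> ('o, 'm, 'o, 'm) func \<Rightarrow> ('o, 'm) triangle set \<Rightarrow>
     ('o, 'm, 'o, 'm) func \<Rightarrow> ('o \<Rightarrow> 'm) \<Rightarrow> ('o \<Rightarrow> 'm) \<Rightarrow> ('o \<Rightarrow> 'm) \<Rightarrow>
     ('o \<times> 'm, 'm) triangle set \<Rightarrow> bool" where
  "detected_by_forgetful C \<Sigma> \<Delta> M \<phi> \<eta> \<mu> \<Delta>\<^sub>M \<longleftrightarrow>
     (\<forall>T. is_triangle (EM_category C M \<eta> \<mu>) (EM_suspension C \<Sigma> \<phi>) T \<longrightarrow>
        (T \<in> \<Delta>\<^sub>M \<longleftrightarrow>
         map_triangle C forgetful_functor (forgetful_comparison C \<Sigma>) T \<in> \<Delta>))"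

end

theory Submission
  imports Defs "HOL-Algebra.Ring"
begin

text \<open>
  Separability splits the action of every module by a module map, natural in the module. Hence
  every base morphism between modules can be averaged to a module map, and averaging commutes with
  composition by module maps; this gives TR3 for modules. For TR1, a module map \<open>f\<close> is a retract
  of the free map \<open>M f\<close>. By TR3 the corresponding idempotents extend to an endomorphism of the cone
  of \<open>M f\<close>, which is idempotent up to a square-zero error; correcting the error and splitting the
  idempotent gives a cone of \<open>f\<close>.

  Averaging a full octahedron does not visibly preserve the distinguished triangle in it. Instead
  the octahedral axiom is reduced to compositions \<open>p \<cdot> m\<close> in which \<open>p\<close> is a biproduct projection.
  There the octahedron contains a single map that is not determined by the data, and averaging it
  changes the resulting triangle only by a unipotent automorphism, so it stays distinguished.
  Applying this special case to \<open>(i, -g) : Y \<rightarrow> Z' \<oplus> Z\<close> and its two projections gives the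
  general axiom.
\<close>

text \<open>Completions given by TR3 are not unique. The actions on \<open>X\<close> and
  \<open>Y\<close> therefore extend to a base cone \<open>Z\<close> only as some map from
  \<open>M Z\<close> to \<open>Z\<close>, with no reason to satisfy the unit and associativity laws.
  This is why cones of module maps are cut out of cones of free maps, where an action is already
  present. Equations with module maps survive averaging, but membership in \<open>\<Delta>\<close>
  is not an equation. In the split case the cone of \<open>p1\<close> is \<open>\<Sigma> Q\<close>
  with connecting map \<open>-\<Sigma> i2\<close>; since \<open>\<Sigma> p2\<close> splits
  \<open>\<Sigma> i2\<close>, the map from the cone of \<open>p1 \<cdot> m\<close> to
  \<open>\<Sigma> Q\<close> is forced to be \<open>-\<Sigma> (p2 \<cdot> m) \<cdot> t\<close>. Only
  \<open>u\<close> remains to be averaged. Five-lemma arguments are replaced throughout by one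
  device: a map that differs from an isomorphism by a nilpotent error is an isomorphism, and
  nilpotence is read off from factorizations through weak kernels and weak cokernels.\<close>

section \<open>Nilpotent corrections in a noncommutative ring\<close>

text \<open>The inverse is the truncated geometric series \<open>1 - d + d^2\<close>, whose product
  with \<open>1 + d\<close> on either side is \<open>1 + d^3\<close>. The exponent three is what the
  octahedron for modules delivers.\<close>

lemma (in ring) nilpotent_unit:
  assumes d: "d \<in> carrier R" and ddd: "d \<otimes> (d \<otimes> d) = \<zero>"
  shows "\<exists>x\<in>carrier R. x \<otimes> (\<one> \<oplus> d) = \<one> \<and> (\<one> \<oplus> d) \<otimes> x = \<one>"
proof -
  have "(\<one> \<ominus> d \<oplus> d \<otimes> d) \<otimes> (\<one> \<oplus> d) = \<one> \<oplus> d \<otimes> (d \<otimes> d)"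
    using d by (algebra; simp; algebra)
  moreover have "(\<one> \<oplus> d) \<otimes> (\<one> \<ominus> d \<oplus> d \<otimes> d) = \<one> \<oplus> d \<otimes> (d \<otimes> d)"
    using d by (algebra; simp; algebra)
  ultimately show ?thesis
    using d ddd by (intro bexI[of _ "\<one> \<ominus> d \<oplus> d \<otimes> d"]) auto
qed

text \<open>One Newton step for the equation \<open>c^2 - c = 0\<close>: with
  \<open>d = c^2 - c\<close> one has \<open>(1 - 2c)^2 = 1 + 4d\<close>, so \<open>1 - 2c\<close> is
  its own inverse modulo \<open>d\<close>, and \<open>e = c + (1 - 2c) d = 3c^2 - 2c^3\<close>. The
  correction is given with \<open>d\<close> on the right and with \<open>d\<close> on the left
  because, for an endomorphism of a cone, \<open>d\<close> is killed by composition on both sides,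
  with different maps.\<close>

lemma (in ring) idempotent_lift:
  assumes c: "c \<in> carrier R" and nil: "(c \<otimes> c \<ominus> c) \<otimes> (c \<otimes> c \<ominus> c) = \<zero>"
  shows "\<exists>x\<in>carrier R. \<exists>e\<in>carrier R. e \<otimes> e = e \<and>
    e = c \<oplus> x \<otimes> (c \<otimes> c \<ominus> c) \<and> e = c \<oplus> (c \<otimes> c \<ominus> c) \<otimes> x"
proof -
  define d x where "d = c \<otimes> c \<ominus> c" and "x = \<one> \<ominus> c \<ominus> c"
  have cl: "d \<in> carrier R" "x \<in> carrier R" using c by (auto simp: d_def x_def)
  have comm: "x \<otimes> d = d \<otimes> x" and cd: "c \<otimes> d = d \<otimes> c"
    and cc: "c \<otimes> c = c \<oplus> d"
    using c unfolding d_def x_def by (algebra; simp; algebra)+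
  \<comment> \<open>This is the linear coefficient in the expansion of
    \<open>(c + x d)^2 = c + d + (c x + x c) d\<close>; its term \<open>-4d\<close> dies against the
    factor \<open>d\<close>, and its term \<open>-1\<close> cancels the \<open>d\<close> left over
    from \<open>c^2\<close>.\<close>
  have cx: "c \<otimes> x \<oplus> x \<otimes> c = x \<ominus> \<one> \<ominus> (d \<oplus> d \<oplus> d \<oplus> d)"
    using c unfolding d_def x_def by (algebra; simp; algebra)
  have dd: "d \<otimes> d = \<zero>" using nil by (simp add: d_def)
  have xdxd: "x \<otimes> d \<otimes> (x \<otimes> d) = \<zero>"
  proof -
    have "x \<otimes> d \<otimes> (x \<otimes> d) = x \<otimes> (d \<otimes> x) \<otimes> d" using cl by (simp add: m_assoc)
    also have "\<dots> = x \<otimes> (x \<otimes> (d \<otimes> d))" using cl unfolding comm[symmetric] by (simp add: m_assoc)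
    finally show ?thesis using cl dd by simp
  qed
  have "(c \<oplus> x \<otimes> d) \<otimes> (c \<oplus> x \<otimes> d)
      = c \<otimes> c \<oplus> (c \<otimes> x \<otimes> d \<oplus> x \<otimes> (d \<otimes> c)) \<oplus> x \<otimes> d \<otimes> (x \<otimes> d)"
    using c cl by algebra
  also have "\<dots> = c \<oplus> d \<oplus> (c \<otimes> x \<oplus> x \<otimes> c) \<otimes> d"
    using c cl by (simp add: xdxd cc cd[symmetric] l_distr m_assoc)
  also have "\<dots> = c \<oplus> d \<oplus> (x \<otimes> d \<ominus> d \<ominus> (d \<otimes> d \<oplus> d \<otimes> d \<oplus> d \<otimes> d \<oplus> d \<otimes> d))"
    using c cl unfolding cx by (algebra; simp; algebra)
  also have "\<dots> = c \<oplus> x \<otimes> d"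
    using c cl unfolding dd by (simp; algebra)
  finally have "(c \<oplus> x \<otimes> d) \<otimes> (c \<oplus> x \<otimes> d) = c \<oplus> x \<otimes> d" .
  then show ?thesis
    using c cl comm unfolding d_def[symmetric] by (intro bexI[of _ x] bexI[of _ "c \<oplus> x \<otimes> d"]) auto
qed

section \<open>Categories and additive categories\<close>

context category
begin

text \<open>Associativity needs composable arguments, so it cannot serve as an unconditional rewrite
  rule. This rule and its mirror image replace two adjacent factors of a product, with the typing
  supplied as premises.\<close>

lemma comp_eq_left:
  "\<lbrakk>h \<cdot> g = k; f \<in> Hom C X Y; g \<in> Hom C Y Z; h \<in> Hom C Z W\<rbrakk> \<Longrightarrow> h \<cdot> (g \<cdot> f) = k \<cdot> f"
  using comp_assoc by simp

lemma comp_eq_right: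
  "\<lbrakk>g \<cdot> f = k; f \<in> Hom C X Y; g \<in> Hom C Y Z; h \<in> Hom C Z W\<rbrakk> \<Longrightarrow> (h \<cdot> g) \<cdot> f = h \<cdot> k"
  using comp_assoc by metis

lemma is_isoE:
  assumes "is_iso C X Y f"
  obtains g where "f \<in> Hom C X Y" "g \<in> Hom C Y X" "g \<cdot> f = ident C X" "f \<cdot> g = ident C Y"
  using assms unfolding is_iso_def by blast

lemma is_iso_ident: "X \<in> Obj C \<Longrightarrow> is_iso C X X (ident C X)"
  unfolding is_iso_def using ident_Hom comp_ident by blast

lemma is_iso_inverse:
  assumes "f \<in> Hom C X Y" "g \<in> Hom C Y X" "g \<cdot> f = ident C X" "f \<cdot> g = ident C Y"
  shows "is_iso C X Y f" "is_iso C Y X g"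
  using assms unfolding is_iso_def by blast+

lemma is_iso_comp:
  assumes f: "is_iso C X Y f" and g: "is_iso C Y Z g"
  shows "is_iso C X Z (g \<cdot> f)"
proof -
  obtain f' where f': "f \<in> Hom C X Y" "f' \<in> Hom C Y X" "f' \<cdot> f = ident C X" "f \<cdot> f' = ident C Y"
    using f by (rule is_isoE)
  obtain g' where g': "g \<in> Hom C Y Z" "g' \<in> Hom C Z Y" "g' \<cdot> g = ident C Y" "g \<cdot> g' = ident C Z"
    using g by (rule is_isoE)
  have "(f' \<cdot> g') \<cdot> (g \<cdot> f) = f' \<cdot> ((g' \<cdot> g) \<cdot> f)"
    using comp_assoc[OF comp_Hom[OF f'(1) g'(1)] g'(2) f'(2)] comp_assoc[OF f'(1) g'(1,2)] by simp
  then have "(f' \<cdot> g') \<cdot> (g \<cdot> f) = ident C X"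
    using f' g' ident_comp by simp
  moreover have "(g \<cdot> f) \<cdot> (f' \<cdot> g') = g \<cdot> ((f \<cdot> f') \<cdot> g')"
    using comp_assoc[OF comp_Hom[OF g'(2) f'(2)] f'(1) g'(1)] comp_assoc[OF g'(2) f'(2,1)] by simp
  then have "(g \<cdot> f) \<cdot> (f' \<cdot> g') = ident C Z"
    using f' g' ident_comp by simp
  ultimately show ?thesis
    using is_iso_inverse(1)[OF comp_Hom[OF f'(1) g'(1)] comp_Hom[OF g'(2) f'(2)]] by simp
qed

text \<open>The hypotheses give a left inverse \<open>a \<cdot> g\<close> and a right inverse
  \<open>h \<cdot> b\<close>, which then agree. Comparison maps between two cones are rarely inverse
  to each other, but their composites are automorphisms, and that suffices here.\<close>

lemma is_iso_if_left_right:
  assumes f: "f \<in> Hom C X Y" and g: "g \<in> Hom C Y X" and h: "h \<in> Hom C Y X"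
    and gf: "is_iso C X X (g \<cdot> f)" and fh: "is_iso C Y Y (f \<cdot> h)"
  shows "is_iso C X Y f"
proof -
  obtain a where a: "a \<in> Hom C X X" "a \<cdot> (g \<cdot> f) = ident C X"
    using gf by (rule is_isoE)
  obtain b where b: "b \<in> Hom C Y Y" "(f \<cdot> h) \<cdot> b = ident C Y"
    using fh by (rule is_isoE)
  have l: "(a \<cdot> g) \<cdot> f = ident C X" and r: "f \<cdot> (h \<cdot> b) = ident C Y"
    using comp_assoc[OF f g a(1)] comp_assoc[OF b(1) h f] a b by simp_all
  have ag: "a \<cdot> g \<in> Hom C Y X" and hb: "h \<cdot> b \<in> Hom C Y X"
    using a b g h comp_Hom by blast+
  have "a \<cdot> g = h \<cdot> b"
    using comp_assoc[OF hb f ag] l r comp_ident[OF ag] ident_comp[OF hb] by simp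
  then show ?thesis
    using is_iso_inverse(1)[OF f ag l] r by simp
qed

lemma iso_cancel_left:
  assumes "is_iso C Y Z g" "f \<in> Hom C X Y" "f' \<in> Hom C X Y" "g \<cdot> f = g \<cdot> f'"
  shows "f = f'"
proof -
  obtain g' where g': "g \<in> Hom C Y Z" "g' \<in> Hom C Z Y" "g' \<cdot> g = ident C Y"
    using assms(1) by (rule is_isoE)
  have "f = g' \<cdot> (g \<cdot> f)" "f' = g' \<cdot> (g \<cdot> f')"
    using comp_assoc[OF _ g'(1,2)] ident_comp assms(2,3) g'(3) by simp_all
  then show ?thesis using assms(4) by simp
qed

lemma iso_cancel_right:
  assumes "is_iso C X Y f" "g \<in> Hom C Y Z" "g' \<in> Hom C Y Z" "g \<cdot> f = g' \<cdot> f"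
  shows "g = g'"
proof -
  obtain f' where f': "f \<in> Hom C X Y" "f' \<in> Hom C Y X" "f \<cdot> f' = ident C Y"
    using assms(1) by (rule is_isoE)
  have "g = (g \<cdot> f) \<cdot> f'" "g' = (g' \<cdot> f) \<cdot> f'"
    using comp_assoc[OF f'(2,1)] comp_ident assms(2,3) f'(3) by metis+
  then show ?thesis using assms(4) by simp
qed

end

lemma (in is_functor) ar_iso:
  assumes "is_iso C X Y f"
  shows "is_iso D (ob F X) (ob F Y) (ar F f)"
proof -
  obtain g where g: "f \<in> Hom C X Y" "g \<in> Hom C Y X" "g \<cdot>\<^bsub>C\<^esub> f = ident C X" "f \<cdot>\<^bsub>C\<^esub> g = ident C Y"
    using assms by (rule C.is_isoE)
  then show ?thesis
    using D.is_iso_inverse(1) ar_Hom ar_comp ar_ident C.Hom_Obj by metis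
qed

abbreviation plus_mor :: "('o, 'm) add_cat \<Rightarrow> 'm \<Rightarrow> 'm \<Rightarrow> 'm" (infixl "\<boxplus>\<index>" 65)
  where "plus_mor C f g \<equiv> add_mor C f g"

text \<open>Packaging endomorphisms as a ring lets noncommutative identities such as the Newton step
  be proved once in ring theory and carried over to any additive category.\<close>

definition End_ring :: "('o, 'm) add_cat \<Rightarrow> 'o \<Rightarrow> 'm ring" where
  "End_ring C X = \<lparr>carrier = Hom C X X, monoid.mult = comp C, one = ident C X,
     ring.zero = zero_mor C X X, ring.add = add_mor C\<rparr>"

context additive_category
begin

lemma zero_Hom:
  assumes "X \<in> Obj C" "Y \<in> Obj C"
  shows "zero_mor C X Y \<in> Hom C X Y"
proof -
  interpret comm_group "Hom_group C X Y" using assms by (rule Hom_comm_group)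
  show ?thesis using one_closed by (simp add: Hom_group_def)
qed

context
  fixes f X Y
  assumes f: "f \<in> Hom C X Y"
begin

interpretation G: comm_group "Hom_group C X Y"
  using Hom_comm_group Hom_Obj[OF f] by blast

lemma add_Hom: "g \<in> Hom C X Y \<Longrightarrow> f \<boxplus> g \<in> Hom C X Y"
  using G.m_closed[of f g] f by (simp add: Hom_group_def)

lemma add_assoc: "\<lbrakk>g \<in> Hom C X Y; h \<in> Hom C X Y\<rbrakk> \<Longrightarrow> (f \<boxplus> g) \<boxplus> h = f \<boxplus> (g \<boxplus> h)"
  using G.m_assoc[of f g h] f by (simp add: Hom_group_def)

lemma add_commute: "g \<in> Hom C X Y \<Longrightarrow> f \<boxplus> g = g \<boxplus> f"
  using G.m_comm[of f g] f by (simp add: Hom_group_def)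

lemma zero_add: "zero_mor C X Y \<boxplus> f = f"
  using G.l_one[of f] f by (simp add: Hom_group_def)

lemma neg_Hom: "neg_mor C X Y f \<in> Hom C X Y"
  using G.inv_closed[of f] f by (simp add: Hom_group_def neg_mor_def)

lemma add_neg: "f \<boxplus> neg_mor C X Y f = zero_mor C X Y"
  using G.r_inv[of f] f by (simp add: Hom_group_def neg_mor_def)

lemma add_left_cancel: "\<lbrakk>g \<in> Hom C X Y; h \<in> Hom C X Y\<rbrakk> \<Longrightarrow> f \<boxplus> g = f \<boxplus> h \<longleftrightarrow> g = h"
  using G.Units_l_cancel[of f g h] G.Units_eq f by (simp add: Hom_group_def)

end

lemma add_zero: "f \<in> Hom C X Y \<Longrightarrow> f \<boxplus> zero_mor C X Y = f"
  using zero_add add_commute zero_Hom Hom_Obj by metis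

lemma neg_unique: "\<lbrakk>f \<in> Hom C X Y; g \<in> Hom C X Y; f \<boxplus> g = zero_mor C X Y\<rbrakk> \<Longrightarrow> neg_mor C X Y f = g"
  using add_left_cancel[of f X Y "neg_mor C X Y f" g] neg_Hom add_neg by metis

lemma neg_neg: "f \<in> Hom C X Y \<Longrightarrow> neg_mor C X Y (neg_mor C X Y f) = f"
  using neg_unique[OF neg_Hom] add_commute[OF neg_Hom] add_neg by simp

lemma neg_zero: "\<lbrakk>X \<in> Obj C; Y \<in> Obj C\<rbrakk> \<Longrightarrow> neg_mor C X Y (zero_mor C X Y) = zero_mor C X Y"
  using neg_unique add_zero zero_Hom by metis

lemma eq_if_diff_zero:
  "\<lbrakk>f \<in> Hom C X Y; g \<in> Hom C X Y; f \<boxplus> neg_mor C X Y g = zero_mor C X Y\<rbrakk> \<Longrightarrow> f = g"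
  using neg_unique[of "neg_mor C X Y g" X Y f] neg_neg[of g X Y] neg_Hom[of g X Y]
    add_commute[of f X Y "neg_mor C X Y g"] by simp

lemma add_diff_cancel:
  assumes "f \<in> Hom C X Y" "g \<in> Hom C X Y"
  shows "f \<boxplus> (g \<boxplus> neg_mor C X Y f) = g"
  using add_commute[of f X Y "g \<boxplus> neg_mor C X Y f"] add_assoc[of g X Y "neg_mor C X Y f" f]
    add_commute[of "neg_mor C X Y f" X Y f] assms by (simp add: add_Hom neg_Hom add_neg add_zero)

lemma zero_comp:
  assumes f: "f \<in> Hom C X Y" and Z: "Z \<in> Obj C"
  shows "zero_mor C Y Z \<cdot> f = zero_mor C X Z"
proof -
  have z: "zero_mor C Y Z \<in> Hom C Y Z" using f Z Hom_Obj zero_Hom by blast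
  have zf: "zero_mor C Y Z \<cdot> f \<in> Hom C X Z" using comp_Hom[OF f z] .
  have "zero_mor C Y Z \<cdot> f \<boxplus> zero_mor C Y Z \<cdot> f = zero_mor C Y Z \<cdot> f \<boxplus> zero_mor C X Z"
    using add_comp[OF f z z] zero_add[OF z] add_zero[OF zf] by simp
  then show ?thesis
    using add_left_cancel[OF zf zf] zero_Hom zf Hom_Obj by metis
qed

lemma comp_zero:
  assumes f: "f \<in> Hom C X Y" and W: "W \<in> Obj C"
  shows "f \<cdot> zero_mor C W X = zero_mor C W Y"
proof -
  have z: "zero_mor C W X \<in> Hom C W X" using f W Hom_Obj zero_Hom by blast
  have zf: "f \<cdot> zero_mor C W X \<in> Hom C W Y" using comp_Hom[OF z f] .
  have "f \<cdot> zero_mor C W X \<boxplus> f \<cdot> zero_mor C W X = f \<cdot> zero_mor C W X \<boxplus> zero_mor C W Y"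
    using comp_add[OF z z f] zero_add[OF z] add_zero[OF zf] by simp
  then show ?thesis
    using add_left_cancel[OF zf zf] zero_Hom zf Hom_Obj by metis
qed

lemma neg_comp:
  assumes f: "f \<in> Hom C X Y" and g: "g \<in> Hom C Y Z"
  shows "neg_mor C Y Z g \<cdot> f = neg_mor C X Z (g \<cdot> f)"
  using neg_unique[OF comp_Hom[OF f g] comp_Hom[OF f neg_Hom[OF g]]]
    add_comp[OF f g neg_Hom[OF g]] add_neg[OF g] zero_comp[OF f] Hom_Obj[OF g] by simp

lemma comp_neg:
  assumes f: "f \<in> Hom C X Y" and g: "g \<in> Hom C Y Z"
  shows "g \<cdot> neg_mor C X Y f = neg_mor C X Z (g \<cdot> f)"
  using neg_unique[OF comp_Hom[OF f g] comp_Hom[OF neg_Hom[OF f] g]]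
    comp_add[OF f neg_Hom[OF f] g] add_neg[OF f] comp_zero[OF g] Hom_Obj[OF f] by simp

lemma diff_comp_zero:
  assumes "f \<in> Hom C X Y" "g \<in> Hom C Y Z" "g' \<in> Hom C Y Z" "g \<cdot> f = g' \<cdot> f"
  shows "(g \<boxplus> neg_mor C Y Z g') \<cdot> f = zero_mor C X Z"
  using assms add_comp[OF assms(1,2) neg_Hom] neg_comp[OF assms(1,3)] add_neg[OF comp_Hom] by simp

lemma comp_diff_zero:
  assumes "f \<in> Hom C X Y" "f' \<in> Hom C X Y" "g \<in> Hom C Y Z" "g \<cdot> f = g \<cdot> f'"
  shows "g \<cdot> (f \<boxplus> neg_mor C X Y f') = zero_mor C X Z"
  using assms comp_add[OF _ neg_Hom] comp_neg[OF assms(2,3)] add_neg[OF comp_Hom[OF assms(2,3)]] by simp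

lemma neg_ident_iso:
  assumes "X \<in> Obj C"
  shows "is_iso C X X (neg_mor C X X (ident C X))"
proof -
  have i: "ident C X \<in> Hom C X X" using assms by (rule ident_Hom)
  have "neg_mor C X X (ident C X) \<cdot> neg_mor C X X (ident C X) = ident C X"
    using neg_comp[OF neg_Hom[OF i] i] ident_comp[OF neg_Hom[OF i]] neg_neg[OF i] by simp
  then show ?thesis using is_iso_inverse(1) neg_Hom[OF i] by blast
qed

text \<open>The equational form, unlike the universal property, is visibly preserved by additive
  functors and by forgetting an action.\<close>

lemma is_zero_object_iff:
  "is_zero_object C Z \<longleftrightarrow> Z \<in> Obj C \<and> ident C Z = zero_mor C Z Z"
proof
  assume "is_zero_object C Z"
  then show "Z \<in> Obj C \<and> ident C Z = zero_mor C Z Z"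
    unfolding is_zero_object_def using ident_Hom zero_Hom by blast
next
  assume Z: "Z \<in> Obj C \<and> ident C Z = zero_mor C Z Z"
  have "f = zero_mor C X Z" if "f \<in> Hom C X Z" for f X
    using that Z ident_comp zero_comp by metis
  moreover have "f = zero_mor C Z X" if "f \<in> Hom C Z X" for f X
    using that Z comp_ident comp_zero by metis
  ultimately show "is_zero_object C Z"
    unfolding is_zero_object_def using Z zero_Hom by metis
qed

lemma into_zero_object: "\<lbrakk>is_zero_object C Z; f \<in> Hom C X Z\<rbrakk> \<Longrightarrow> f = zero_mor C X Z"
  unfolding is_zero_object_iff using ident_comp zero_comp by metis

lemma from_zero_object: "\<lbrakk>is_zero_object C Z; f \<in> Hom C Z X\<rbrakk> \<Longrightarrow> f = zero_mor C Z X"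
  unfolding is_zero_object_iff using comp_ident comp_zero by metis

lemma ring_End: 
  assumes X: "X \<in> Obj C"
  shows "ring (End_ring C X)"
proof -
  note facts = End_ring_def add_Hom comp_Hom ident_Hom[OF X] zero_Hom[OF X X] comp_ident ident_comp zero_add
  show ?thesis
  proof (rule ringI)
    show "abelian_group (End_ring C X)"
    proof (rule abelian_groupI)
      fix f assume f: "f \<in> carrier (End_ring C X)"
      then show "\<exists>g\<in>carrier (End_ring C X). g \<oplus>\<^bsub>End_ring C X\<^esub> f = \<zero>\<^bsub>End_ring C X\<^esub>"
        using neg_Hom[of f X X] add_neg[of f X X] add_commute[of f X X "neg_mor C X X f"]
        by (auto simp: End_ring_def intro!: bexI[of _ "neg_mor C X X f"])
      fix g assume g: "g \<in> carrier (End_ring C X)"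
      show "f \<oplus>\<^bsub>End_ring C X\<^esub> g = g \<oplus>\<^bsub>End_ring C X\<^esub> f"
        using f g add_commute[of f X X g] by (simp add: End_ring_def)
      fix h assume h: "h \<in> carrier (End_ring C X)"
      show "f \<oplus>\<^bsub>End_ring C X\<^esub> g \<oplus>\<^bsub>End_ring C X\<^esub> h = f \<oplus>\<^bsub>End_ring C X\<^esub> (g \<oplus>\<^bsub>End_ring C X\<^esub> h)"
        using f g h add_assoc[of f X X g h] by (simp add: End_ring_def)
    qed (simp_all add: facts)
    show "Group.monoid (End_ring C X)"
    proof (rule monoidI)
      fix f g h
      assume "f \<in> carrier (End_ring C X)" "g \<in> carrier (End_ring C X)" "h \<in> carrier (End_ring C X)"
      then show "f \<otimes>\<^bsub>End_ring C X\<^esub> g \<otimes>\<^bsub>End_ring C X\<^esub> h = f \<otimes>\<^bsub>End_ring C X\<^esub> (g \<otimes>\<^bsub>End_ring C X\<^esub> h)"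
        using comp_assoc[of h X X g X f X] by (simp add: End_ring_def)
    qed (auto simp: End_ring_def ident_Hom[OF X] comp_ident ident_comp intro: comp_Hom)
  next
    fix f g h
    assume "f \<in> carrier (End_ring C X)" "g \<in> carrier (End_ring C X)" "h \<in> carrier (End_ring C X)"
    then show "(f \<oplus>\<^bsub>End_ring C X\<^esub> g) \<otimes>\<^bsub>End_ring C X\<^esub> h
          = f \<otimes>\<^bsub>End_ring C X\<^esub> h \<oplus>\<^bsub>End_ring C X\<^esub> g \<otimes>\<^bsub>End_ring C X\<^esub> h"
      and "h \<otimes>\<^bsub>End_ring C X\<^esub> (f \<oplus>\<^bsub>End_ring C X\<^esub> g)
          = h \<otimes>\<^bsub>End_ring C X\<^esub> f \<oplus>\<^bsub>End_ring C X\<^esub> h \<otimes>\<^bsub>End_ring C X\<^esub> g"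
      using add_comp[of h X X f X g] comp_add[of f X X g h X] by (simp_all add: End_ring_def)
  qed
qed

lemma End_neg:
  assumes f: "f \<in> Hom C X X"
  shows "\<ominus>\<^bsub>End_ring C X\<^esub> f = neg_mor C X X f"
proof -
  interpret R: ring "End_ring C X" using ring_End f Hom_Obj by blast
  show ?thesis
    using neg_unique[OF f, of "\<ominus>\<^bsub>End_ring C X\<^esub> f"] R.a_inv_closed[of f] R.r_neg[of f] f
    by (simp add: End_ring_def)
qed

lemma nilpotent_iso:
  assumes d: "d \<in> Hom C X X" and ddd: "d \<cdot> (d \<cdot> d) = zero_mor C X X"
  shows "is_iso C X X (ident C X \<boxplus> d)"
proof -
  have X: "X \<in> Obj C" using d Hom_Obj by blast
  have "\<exists>x\<in>Hom C X X. x \<cdot> (ident C X \<boxplus> d) = ident C X \<and> (ident C X \<boxplus> d) \<cdot> x = ident C X"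
    using ring.nilpotent_unit[OF ring_End[OF X], of d] d ddd by (simp add: End_ring_def)
  then show ?thesis
    unfolding is_iso_def using add_Hom[OF ident_Hom[OF X] d] by blast
qed

lemma idempotent_lift:
  fixes c d X
  defines "d \<equiv> c \<cdot> c \<boxplus> neg_mor C X X c"
  assumes c: "c \<in> Hom C X X" and nil: "d \<cdot> d = zero_mor C X X"
  obtains x e where "x \<in> Hom C X X" "e \<in> Hom C X X" "e \<cdot> e = e" "e = c \<boxplus> x \<cdot> d" "e = c \<boxplus> d \<cdot> x"
proof -
  have X: "X \<in> Obj C" using c Hom_Obj by blast
  have "\<exists>x\<in>Hom C X X. \<exists>e\<in>Hom C X X. e \<cdot> e = e \<and> e = c \<boxplus> x \<cdot> d \<and> e = c \<boxplus> d \<cdot> x"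
    using ring.idempotent_lift[OF ring_End[OF X], of c] c nil
    unfolding a_minus_def End_neg[OF c] by (simp add: End_ring_def d_def)
  then show thesis using that by blast
qed

end

context additive_functor
begin

lemma ar_zero:
  assumes "X \<in> Obj C" "Y \<in> Obj C"
  shows "ar F (zero_mor C X Y) = zero_mor D (ob F X) (ob F Y)"
proof -
  have z: "zero_mor C X Y \<in> Hom C X Y" using assms by (rule C.zero_Hom)
  have Fz: "ar F (zero_mor C X Y) \<in> Hom D (ob F X) (ob F Y)" using z by (rule ar_Hom)
  show ?thesis
    using ar_add[OF z z] C.add_zero[OF z] D.add_left_cancel[OF Fz Fz D.zero_Hom] D.add_zero[OF Fz]
      ob_Obj assms by simp
qed

lemma ar_neg:
  assumes "f \<in> Hom C X Y"
  shows "ar F (neg_mor C X Y f) = neg_mor D (ob F X) (ob F Y) (ar F f)"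
  using D.neg_unique[OF ar_Hom[OF assms] ar_Hom[OF C.neg_Hom[OF assms]]]
    ar_add[OF assms C.neg_Hom[OF assms]] C.add_neg[OF assms] ar_zero C.Hom_Obj[OF assms] by simp

lemma ar_zero_object: "is_zero_object C Z \<Longrightarrow> is_zero_object D (ob F Z)"
  unfolding C.is_zero_object_iff D.is_zero_object_iff using ar_ident ar_zero ob_Obj by metis

end

section \<open>Triangles\<close>

text \<open>TR1 to TR3 alone, with a suspension that need not be an equivalence. The consequences
  thus apply to modules before their octahedral axiom is known. The asymmetry is deliberate: weak
  cokernels are available here, whereas weak kernels need desuspension of a morphism.\<close>

locale pretriangulated_category = additive_category C + \<Sigma>: additive_functor C C \<Sigma>
  for C :: "('o, 'm) add_cat" (structure) and \<Sigma> :: "('o, 'm, 'o, 'm) func" +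
  fixes \<Delta> :: "('o, 'm) triangle set"
  assumes dist_triangle: "T \<in> \<Delta> \<Longrightarrow> is_triangle C \<Sigma> T"
    and dist_iso: "\<lbrakk>T \<in> \<Delta>; is_triangle C \<Sigma> T'; is_triangle_iso C \<Sigma> T T' a b c\<rbrakk> \<Longrightarrow> T' \<in> \<Delta>"
    and dist_ident: "\<lbrakk>X \<in> Obj C; is_zero_object C Z\<rbrakk>
      \<Longrightarrow> Triangle X X Z (ident C X) (zero_mor C X Z) (zero_mor C Z (ob \<Sigma> X)) \<in> \<Delta>"
    and dist_cone: "f \<in> Hom C X Y \<Longrightarrow> \<exists>Z g h. Triangle X Y Z f g h \<in> \<Delta>"
    and dist_rotate: "is_triangle C \<Sigma> (Triangle X Y Z f g h)
      \<Longrightarrow> Triangle X Y Z f g h \<in> \<Delta> \<longleftrightarrow>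
          Triangle Y Z (ob \<Sigma> X) g h (neg_mor C (ob \<Sigma> X) (ob \<Sigma> Y) (ar \<Sigma> f)) \<in> \<Delta>"
    and dist_complete: "\<lbrakk>Triangle X Y Z f g h \<in> \<Delta>; Triangle X' Y' Z' f' g' h' \<in> \<Delta>;
        a \<in> Hom C X X'; b \<in> Hom C Y Y'; b \<cdot> f = f' \<cdot> a\<rbrakk>
      \<Longrightarrow> \<exists>c. is_triangle_morphism C \<Sigma> (Triangle X Y Z f g h) (Triangle X' Y' Z' f' g' h') a b c"
begin

lemma dist_Hom:
  assumes "Triangle X Y Z f g h \<in> \<Delta>"
  shows "f \<in> Hom C X Y" "g \<in> Hom C Y Z" "h \<in> Hom C Z (ob \<Sigma> X)"
    "X \<in> Obj C" "Y \<in> Obj C" "Z \<in> Obj C"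
  using dist_triangle[OF assms] Hom_Obj by auto

lemma dist_rotateD:
  assumes "Triangle X Y Z f g h \<in> \<Delta>"
  shows "Triangle Y Z (ob \<Sigma> X) g h (neg_mor C (ob \<Sigma> X) (ob \<Sigma> Y) (ar \<Sigma> f)) \<in> \<Delta>"
  using dist_rotate[OF dist_triangle[OF assms]] assms by simp

lemma dist_completeE:
  assumes "Triangle X Y Z f g h \<in> \<Delta>" "Triangle X' Y' Z' f' g' h' \<in> \<Delta>"
    "a \<in> Hom C X X'" "b \<in> Hom C Y Y'" "b \<cdot> f = f' \<cdot> a"
  obtains c where "c \<in> Hom C Z Z'" "c \<cdot> g = g' \<cdot> b" "ar \<Sigma> a \<cdot> h = h' \<cdot> c"
  using dist_complete[OF assms] by auto

text \<open>Its rotation is the identity triangle on \<open>W\<close> with third object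
  \<open>\<Sigma> N\<close>, which is again a zero object; the sign of the rotation falls on a zero
  map.\<close>

lemma dist_ident_right:
  assumes N: "is_zero_object C N" and W: "W \<in> Obj C"
  shows "Triangle N W W (zero_mor C N W) (ident C W) (zero_mor C W (ob \<Sigma> N)) \<in> \<Delta>"
proof -
  have No: "N \<in> Obj C" using N unfolding is_zero_object_def by blast
  have SN: "is_zero_object C (ob \<Sigma> N)" using N by (rule \<Sigma>.ar_zero_object)
  have SNo: "ob \<Sigma> N \<in> Obj C" and SW: "ob \<Sigma> W \<in> Obj C" using No W \<Sigma>.ob_Obj by blast+
  have "Triangle W W (ob \<Sigma> N) (ident C W) (zero_mor C W (ob \<Sigma> N))
      (neg_mor C (ob \<Sigma> N) (ob \<Sigma> W) (ar \<Sigma> (zero_mor C N W))) \<in> \<Delta>"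
    using dist_ident[OF W SN] \<Sigma>.ar_zero[OF No W] neg_zero[OF SNo SW] by simp
  then show ?thesis
    using dist_rotate[of N W W "zero_mor C N W"] No SNo W by (simp add: ident_Hom zero_Hom)
qed

text \<open>The pair \<open>(1, f)\<close> maps the identity triangle on \<open>X\<close> to the
  given one. Its completion factors \<open>g \<cdot> f\<close> through a zero object; the second
  equation is the first one for the rotated triangle.\<close>

lemma dist_comp_zero:
  assumes T: "Triangle X Y Z f g h \<in> \<Delta>"
  shows "g \<cdot> f = zero_mor C X Z" "h \<cdot> g = zero_mor C Y (ob \<Sigma> X)"
proof -
  have *: "g \<cdot> f = zero_mor C X Z" if T: "Triangle X Y Z f g h \<in> \<Delta>" for X Y Z f g h
  proof -
    note H = dist_Hom[OF T]
    obtain N where N: "is_zero_object C N" using zero_object_ex by blast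
    obtain c where c: "c \<in> Hom C N Z" "c \<cdot> zero_mor C X N = g \<cdot> f"
      using dist_completeE[OF dist_ident[OF H(4) N] T ident_Hom[OF H(4)] H(1)] by metis
    then show ?thesis using comp_zero H by metis
  qed
  show "g \<cdot> f = zero_mor C X Z" using *[OF T] .
  show "h \<cdot> g = zero_mor C Y (ob \<Sigma> X)" using *[OF dist_rotateD[OF T]] .
qed

text \<open>The factorization \<open>s\<close> is the third component of a morphism from the rotated
  triangle to \<open>N \<rightarrow> W \<rightarrow> W\<close>, whose first two components are zero
  and \<open>t\<close>.\<close>

lemma weak_cokernel:
  assumes T: "Triangle X Y Z f g h \<in> \<Delta>" and t: "t \<in> Hom C Z W" "t \<cdot> g = zero_mor C Y W"
  obtains s where "s \<in> Hom C (ob \<Sigma> X) W" "t = s \<cdot> h"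
proof -
  note H = dist_Hom[OF T]
  have W: "W \<in> Obj C" using t Hom_Obj by blast
  obtain N where N: "is_zero_object C N" using zero_object_ex by blast
  have No: "N \<in> Obj C" using N unfolding is_zero_object_def by blast
  have "t \<cdot> g = zero_mor C N W \<cdot> zero_mor C Y N"
    using t zero_comp[OF zero_Hom[OF H(5) No] W] by simp
  then obtain c where "c \<in> Hom C (ob \<Sigma> X) W" "c \<cdot> h = ident C W \<cdot> t"
    using dist_completeE[OF dist_rotateD[OF T] dist_ident_right[OF N W] zero_Hom[OF H(5) No] t(1)] by metis
  then show thesis using that ident_comp t by metis
qed

text \<open>The error \<open>c - 1\<close> kills \<open>g\<close>, hence factors as
  \<open>s \<cdot> h\<close>; since also \<open>h \<cdot> (c - 1) = 0\<close>, it squares to zero.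
  This takes the place of the five lemma.\<close>

lemma dist_endo_iso:
  assumes T: "Triangle X Y Z f g h \<in> \<Delta>" and c: "c \<in> Hom C Z Z" "c \<cdot> g = g" "h \<cdot> c = h"
  shows "is_iso C Z Z c"
proof -
  note H = dist_Hom[OF T]
  note i = ident_Hom[OF H(6)]
  let ?d = "c \<boxplus> neg_mor C Z Z (ident C Z)"
  have d: "?d \<in> Hom C Z Z" using c i by (intro add_Hom neg_Hom)
  have dg: "?d \<cdot> g = zero_mor C Y Z"
    using diff_comp_zero[OF H(2) c(1) i] c(2) ident_comp[OF H(2)] by simp
  have hd: "h \<cdot> ?d = zero_mor C Z (ob \<Sigma> X)"
    using comp_diff_zero[OF c(1) i H(3)] c(3) comp_ident[OF H(3)] by simp
  obtain s where s: "s \<in> Hom C (ob \<Sigma> X) Z" "?d = s \<cdot> h"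
    using weak_cokernel[OF T d dg] .
  have "?d \<cdot> ?d = s \<cdot> (h \<cdot> ?d)" using comp_assoc[OF d H(3) s(1)] s(2) by simp
  then have "?d \<cdot> ?d = zero_mor C Z Z" using hd comp_zero[OF s(1) H(6)] by simp
  then have "is_iso C Z Z (ident C Z \<boxplus> ?d)"
    using nilpotent_iso[OF d] comp_zero[OF d H(6)] by simp
  then show ?thesis using add_diff_cancel[OF i c(1)] by simp
qed

text \<open>Completing the inverses of \<open>a\<close> and \<open>b\<close> gives some
  \<open>c'\<close> in the other direction. It need not invert \<open>c\<close>, but
  \<open>c' \<cdot> c\<close> and \<open>c \<cdot> c'\<close> fix the outer maps of their triangles
  and are therefore automorphisms.\<close>

lemma dist_morphism_iso:
  assumes T: "Triangle X Y Z f g h \<in> \<Delta>" and T': "Triangle X' Y' Z' f' g' h' \<in> \<Delta>"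
    and a: "is_iso C X X' a" and b: "is_iso C Y Y' b"
    and m: "is_triangle_morphism C \<Sigma> (Triangle X Y Z f g h) (Triangle X' Y' Z' f' g' h') a b c"
  shows "is_iso C Z Z' c"
proof -
  note H = dist_Hom[OF T] and H' = dist_Hom[OF T']
  have m: "a \<in> Hom C X X'" "b \<in> Hom C Y Y'" "c \<in> Hom C Z Z'"
    "b \<cdot> f = f' \<cdot> a" "c \<cdot> g = g' \<cdot> b" "ar \<Sigma> a \<cdot> h = h' \<cdot> c" using m by auto
  obtain a' where a': "a' \<in> Hom C X' X" "a' \<cdot> a = ident C X" "a \<cdot> a' = ident C X'"
    using a by (rule is_isoE)
  obtain b' where b': "b' \<in> Hom C Y' Y" "b' \<cdot> b = ident C Y" "b \<cdot> b' = ident C Y'"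
    using b by (rule is_isoE)
  have "b' \<cdot> f' = b' \<cdot> (f' \<cdot> (a \<cdot> a'))" using a' comp_ident H'(1) by simp
  also have "\<dots> = b' \<cdot> ((b \<cdot> f) \<cdot> a')" using comp_assoc[OF a'(1) m(1) H'(1)] m(4) by simp
  also have "\<dots> = (b' \<cdot> b) \<cdot> (f \<cdot> a')"
    using comp_assoc[OF a'(1) H(1) m(2)] comp_assoc[OF comp_Hom[OF a'(1) H(1)] m(2) b'(1)] by simp
  finally have eq: "b' \<cdot> f' = f \<cdot> a'" using b' ident_comp comp_Hom[OF a'(1) H(1)] by simp
  obtain c' where c': "c' \<in> Hom C Z' Z" "c' \<cdot> g' = g \<cdot> b'" "ar \<Sigma> a' \<cdot> h' = h \<cdot> c'"
    using dist_completeE[OF T' T a'(1) b'(1) eq] .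
  note S = \<Sigma>.ar_Hom[OF m(1)] \<Sigma>.ar_Hom[OF a'(1)]
  have Saa: "ar \<Sigma> a' \<cdot> ar \<Sigma> a = ident C (ob \<Sigma> X)" "ar \<Sigma> a \<cdot> ar \<Sigma> a' = ident C (ob \<Sigma> X')"
    using \<Sigma>.ar_comp[OF m(1) a'(1)] \<Sigma>.ar_comp[OF a'(1) m(1)] a' \<Sigma>.ar_ident H(4) H'(4) by simp_all
  have "(c' \<cdot> c) \<cdot> g = (c' \<cdot> g') \<cdot> b" 
    using comp_eq_right[OF m(5) H(2) m(3) c'(1)] comp_assoc[OF m(2) H'(2) c'(1)] by simp
  then have "(c' \<cdot> c) \<cdot> g = g" using c'(2) comp_eq_right[OF b'(2) m(2) b'(1) H(2)] comp_ident H(2) by simp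
  moreover have "h \<cdot> (c' \<cdot> c) = ar \<Sigma> a' \<cdot> (h' \<cdot> c)"
    using comp_assoc[OF m(3) c'(1) H(3)] c'(3) comp_assoc[OF m(3) H'(3) S(2)] by simp
  then have "h \<cdot> (c' \<cdot> c) = h"
    using m(6) comp_eq_left[OF Saa(1) H(3) S] ident_comp H(3) by metis
  ultimately have i1: "is_iso C Z Z (c' \<cdot> c)"
    using dist_endo_iso[OF T] comp_Hom[OF m(3) c'(1)] by blast
  have "(c \<cdot> c') \<cdot> g' = (c \<cdot> g) \<cdot> b'" 
    using comp_eq_right[OF c'(2) H'(2) c'(1) m(3)] comp_assoc[OF b'(1) H(2) m(3)] by simp
  then have "(c \<cdot> c') \<cdot> g' = g'" using m(5) comp_eq_right[OF b'(3) b'(1) m(2) H'(2)] comp_ident H'(2) by simp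
  moreover have "h' \<cdot> (c \<cdot> c') = ar \<Sigma> a \<cdot> (h \<cdot> c')"
    using comp_assoc[OF c'(1) m(3) H'(3)] m(6) comp_assoc[OF c'(1) H(3) S(1)] by simp
  then have "h' \<cdot> (c \<cdot> c') = h'"
    using c'(3) comp_eq_left[OF Saa(2) H'(3) S(2,1)] ident_comp H'(3) by metis
  ultimately have i2: "is_iso C Z' Z' (c \<cdot> c')"
    using dist_endo_iso[OF T'] comp_Hom[OF c'(1) m(3)] by blast
  show ?thesis using is_iso_if_left_right[OF m(3) c'(1) c'(1) i1 i2] .
qed

lemma dist_iso_third:
  assumes T: "Triangle X Y Z f g h \<in> \<Delta>" and c: "is_iso C Z Z' c" and h': "h' \<in> Hom C Z' (ob \<Sigma> X)" "h' \<cdot> c = h"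
  shows "Triangle X Y Z' f (c \<cdot> g) h' \<in> \<Delta>"
proof -
  note H = dist_Hom[OF T]
  have c': "c \<in> Hom C Z Z'" using c unfolding is_iso_def by blast
  show ?thesis
    by (rule dist_iso[OF T, of _ "ident C X" "ident C Y" c])
      (use H c c' h' comp_ident[OF comp_Hom[OF H(2) c']] in \<open>simp_all add: comp_Hom is_iso_ident ident_Hom comp_ident ident_comp \<Sigma>.ar_ident\<close>)
qed

lemma dist_iso_over:
  assumes T: "Triangle X Y Z f g h \<in> \<Delta>" and T': "Triangle X Y Z' f g' h' \<in> \<Delta>"
  obtains c where "is_iso C Z Z' c" "c \<cdot> g = g'" "h' \<cdot> c = h"
proof -
  note H = dist_Hom[OF T] and H' = dist_Hom[OF T']
  note i = ident_Hom[OF H(4)] ident_Hom[OF H(5)]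
  have eq: "ident C Y \<cdot> f = f \<cdot> ident C X" using H(1) comp_ident ident_comp by simp
  obtain c where c: "is_triangle_morphism C \<Sigma> (Triangle X Y Z f g h) (Triangle X Y Z' f g' h') (ident C X) (ident C Y) c"
    using dist_complete[OF T T' i eq] by blast
  show thesis
    using that[OF dist_morphism_iso[OF T T' is_iso_ident is_iso_ident c]] c H H'
    by (simp add: comp_ident ident_comp \<Sigma>.ar_ident)
qed

text \<open>The isomorphism of triangles is \<open>(-1, 1, 1)\<close>.\<close>

lemma dist_neg_first_third:
  assumes T: "Triangle X Y Z f g h \<in> \<Delta>"
  shows "Triangle X Y Z (neg_mor C X Y f) g (neg_mor C Z (ob \<Sigma> X) h) \<in> \<Delta>"
proof -
  note H = dist_Hom[OF T]
  let ?n = "neg_mor C X X (ident C X)"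
  have n: "is_iso C X X ?n" "?n \<in> Hom C X X" using neg_ident_iso neg_Hom ident_Hom H(4) by auto
  have "ar \<Sigma> ?n = neg_mor C (ob \<Sigma> X) (ob \<Sigma> X) (ident C (ob \<Sigma> X))"
    using \<Sigma>.ar_neg[OF ident_Hom[OF H(4)]] \<Sigma>.ar_ident[OF H(4)] by simp
  then have "ar \<Sigma> ?n \<cdot> h = neg_mor C Z (ob \<Sigma> X) h"
    using neg_comp[OF H(3) ident_Hom] ident_comp[OF H(3)] H(3) Hom_Obj by metis
  moreover have "neg_mor C X Y f \<cdot> ?n = f"
    using neg_comp[OF n(2) H(1)] comp_neg[OF ident_Hom[OF H(4)] H(1)] comp_ident[OF H(1)] neg_neg[OF H(1)] by simp
  ultimately show ?thesis
    by (intro dist_iso[OF T, of _ ?n "ident C Y" "ident C Z"])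
      (use H n comp_ident[OF neg_Hom[OF H(3)]] in \<open>simp_all add: neg_Hom is_iso_ident ident_Hom comp_ident ident_comp\<close>)
qed

end

text \<open>The octahedral axiom for \<open>p1 \<cdot> m\<close>, using that the cone of \<open>p1\<close> is \<open>\<Sigma> Q\<close>. Its instances for
  both projections already imply the general axiom.\<close>

locale split_octahedral_category = pretriangulated_category +
  assumes split_octahedron: "\<lbrakk>is_biproduct C P Q B i1 i2 p1 p2; Triangle Y B W m n w \<in> \<Delta>;
      Triangle Y P S (p1 \<cdot> m) s t \<in> \<Delta>\<rbrakk>
    \<Longrightarrow> \<exists>u. u \<in> Hom C W S \<and> u \<cdot> n = s \<cdot> p1 \<and> t \<cdot> u = w \<and>
          Triangle Q W S (n \<cdot> i2) u (neg_mor C S (ob \<Sigma> Q) (ar \<Sigma> (p2 \<cdot> m) \<cdot> t)) \<in> \<Delta>"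

lemma (in additive_category) is_biproduct_swap:
  assumes "is_biproduct C P Q B i1 i2 p1 p2"
  shows "is_biproduct C Q P B i2 i1 p2 p1"
  using assms add_commute comp_Hom unfolding is_biproduct_def by metis

section \<open>The octahedral axiom from its split case\<close>

context split_octahedral_category
begin

text \<open>The cone \<open>W\<close> of \<open>(i, -g)\<close> is a homotopy pushout of
  \<open>i\<close> and \<open>g\<close>, with legs \<open>a\<close> from \<open>Z'\<close> and
  \<open>c\<close> from \<open>Z\<close>. One projection shows that \<open>W\<close> is a cone of
  \<open>g \<cdot> f\<close>, the other that \<open>X'\<close> is a cone of \<open>a\<close>.
  Replacing \<open>W\<close> by the given cone \<open>Y'\<close> turns \<open>a\<close> and
  \<open>v\<close> into the required maps.\<close>

theorem octahedron:
  assumes F: "Triangle X Y Z' f i i' \<in> \<Delta>" and G: "Triangle Y Z X' g j j' \<in> \<Delta>"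
    and GF: "Triangle X Z Y' (g \<cdot> f) k k' \<in> \<Delta>"
  shows "\<exists>u v. Triangle Z' Y' X' u v (ar \<Sigma> i \<cdot> j') \<in> \<Delta> \<and>
            u \<cdot> i = k \<cdot> g \<and> k' \<cdot> u = i' \<and> v \<cdot> k = j \<and> j' \<cdot> v = ar \<Sigma> f \<cdot> k'"
proof -
  note HF = dist_Hom[OF F] and HG = dist_Hom[OF G] and HGF = dist_Hom[OF GF]
  obtain B i1 i2 p1 p2 where B: "is_biproduct C Z' Z B i1 i2 p1 p2"
    using biproduct_ex HF(6) HG(5) by blast
  have b: "i1 \<in> Hom C Z' B" "i2 \<in> Hom C Z B" "p1 \<in> Hom C B Z'" "p2 \<in> Hom C B Z"
    "p1 \<cdot> i1 = ident C Z'" "p2 \<cdot> i2 = ident C Z" "p1 \<cdot> i2 = zero_mor C Z Z'" "p2 \<cdot> i1 = zero_mor C Z' Z"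
    "(i1 \<cdot> p1) \<boxplus> (i2 \<cdot> p2) = ident C B"
    using B unfolding is_biproduct_def by blast+
  let ?g = "neg_mor C Y Z g"
  have ng: "?g \<in> Hom C Y Z" using HG(1) by (rule neg_Hom)
  \<comment> \<open>The sign turns \<open>n \<cdot> m = 0\<close> into the commuting square
    \<open>a \<cdot> i = c \<cdot> g\<close>. Together with the signs of rotation it also yields
    \<open>g \<cdot> f\<close>, not its negative, as the first map of the triangle on
    \<open>c\<close>.\<close>
  define m where "m = (i1 \<cdot> i) \<boxplus> (i2 \<cdot> ?g)"
  have ii: "i1 \<cdot> i \<in> Hom C Y B" "i2 \<cdot> ?g \<in> Hom C Y B" using comp_Hom HF(2) b(1,2) ng by blast+
  have m: "m \<in> Hom C Y B" unfolding m_def using ii by (rule add_Hom)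
  have p1m: "p1 \<cdot> m = i"
    unfolding m_def
    using comp_add[OF ii b(3)] comp_eq_left[OF b(5) HF(2) b(1,3)] comp_eq_left[OF b(7) ng b(2,3)]
      ident_comp[OF HF(2)] zero_comp[OF ng HF(6)] add_zero[OF HF(2)] by simp
  have p2m: "p2 \<cdot> m = ?g"
    unfolding m_def
    using comp_add[OF ii b(4)] comp_eq_left[OF b(8) HF(2) b(1,4)] comp_eq_left[OF b(6) ng b(2,4)]
      ident_comp[OF ng] zero_comp[OF HF(2) HG(5)] zero_add[OF ng] by simp
  obtain W n w where T: "Triangle Y B W m n w \<in> \<Delta>" using dist_cone[OF m] by blast
  note HT = dist_Hom[OF T]
  define a where "a = n \<cdot> i1"
  define c where "c = n \<cdot> i2"
  have a: "a \<in> Hom C Z' W" and c: "c \<in> Hom C Z W"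
    unfolding a_def c_def using comp_Hom b(1,2) HT(2) by blast+
  have ag: "a \<cdot> i = c \<cdot> g"
  proof -
    have "zero_mor C Y W = n \<cdot> m" using dist_comp_zero(1)[OF T] by simp
    also have "\<dots> = (a \<cdot> i) \<boxplus> neg_mor C Y W (c \<cdot> g)"
      unfolding m_def a_def c_def
      using comp_add[OF ii HT(2)] comp_assoc[OF HF(2) b(1) HT(2)] comp_assoc[OF ng b(2) HT(2)]
        comp_neg[OF HG(1) comp_Hom[OF b(2) HT(2)]] by simp
    finally show ?thesis
      using eq_if_diff_zero[OF comp_Hom[OF HF(2) a] comp_Hom[OF HG(1) c]] by simp
  qed
  let ?f = "neg_mor C (ob \<Sigma> X) (ob \<Sigma> Y) (ar \<Sigma> f)"
  note Sf = \<Sigma>.ar_Hom[OF HF(1)] and Sg = \<Sigma>.ar_Hom[OF HG(1)]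
  \<comment> \<open>As \<open>p1 \<cdot> m = i\<close>, a cone of this composite is
    \<open>\<Sigma> X\<close>, by rotating the triangle on \<open>f\<close>.\<close>
  have "Triangle Y Z' (ob \<Sigma> X) (p1 \<cdot> m) i' ?f \<in> \<Delta>"
    using dist_rotateD[OF F] p1m by simp
  from split_octahedron[OF B T this]
  obtain h where h: "h \<in> Hom C W (ob \<Sigma> X)" "h \<cdot> n = i' \<cdot> p1" "?f \<cdot> h = w"
    and Th: "Triangle Z W (ob \<Sigma> X) c h (neg_mor C (ob \<Sigma> X) (ob \<Sigma> Z) (ar \<Sigma> (p2 \<cdot> m) \<cdot> ?f)) \<in> \<Delta>"
    unfolding c_def by auto
  have "ar \<Sigma> (p2 \<cdot> m) \<cdot> ?f = ar \<Sigma> (g \<cdot> f)"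
    unfolding p2m using \<Sigma>.ar_neg[OF HG(1)] neg_comp[OF neg_Hom[OF Sf] Sg] comp_neg[OF Sf Sg]
      neg_neg[OF comp_Hom[OF Sf Sg]] \<Sigma>.ar_comp[OF HF(1) HG(1)] by simp
  then have Tc: "Triangle X Z W (g \<cdot> f) c h \<in> \<Delta>"
    using dist_rotate[of X Z W "g \<cdot> f" c h] Th HGF(1) c h(1) by simp
  obtain \<chi> where \<chi>: "is_iso C W Y' \<chi>" "\<chi> \<cdot> c = k" "k' \<cdot> \<chi> = h"
    using dist_iso_over[OF Tc GF] .
  obtain \<chi>' where \<chi>': "\<chi> \<in> Hom C W Y'" "\<chi>' \<in> Hom C Y' W" "\<chi>' \<cdot> \<chi> = ident C W" "\<chi> \<cdot> \<chi>' = ident C Y'"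
    using \<chi>(1) by (rule is_isoE)
  let ?j = "neg_mor C X' (ob \<Sigma> Y) j'"
  \<comment> \<open>As \<open>p2 \<cdot> m = -g\<close>, the triangle on \<open>g\<close> is used
    with first and third maps negated.\<close>
  have "Triangle Y Z X' (p2 \<cdot> m) j ?j \<in> \<Delta>"
    using dist_neg_first_third[OF G] p2m by simp
  from split_octahedron[OF is_biproduct_swap[OF B] T this]
  obtain v where v: "v \<in> Hom C W X'" "v \<cdot> n = j \<cdot> p2" "?j \<cdot> v = w"
    and Tv: "Triangle Z' W X' a v (neg_mor C X' (ob \<Sigma> Z') (ar \<Sigma> (p1 \<cdot> m) \<cdot> ?j)) \<in> \<Delta>"
    unfolding a_def by auto
  note Si = \<Sigma>.ar_Hom[OF HF(2)]
  have Sij: "ar \<Sigma> i \<cdot> j' \<in> Hom C X' (ob \<Sigma> Z')" using comp_Hom[OF HG(3) Si] .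
  have Tv: "Triangle Z' W X' a v (ar \<Sigma> i \<cdot> j') \<in> \<Delta>"
    using Tv p1m comp_neg[OF HG(3) Si] neg_neg[OF Sij] by simp
  have "Triangle Z' Y' X' (\<chi> \<cdot> a) (v \<cdot> \<chi>') (ar \<Sigma> i \<cdot> j') \<in> \<Delta>"
    by (rule dist_iso[OF Tv, of _ "ident C Z'" \<chi> "ident C X'"])
      (use HF HG a v \<chi>' \<chi>(1) Sij comp_ident[OF comp_Hom[OF a \<chi>'(1)]] comp_eq_right[OF \<chi>'(3,1,2) v(1)] in \<open>simp_all add: is_iso_ident ident_Hom comp_ident ident_comp comp_Hom \<Sigma>.ar_ident\<close>)
  moreover have "(\<chi> \<cdot> a) \<cdot> i = k \<cdot> g"
    using comp_eq_right[OF ag HF(2) a \<chi>'(1)] comp_eq_left[OF \<chi>(2) HG(1) c \<chi>'(1)] by simp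
  moreover have "k' \<cdot> (\<chi> \<cdot> a) = i'"
    using comp_eq_left[OF \<chi>(3) a \<chi>'(1) HGF(3)] comp_eq_left[OF h(2) b(1) HT(2) h(1)] 
      comp_eq_right[OF b(5) b(1,3) HF(3)] comp_ident[OF HF(3)] by (simp add: a_def)
  moreover have "(v \<cdot> \<chi>') \<cdot> k = j"
  proof -
    have "\<chi>' \<cdot> k = c" using comp_eq_left[OF \<chi>'(3) c \<chi>'(1,2)] \<chi>(2) ident_comp[OF c] by simp
    then have "(v \<cdot> \<chi>') \<cdot> k = v \<cdot> c" using comp_eq_right[OF _ HGF(2) \<chi>'(2) v(1)] by simp
    also have "\<dots> = j"
      using comp_eq_left[OF v(2) b(2) HT(2) v(1)] comp_eq_right[OF b(6) b(2,4) HG(2)] comp_ident[OF HG(2)]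
      by (simp add: c_def)
    finally show ?thesis .
  qed
  moreover have "j' \<cdot> (v \<cdot> \<chi>') = ar \<Sigma> f \<cdot> k'"
  proof -
    \<comment> \<open>Both sides are \<open>w\<close>, the connecting map of \<open>m\<close>, which
      the two split octahedra share.\<close>
    have "neg_mor C W (ob \<Sigma> Y) (j' \<cdot> v) = neg_mor C W (ob \<Sigma> Y) (ar \<Sigma> f \<cdot> h)"
      using v(3) h(3) neg_comp[OF v(1) HG(3)] neg_comp[OF h(1) Sf] by simp
    then have "j' \<cdot> v = ar \<Sigma> f \<cdot> h"
      using neg_neg[OF comp_Hom[OF v(1) HG(3)]] neg_neg[OF comp_Hom[OF h(1) Sf]] by metis
    moreover have "h \<cdot> \<chi>' = k'"
      using comp_eq_right[OF \<chi>'(4) \<chi>'(2,1) HGF(3)] \<chi>(3) comp_ident[OF HGF(3)] by simp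
    ultimately show ?thesis
      using comp_eq_left[OF _ \<chi>'(2) v(1) HG(3)] comp_eq_right[OF _ \<chi>'(2) h(1) Sf] by metis
  qed
  ultimately show ?thesis by blast
qed

end

section \<open>Retracts of distinguished triangles and split triangles\<close>

context pretriangulated_category
begin

text \<open>A genuine cone \<open>Z0\<close> of \<open>f\<close> is compared with \<open>Z\<close>
  in both directions by way of \<open>Z'\<close>, where TR3 applies. The comparison maps respect the
  outer maps, so both composites differ from the identity by a nilpotent map; hence \<open>Z\<close>
  is isomorphic to a cone.\<close>

lemma dist_retract:
  assumes T': "Triangle X' Y' Z' f' g' h' \<in> \<Delta>"
    and T: "is_triangle C \<Sigma> (Triangle X Y Z f g h)"
    and i: "is_triangle_morphism C \<Sigma> (Triangle X Y Z f g h) (Triangle X' Y' Z' f' g' h') a b c"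
    and p: "is_triangle_morphism C \<Sigma> (Triangle X' Y' Z' f' g' h') (Triangle X Y Z f g h) a' b' c'"
    and pi: "a' \<cdot> a = ident C X" "b' \<cdot> b = ident C Y" "c' \<cdot> c = ident C Z"
  shows "Triangle X Y Z f g h \<in> \<Delta>"
proof -
  note H' = dist_Hom[OF T']
  have H: "f \<in> Hom C X Y" "g \<in> Hom C Y Z" "h \<in> Hom C Z (ob \<Sigma> X)" using T by auto
  have X: "X \<in> Obj C" "Y \<in> Obj C" "Z \<in> Obj C" using H Hom_Obj by blast+
  have m: "a \<in> Hom C X X'" "b \<in> Hom C Y Y'" "c \<in> Hom C Z Z'"
    "b \<cdot> f = f' \<cdot> a" "c \<cdot> g = g' \<cdot> b" "ar \<Sigma> a \<cdot> h = h' \<cdot> c" using i by auto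
  have m': "a' \<in> Hom C X' X" "b' \<in> Hom C Y' Y" "c' \<in> Hom C Z' Z"
    "b' \<cdot> f' = f \<cdot> a'" "c' \<cdot> g' = g \<cdot> b'" "ar \<Sigma> a' \<cdot> h' = h \<cdot> c'" using p by auto
  note S = \<Sigma>.ar_Hom[OF m(1)] \<Sigma>.ar_Hom[OF m'(1)]
  have Saa: "ar \<Sigma> a' \<cdot> ar \<Sigma> a = ident C (ob \<Sigma> X)"
    using \<Sigma>.ar_comp[OF m(1) m'(1)] pi(1) \<Sigma>.ar_ident X by simp
  obtain Z0 g0 h0 where T0: "Triangle X Y Z0 f g0 h0 \<in> \<Delta>" using dist_cone[OF H(1)] by blast
  note H0 = dist_Hom[OF T0]
  obtain \<theta>' where \<theta>': "\<theta>' \<in> Hom C Z' Z0" "\<theta>' \<cdot> g' = g0 \<cdot> b'" "ar \<Sigma> a' \<cdot> h' = h0 \<cdot> \<theta>'"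
    using dist_completeE[OF T' T0 m'(1,2,4)] .
  obtain \<zeta>' where \<zeta>': "\<zeta>' \<in> Hom C Z0 Z'" "\<zeta>' \<cdot> g0 = g' \<cdot> b" "ar \<Sigma> a \<cdot> h0 = h' \<cdot> \<zeta>'"
    using dist_completeE[OF T0 T' m(1,2,4)] .
  define \<theta> where "\<theta> = \<theta>' \<cdot> c"
  define \<zeta> where "\<zeta> = c' \<cdot> \<zeta>'"
  have \<theta>: "\<theta> \<in> Hom C Z Z0" unfolding \<theta>_def using comp_Hom[OF m(3) \<theta>'(1)] .
  have \<zeta>: "\<zeta> \<in> Hom C Z0 Z" unfolding \<zeta>_def using comp_Hom[OF \<zeta>'(1) m'(3)] .
  have \<theta>g: "\<theta> \<cdot> g = g0"
    unfolding \<theta>_def using comp_eq_right[OF m(5) H(2) m(3) \<theta>'(1)] comp_eq_left[OF \<theta>'(2) m(2) H'(2) \<theta>'(1)]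
      comp_eq_right[OF pi(2) m(2) m'(2) H0(2)] comp_ident[OF H0(2)] by simp
  have h\<theta>: "h0 \<cdot> \<theta> = h"
    unfolding \<theta>_def using comp_eq_left[OF \<theta>'(3)[symmetric] m(3) \<theta>'(1) H0(3)]
      comp_eq_right[OF m(6)[symmetric] m(3) H'(3) S(2)] comp_eq_left[OF Saa H(3) S] ident_comp[OF H(3)] by simp
  have \<zeta>g: "\<zeta> \<cdot> g0 = g"
    unfolding \<zeta>_def using comp_eq_right[OF \<zeta>'(2) H0(2) \<zeta>'(1) m'(3)] comp_eq_left[OF m'(5) m(2) H'(2) m'(3)]
      comp_eq_right[OF pi(2) m(2) m'(2) H(2)] comp_ident[OF H(2)] by simp
  have h\<zeta>: "h \<cdot> \<zeta> = h0"
    unfolding \<zeta>_def using comp_eq_left[OF m'(6)[symmetric] \<zeta>'(1) m'(3) H(3)]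
      comp_eq_right[OF \<zeta>'(3)[symmetric] \<zeta>'(1) H'(3) S(2)] comp_eq_left[OF Saa H0(3) S] ident_comp[OF H0(3)] by simp
  have "is_iso C Z0 Z0 (\<theta> \<cdot> \<zeta>)"
    using dist_endo_iso[OF T0 comp_Hom[OF \<zeta> \<theta>]] comp_eq_right[OF \<zeta>g H0(2) \<zeta> \<theta>] \<theta>g
      comp_eq_left[OF h\<theta> \<zeta> \<theta> H0(3)] h\<zeta> by simp
  moreover have "is_iso C Z Z (\<zeta> \<cdot> \<theta>)"
  proof -
    \<comment> \<open>The triangle on \<open>Z\<close> is not yet known to be distinguished, so the
      error is moved to \<open>Z'\<close> as \<open>c \<cdot> (d \<cdot> c')\<close>, which kills
      \<open>g'\<close> and factors as \<open>s \<cdot> h'\<close>. Composing with \<open>c\<close>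
      gives \<open>c \<cdot> d = s \<cdot> (h' \<cdot> c)\<close>. Since
      \<open>h' \<cdot> c = \<Sigma> a \<cdot> h\<close> and \<open>h \<cdot> d = 0\<close>, the map
      \<open>c \<cdot> d \<cdot> d\<close> vanishes; as \<open>c\<close> is a split monomorphism, so
      does \<open>d \<cdot> d\<close>.\<close>
    let ?d = "(\<zeta> \<cdot> \<theta>) \<boxplus> neg_mor C Z Z (ident C Z)"
    note i = ident_Hom[OF X(3)] and \<zeta>\<theta> = comp_Hom[OF \<theta> \<zeta>]
    have d: "?d \<in> Hom C Z Z" using \<zeta>\<theta> i by (intro add_Hom neg_Hom)
    have dg: "?d \<cdot> g = zero_mor C Y Z"
      using diff_comp_zero[OF H(2) \<zeta>\<theta> i] comp_eq_right[OF \<theta>g H(2) \<theta> \<zeta>] \<zeta>g ident_comp[OF H(2)] by simp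
    have hd: "h \<cdot> ?d = zero_mor C Z (ob \<Sigma> X)"
      using comp_diff_zero[OF \<zeta>\<theta> i H(3)] comp_eq_left[OF h\<zeta> \<theta> \<zeta> H(3)] h\<theta> comp_ident[OF H(3)] by simp
    note dc' = comp_Hom[OF m'(3) d]
    note cdc' = comp_Hom[OF dc' m(3)]
    have "(?d \<cdot> c') \<cdot> g' = zero_mor C Y' Z"
      using comp_eq_right[OF m'(5) H'(2) m'(3) d] comp_eq_left[OF dg m'(2) H(2) d] zero_comp[OF m'(2) X(3)] by simp
    then have "(c \<cdot> (?d \<cdot> c')) \<cdot> g' = zero_mor C Y' Z'"
      using comp_eq_right[OF _ H'(2) dc' m(3)] comp_zero[OF m(3) H'(5)] by simp
    then obtain s where s: "s \<in> Hom C (ob \<Sigma> X') Z'" "c \<cdot> (?d \<cdot> c') = s \<cdot> h'"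
      using weak_cokernel[OF T' cdc'] by blast
    have SX: "ob \<Sigma> X' \<in> Obj C" using H'(3) Hom_Obj by blast
    have "c \<cdot> ?d = (c \<cdot> (?d \<cdot> c')) \<cdot> c"
      using comp_eq_right[OF comp_eq_right[OF pi(3) m(3) m'(3) d] m(3) dc' m(3)] comp_ident[OF d] by simp
    then have cd: "c \<cdot> ?d = s \<cdot> (h' \<cdot> c)" using s comp_assoc[OF m(3) H'(3) s(1)] by simp
    note h'c = comp_Hom[OF m(3) H'(3)]
    have "(h' \<cdot> c) \<cdot> ?d = zero_mor C Z (ob \<Sigma> X')"
      using comp_eq_right[OF hd d H(3) S(1)] m(6) comp_zero[OF S(1) X(3)] by simp
    then have "(c \<cdot> ?d) \<cdot> ?d = zero_mor C Z Z'"
      unfolding cd using comp_eq_right[OF _ d h'c s(1)] comp_zero[OF s(1) X(3)] by simp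
    then have "c \<cdot> (?d \<cdot> ?d) = zero_mor C Z Z'" using comp_assoc[OF d d m(3)] by simp
    then have "?d \<cdot> ?d = c' \<cdot> zero_mor C Z Z'"
      using comp_eq_left[OF pi(3) comp_Hom[OF d d] m(3) m'(3)] ident_comp[OF comp_Hom[OF d d]] by simp
    then have "?d \<cdot> (?d \<cdot> ?d) = zero_mor C Z Z"
      using comp_zero[OF m'(3) X(3)] comp_zero[OF d X(3)] by simp
    then have "is_iso C Z Z (ident C Z \<boxplus> ?d)" using nilpotent_iso[OF d] by simp
    then show ?thesis using add_diff_cancel[OF i \<zeta>\<theta>] by simp
  qed
  ultimately have "is_iso C Z0 Z \<zeta>" using is_iso_if_left_right[OF \<zeta> \<theta> \<theta>] by blast
  from dist_iso_third[OF T0 this H(3) h\<zeta>] show ?thesis by (simp add: \<zeta>g)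
qed

text \<open>The connecting map \<open>h\<close> of any cone of \<open>i2\<close> satisfies
  \<open>\<Sigma> i2 \<cdot> h = 0\<close>, so \<open>h = 0\<close> because
  \<open>\<Sigma> i2\<close> is split. Then \<open>p1\<close> factors through \<open>g\<close> as
  \<open>c \<cdot> g\<close>, and \<open>g \<cdot> i1\<close> inverts \<open>c\<close> up to
  automorphisms.\<close>

lemma dist_split:
  assumes B: "is_biproduct C P Q B i1 i2 p1 p2"
  shows "Triangle Q B P i2 p1 (zero_mor C P (ob \<Sigma> Q)) \<in> \<Delta>"
proof -
  have b: "i1 \<in> Hom C P B" "i2 \<in> Hom C Q B" "p1 \<in> Hom C B P" "p2 \<in> Hom C B Q"
    "p1 \<cdot> i1 = ident C P" "p2 \<cdot> i2 = ident C Q" "p1 \<cdot> i2 = zero_mor C Q P" "p2 \<cdot> i1 = zero_mor C P Q"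
    "(i1 \<cdot> p1) \<boxplus> (i2 \<cdot> p2) = ident C B"
    using B unfolding is_biproduct_def by blast+
  have PQ: "P \<in> Obj C" "Q \<in> Obj C" using b(1,2) Hom_Obj by blast+
  obtain Z g h where T: "Triangle Q B Z i2 g h \<in> \<Delta>" using dist_cone[OF b(2)] by blast
  note H = dist_Hom[OF T]
  note Si2 = \<Sigma>.ar_Hom[OF b(2)] and Sp2 = \<Sigma>.ar_Hom[OF b(4)]
  have SQB: "ob \<Sigma> Q \<in> Obj C" "ob \<Sigma> B \<in> Obj C" using Si2 Hom_Obj by blast+
  have "neg_mor C Z (ob \<Sigma> B) (ar \<Sigma> i2 \<cdot> h) = zero_mor C Z (ob \<Sigma> B)"
    using dist_comp_zero(2)[OF dist_rotateD[OF T]] neg_comp[OF H(3) Si2] by simp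
  then have "ar \<Sigma> i2 \<cdot> h = zero_mor C Z (ob \<Sigma> B)"
    using neg_neg[OF comp_Hom[OF H(3) Si2]] neg_zero[OF H(6) SQB(2)] by simp
  then have "ident C (ob \<Sigma> Q) \<cdot> h = zero_mor C Z (ob \<Sigma> Q)"
    using comp_eq_left[OF _ H(3) Si2 Sp2] \<Sigma>.ar_comp[OF b(2,4)] b(6) \<Sigma>.ar_ident[OF PQ(2)] comp_zero[OF Sp2 H(6)]
    by simp
  then have h0: "h = zero_mor C Z (ob \<Sigma> Q)" using ident_comp[OF H(3)] by simp
  obtain N where N: "is_zero_object C N" using zero_object_ex by blast
  have No: "N \<in> Obj C" using N unfolding is_zero_object_def by blast
  have "p1 \<cdot> i2 = zero_mor C N P \<cdot> zero_mor C Q N"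
    using b(7) zero_comp[OF zero_Hom[OF PQ(2) No] PQ(1)] by simp
  then obtain c where c: "c \<in> Hom C Z P" "c \<cdot> g = ident C P \<cdot> p1"
    using dist_completeE[OF T dist_ident_right[OF N PQ(1)] zero_Hom[OF PQ(2) No] b(3)] by metis
  have cg: "c \<cdot> g = p1" using c ident_comp b(3) by simp
  note gi = comp_Hom[OF b(1) H(2)]
  have "c \<cdot> (g \<cdot> i1) = ident C P" using comp_eq_left[OF cg b(1) H(2) c(1)] b(5) by simp
  then have r: "is_iso C P P (c \<cdot> (g \<cdot> i1))" using is_iso_ident PQ(1) by simp
  have "((g \<cdot> i1) \<cdot> c) \<cdot> g = g \<cdot> (i1 \<cdot> p1)"
    using comp_eq_right[OF cg H(2) c(1) gi] comp_assoc[OF b(3,1) H(2)] by simp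
  also have "\<dots> = g \<cdot> ((i1 \<cdot> p1) \<boxplus> (i2 \<cdot> p2))"
    using comp_add[OF comp_Hom[OF b(3,1)] comp_Hom[OF b(4,2)] H(2)] comp_eq_left[OF dist_comp_zero(1)[OF T] b(4,2) H(2)]
      zero_comp[OF b(4) H(6)] add_zero[OF comp_Hom[OF comp_Hom[OF b(3,1)] H(2)]] by simp
  also have "\<dots> = g" using b(9) comp_ident[OF H(2)] by simp
  finally have "is_iso C Z Z ((g \<cdot> i1) \<cdot> c)"
    using dist_endo_iso[OF T comp_Hom[OF c(1) gi]] h0 zero_comp[OF comp_Hom[OF c(1) gi] SQB(1)] by simp
  then have iso: "is_iso C Z P c" using is_iso_if_left_right[OF c(1) gi gi _ r] by blast
  show ?thesis
    using dist_iso_third[OF T iso zero_Hom[OF PQ(1) SQB(1)]] zero_comp[OF c(1) SQB(1)] h0 cg by simp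
qed

end

section \<open>Equivalences are full and faithful\<close>

lemma faithful_if_left_inverse:
  assumes F: "is_functor C D F" and G: "is_functor D C G"
    and \<alpha>: "nat_iso C C (G \<circ>\<^sub>F F) id_func \<alpha>"
    and f: "f \<in> Hom C X Y" "f' \<in> Hom C X Y" "ar F f = ar F f'"
  shows "f = f'"
proof -
  interpret nat_iso C C "G \<circ>\<^sub>F F" id_func \<alpha> by (rule \<alpha>)
  interpret F: is_functor C D F by (rule F)
  have X: "X \<in> Obj C" using f F.C.Hom_Obj by blast
  have "f \<cdot>\<^bsub>C\<^esub> \<alpha> X = f' \<cdot>\<^bsub>C\<^esub> \<alpha> X"
    using naturality[OF f(1)] naturality[OF f(2)] f(3) by (simp add: id_func_def comp_func_def)
  then show ?thesis
    using F.C.iso_cancel_right[OF component_iso[OF X]] f by (simp add: id_func_def)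
qed

lemma equivalence_faithful:
  assumes "is_equivalence C D F" "f \<in> Hom C X Y" "f' \<in> Hom C X Y" "ar F f = ar F f'"
  shows "f = f'"
  using assms faithful_if_left_inverse[of C D F] unfolding is_equivalence_def by blast

text \<open>The preimage is \<open>G h\<close> conjugated by \<open>\<alpha>\<close>. After applying
  \<open>G\<close>, its image agrees with \<open>h\<close>, and \<open>G\<close> is faithful by
  means of \<open>\<beta>\<close>.\<close>

lemma equivalence_full:
  assumes E: "is_equivalence C D F" and XY: "X \<in> Obj C" "Y \<in> Obj C"
    and h: "h \<in> Hom D (ob F X) (ob F Y)"
  obtains f where "f \<in> Hom C X Y" "ar F f = h"
proof -
  obtain G \<alpha> \<beta> where F: "is_functor C D F" and G: "is_functor D C G"
    and \<alpha>: "nat_iso C C (G \<circ>\<^sub>F F) id_func \<alpha>" and \<beta>: "nat_iso D D (F \<circ>\<^sub>F G) id_func \<beta>"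
    using E unfolding is_equivalence_def by blast
  interpret nat_iso C C "G \<circ>\<^sub>F F" id_func \<alpha> by (rule \<alpha>)
  interpret F: is_functor C D F by (rule F)
  interpret G: is_functor D C G by (rule G)
  note Gh = G.ar_Hom[OF h]
  have a: "is_iso C (ob G (ob F X)) X (\<alpha> X)" "is_iso C (ob G (ob F Y)) Y (\<alpha> Y)"
    using component_iso XY by (simp_all add: id_func_def comp_func_def)
  obtain a' where a': "\<alpha> X \<in> Hom C (ob G (ob F X)) X" "a' \<in> Hom C X (ob G (ob F X))"
    "a' \<cdot>\<^bsub>C\<^esub> \<alpha> X = ident C (ob G (ob F X))"
    using a(1) by (rule F.C.is_isoE)
  have aY: "\<alpha> Y \<in> Hom C (ob G (ob F Y)) Y" using a(2) unfolding is_iso_def by blast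
  note aG = F.C.comp_Hom[OF Gh aY]
  define f where "f = (\<alpha> Y \<cdot>\<^bsub>C\<^esub> ar G h) \<cdot>\<^bsub>C\<^esub> a'"
  have f: "f \<in> Hom C X Y" unfolding f_def using F.C.comp_Hom[OF a'(2) aG] .
  have "f \<cdot>\<^bsub>C\<^esub> \<alpha> X = \<alpha> Y \<cdot>\<^bsub>C\<^esub> ar G h"
    unfolding f_def using F.C.comp_eq_right[OF a'(3,1,2) aG] F.C.comp_ident[OF aG] by simp
  then have "\<alpha> Y \<cdot>\<^bsub>C\<^esub> ar G (ar F f) = \<alpha> Y \<cdot>\<^bsub>C\<^esub> ar G h"
    using naturality[OF f] by (simp add: id_func_def comp_func_def)
  then have "ar G (ar F f) = ar G h"
    using F.C.iso_cancel_left[OF a(2) G.ar_Hom[OF F.ar_Hom[OF f]] Gh] by blast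
  then have "ar F f = h"
    using faithful_if_left_inverse[OF G F \<beta> F.ar_Hom[OF f] h] by blast
  then show thesis using that f by blast
qed

section \<open>Split octahedra and weak kernels in a triangulated category\<close>

sublocale triangulated_category \<subseteq> pre: pretriangulated_category C \<Sigma> \<Delta>
  by unfold_locales (erule dist_triangle, erule (2) TR1_iso, erule (1) TR1_ident, erule TR1_cone,
    erule TR2, erule (4) TR3)

text \<open>TR4 is applied to \<open>m\<close> followed by \<open>p1\<close>, with
  \<open>\<Sigma> Q\<close> as cone of \<open>p1\<close>. It provides \<open>v\<close> with
  \<open>-\<Sigma> i2 \<cdot> v = \<Sigma> m \<cdot> t\<close>; composing with
  \<open>\<Sigma> p2\<close> determines \<open>v\<close>. Rotating back moves \<open>Q\<close> to
  the front.\<close>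

sublocale triangulated_category \<subseteq> pre: split_octahedral_category C \<Sigma> \<Delta>
proof
  fix P Q B i1 i2 p1 p2 Y m W n w S s t
  assume B: "is_biproduct C P Q B i1 i2 p1 p2" and T: "Triangle Y B W m n w \<in> \<Delta>"
    and T1: "Triangle Y P S (p1 \<cdot> m) s t \<in> \<Delta>"
  have b: "i1 \<in> Hom C P B" "i2 \<in> Hom C Q B" "p1 \<in> Hom C B P" "p2 \<in> Hom C B Q"
    "p1 \<cdot> i1 = ident C P" "p2 \<cdot> i2 = ident C Q"
    using B unfolding is_biproduct_def by blast+
  note H = pre.dist_Hom[OF T] and H1 = pre.dist_Hom[OF T1]
  note Q = Hom_Obj[OF b(2), THEN conjunct1]
  note Sn = \<Sigma>.ar_Hom[OF H(2)] and Si2 = \<Sigma>.ar_Hom[OF b(2)] and Sp2 = \<Sigma>.ar_Hom[OF b(4)] and Sm = \<Sigma>.ar_Hom[OF H(1)]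
  let ?k = "neg_mor C (ob \<Sigma> Q) (ob \<Sigma> B) (ar \<Sigma> i2)"
  have "Triangle B P (ob \<Sigma> Q) p1 (zero_mor C P (ob \<Sigma> Q)) ?k \<in> \<Delta>"
    using pre.dist_rotateD[OF pre.dist_split[OF B]] .
  from TR4[OF T this T1] obtain u v where
    uv: "Triangle W S (ob \<Sigma> Q) u v (ar \<Sigma> n \<cdot> ?k) \<in> \<Delta>"
    and e: "u \<cdot> n = s \<cdot> p1" "t \<cdot> u = w" "?k \<cdot> v = ar \<Sigma> m \<cdot> t"
    by blast
  note U = pre.dist_Hom[OF uv]
  have k: "ar \<Sigma> n \<cdot> ?k = neg_mor C (ob \<Sigma> Q) (ob \<Sigma> W) (ar \<Sigma> (n \<cdot> i2))"
    using comp_neg[OF Si2 Sn] \<Sigma>.ar_comp[OF b(2) H(2)] by simp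
  have "ar \<Sigma> p2 \<cdot> ?k = neg_mor C (ob \<Sigma> Q) (ob \<Sigma> Q) (ident C (ob \<Sigma> Q))"
    using comp_neg[OF Si2 Sp2] \<Sigma>.ar_comp[OF b(2,4)] b(6) \<Sigma>.ar_ident[OF Q] by simp
  then have "ar \<Sigma> p2 \<cdot> (?k \<cdot> v) = neg_mor C S (ob \<Sigma> Q) v"
    using comp_eq_left[OF _ U(2) neg_Hom[OF Si2] Sp2] neg_comp[OF U(2) ident_Hom[OF U(6)]] ident_comp[OF U(2)] by simp
  then have "neg_mor C S (ob \<Sigma> Q) v = ar \<Sigma> (p2 \<cdot> m) \<cdot> t"
    using e(3) comp_assoc[OF H1(3) Sm Sp2] \<Sigma>.ar_comp[OF H(1) b(4)] by simp
  then have "v = neg_mor C S (ob \<Sigma> Q) (ar \<Sigma> (p2 \<cdot> m) \<cdot> t)"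
    using neg_neg[OF U(2)] by simp
  moreover have "Triangle Q W S (n \<cdot> i2) u v \<in> \<Delta>"
    using pre.dist_rotate[of Q W S "n \<cdot> i2" u v] uv[unfolded k] U comp_Hom[OF b(2) H(2)] by simp
  ultimately show "\<exists>u. u \<in> Hom C W S \<and> u \<cdot> n = s \<cdot> p1 \<and> t \<cdot> u = w \<and>
      Triangle Q W S (n \<cdot> i2) u (neg_mor C S (ob \<Sigma> Q) (ar \<Sigma> (p2 \<cdot> m) \<cdot> t)) \<in> \<Delta>"
    using e U(1) by blast
qed

context triangulated_category
begin

lemmas suspension_faithful = equivalence_faithful[OF \<Sigma>_equivalence]
lemmas suspension_full = equivalence_full[OF \<Sigma>_equivalence]

text \<open>The pair \<open>(t, 0)\<close> maps the rotated identity triangle on \<open>W\<close> to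
  the doubly rotated given one. The third component runs from \<open>\<Sigma> W\<close> to
  \<open>\<Sigma> Y\<close>; fullness of the suspension desuspends it to \<open>s\<close>, and the
  two signs cancel.\<close>

lemma weak_kernel:
  assumes T: "Triangle X Y Z f g h \<in> \<Delta>" and t: "t \<in> Hom C W Z" "h \<cdot> t = zero_mor C W (ob \<Sigma> X)"
  obtains s where "s \<in> Hom C W Y" "t = g \<cdot> s"
proof -
  note H = pre.dist_Hom[OF T]
  note T2 = pre.dist_rotateD[OF pre.dist_rotateD[OF T]]
  have W: "W \<in> Obj C" using t Hom_Obj by blast
  have SX: "ob \<Sigma> X \<in> Obj C" "ob \<Sigma> W \<in> Obj C" using H W \<Sigma>.ob_Obj by blast+
  obtain N where N: "is_zero_object C N" using zero_object_ex by blast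
  have No: "N \<in> Obj C" using N unfolding is_zero_object_def by blast
  note iW = ident_Hom[OF SX(2)]
  have TN: "Triangle W N (ob \<Sigma> W) (zero_mor C W N) (zero_mor C N (ob \<Sigma> W))
      (neg_mor C (ob \<Sigma> W) (ob \<Sigma> W) (ident C (ob \<Sigma> W))) \<in> \<Delta>"
    using pre.dist_rotateD[OF pre.dist_ident[OF W N]] \<Sigma>.ar_ident[OF W] by simp
  have "zero_mor C N (ob \<Sigma> X) \<cdot> zero_mor C W N = h \<cdot> t"
    using t zero_comp[OF zero_Hom[OF W No] SX(1)] by simp
  from TN T2 t(1) zero_Hom[OF No SX(1)] this
  obtain c where c: "c \<in> Hom C (ob \<Sigma> W) (ob \<Sigma> Y)"
    "ar \<Sigma> t \<cdot> neg_mor C (ob \<Sigma> W) (ob \<Sigma> W) (ident C (ob \<Sigma> W)) = neg_mor C (ob \<Sigma> Y) (ob \<Sigma> Z) (ar \<Sigma> g) \<cdot> c"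
    by (rule pre.dist_completeE)
  obtain s where s: "s \<in> Hom C W Y" "ar \<Sigma> s = c" using suspension_full[OF W H(5) c(1)] .
  note St = \<Sigma>.ar_Hom[OF t(1)] and Sg = \<Sigma>.ar_Hom[OF H(2)]
  have "neg_mor C (ob \<Sigma> W) (ob \<Sigma> Z) (ar \<Sigma> t) = neg_mor C (ob \<Sigma> W) (ob \<Sigma> Z) (ar \<Sigma> g \<cdot> c)"
    using c(2) comp_neg[OF iW St] comp_ident[OF St] neg_comp[OF c(1) Sg] by simp
  then have "ar \<Sigma> t = ar \<Sigma> g \<cdot> c"
    using neg_neg[OF St] neg_neg[OF comp_Hom[OF c(1) Sg]] by metis
  then have "ar \<Sigma> t = ar \<Sigma> (g \<cdot> s)"
    using \<Sigma>.ar_comp[OF s(1) H(2)] s(2) by simp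
  then show thesis
    using that s(1) suspension_faithful[OF t(1) comp_Hom[OF s(1) H(2)]] by blast
qed

end

section \<open>The Eilenberg-Moore category\<close>

context monad
begin

abbreviation EM where "EM \<equiv> EM_category C M \<eta> \<mu>"
abbreviation free where "free X \<equiv> (ob M X, \<mu> X)"

lemma eta_Hom: "X \<in> Obj C \<Longrightarrow> \<eta> X \<in> Hom C X (ob M X)"
  and eta_natural: "f \<in> Hom C X Y \<Longrightarrow> \<eta> Y \<cdot> f = ar M f \<cdot> \<eta> X"
  using \<eta>.component \<eta>.naturality by (simp_all add: id_func_def)

lemma mu_Hom: "X \<in> Obj C \<Longrightarrow> \<mu> X \<in> Hom C (ob M (ob M X)) (ob M X)"
  and mu_natural: "f \<in> Hom C X Y \<Longrightarrow> \<mu> Y \<cdot> ar M (ar M f) = ar M f \<cdot> \<mu> X"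
  using \<mu>.component \<mu>.naturality by (simp_all add: comp_func_def)

text \<open>Module maps are base morphisms with the same composition and addition, so an equation
  between them is an equation in \<open>C\<close>; only membership in a Hom-set is new.\<close>

lemma EM_simps:
  "Obj EM = EM_Obj C M \<eta> \<mu>" "comp EM = comp C" "add_mor EM = add_mor C"
  "ident EM A = ident C (fst A)" "zero_mor EM A B = zero_mor C (fst A) (fst B)"
  by (simp_all add: EM_category_def case_prod_beta)

lemma EM_Hom_iff:
  "a \<in> Hom EM A B \<longleftrightarrow> a \<in> Hom C (fst A) (fst B) \<and> A \<in> EM_Obj C M \<eta> \<mu> \<and> B \<in> EM_Obj C M \<eta> \<mu> \<and>
     a \<cdot> snd A = snd B \<cdot> ar M a"
  by (auto simp add: EM_category_def case_prod_beta)

lemma EM_HomD: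
  assumes "a \<in> Hom EM A B"
  shows "a \<in> Hom C (fst A) (fst B)" "A \<in> EM_Obj C M \<eta> \<mu>" "B \<in> EM_Obj C M \<eta> \<mu>"
    "a \<cdot> snd A = snd B \<cdot> ar M a"
  using assms unfolding EM_Hom_iff by auto

lemma EM_ObjD:
  assumes "A \<in> EM_Obj C M \<eta> \<mu>"
  shows "fst A \<in> Obj C" "snd A \<in> Hom C (ob M (fst A)) (fst A)"
    "snd A \<cdot> \<eta> (fst A) = ident C (fst A)" "snd A \<cdot> ar M (snd A) = snd A \<cdot> \<mu> (fst A)"
  using assms unfolding EM_Obj_def by auto

lemma EM_ObjI:
  assumes "X \<in> Obj C" "\<rho> \<in> Hom C (ob M X) X" "\<rho> \<cdot> \<eta> X = ident C X" "\<rho> \<cdot> ar M \<rho> = \<rho> \<cdot> \<mu> X"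
  shows "(X, \<rho>) \<in> EM_Obj C M \<eta> \<mu>"
  using assms unfolding EM_Obj_def by simp

lemma module_map_comp:
  assumes a: "a \<in> Hom EM A B" and b: "b \<in> Hom EM B D"
  shows "b \<cdot> a \<in> Hom EM A D"
proof -
  note a = EM_HomD[OF a] and b = EM_HomD[OF b]
  have "(b \<cdot> a) \<cdot> snd A = b \<cdot> (snd B \<cdot> ar M a)"
    using C.comp_eq_right[OF a(4) _ a(1) b(1)] EM_ObjD[OF a(2)] by simp
  also have "\<dots> = (snd D \<cdot> ar M b) \<cdot> ar M a"
    using C.comp_eq_left[OF b(4) ar_Hom[OF a(1)] _ b(1)] EM_ObjD[OF a(3)] by simp
  also have "\<dots> = snd D \<cdot> ar M (b \<cdot> a)"
    using C.comp_assoc[OF ar_Hom[OF a(1)] ar_Hom[OF b(1)]] EM_ObjD[OF b(3)] ar_comp[OF a(1) b(1)] by simp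
  finally show ?thesis using a b C.comp_Hom unfolding EM_Hom_iff by blast
qed

lemma category_EM: "category EM"
proof
  fix a A B
  assume a: "a \<in> Hom EM A B"
  show "A \<in> Obj EM \<and> B \<in> Obj EM" using EM_HomD[OF a] by (simp add: EM_simps)
  show "a \<cdot>\<^bsub>EM\<^esub> ident EM A = a" "ident EM B \<cdot>\<^bsub>EM\<^esub> a = a"
    using EM_HomD[OF a] by (simp_all add: EM_simps C.comp_ident C.ident_comp)
next
  fix A assume "A \<in> Obj EM"
  then have A: "A \<in> EM_Obj C M \<eta> \<mu>" by (simp add: EM_simps)
  show "ident EM A \<in> Hom EM A A"
    unfolding EM_Hom_iff EM_simps using A EM_ObjD[OF A]
    by (simp add: C.ident_Hom ar_ident C.comp_ident C.ident_comp)
next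
  fix a A B b D assume "a \<in> Hom EM A B" "b \<in> Hom EM B D"
  then show "b \<cdot>\<^bsub>EM\<^esub> a \<in> Hom EM A D" using module_map_comp by (simp add: EM_simps)
next
  fix a A B b D d E assume "a \<in> Hom EM A B" "b \<in> Hom EM B D" "d \<in> Hom EM D E"
  then show "d \<cdot>\<^bsub>EM\<^esub> (b \<cdot>\<^bsub>EM\<^esub> a) = (d \<cdot>\<^bsub>EM\<^esub> b) \<cdot>\<^bsub>EM\<^esub> a"
    using C.comp_assoc[OF EM_HomD(1) EM_HomD(1) EM_HomD(1)] by (simp add: EM_simps)
qed

lemma module_map_add:
  assumes a: "a \<in> Hom EM A B" and b: "b \<in> Hom EM A B"
  shows "a \<boxplus> b \<in> Hom EM A B"
  using EM_HomD[OF a] EM_HomD[OF b] EM_ObjD(2)[OF EM_HomD(2)[OF a]] EM_ObjD(2)[OF EM_HomD(3)[OF a]]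
  unfolding EM_Hom_iff
  by (simp add: C.add_Hom ar_add C.add_comp C.comp_add[OF ar_Hom ar_Hom])

lemma module_map_zero:
  assumes A: "A \<in> EM_Obj C M \<eta> \<mu>" and B: "B \<in> EM_Obj C M \<eta> \<mu>"
  shows "zero_mor C (fst A) (fst B) \<in> Hom EM A B"
  using A B EM_ObjD[OF A] EM_ObjD[OF B] unfolding EM_Hom_iff
  by (simp add: C.zero_Hom ar_zero C.zero_comp C.comp_zero ob_Obj)

lemma module_map_neg:
  assumes a: "a \<in> Hom EM A B"
  shows "neg_mor C (fst A) (fst B) a \<in> Hom EM A B"
  using EM_HomD[OF a] EM_ObjD(2)[OF EM_HomD(2)[OF a]] EM_ObjD(2)[OF EM_HomD(3)[OF a]]
  unfolding EM_Hom_iff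
  by (simp add: C.neg_Hom ar_neg C.neg_comp C.comp_neg[OF ar_Hom])

lemma comm_group_EM:
  assumes A: "A \<in> EM_Obj C M \<eta> \<mu>" and B: "B \<in> EM_Obj C M \<eta> \<mu>"
  shows "comm_group (Hom_group EM A B)"
proof (rule comm_groupI)
  fix a assume "a \<in> carrier (Hom_group EM A B)"
  then have a: "a \<in> Hom EM A B" by (simp add: Hom_group_def)
  note a' = EM_HomD(1)[OF a]
  show "\<one>\<^bsub>Hom_group EM A B\<^esub> \<otimes>\<^bsub>Hom_group EM A B\<^esub> a = a"
    using C.zero_add[OF a'] by (simp add: Hom_group_def EM_simps)
  show "\<exists>b\<in>carrier (Hom_group EM A B). b \<otimes>\<^bsub>Hom_group EM A B\<^esub> a = \<one>\<^bsub>Hom_group EM A B\<^esub>"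
    using module_map_neg[OF a] C.add_neg[OF a'] C.add_commute[OF a' C.neg_Hom[OF a']]
    by (auto simp: Hom_group_def EM_simps)
  fix b assume "b \<in> carrier (Hom_group EM A B)"
  then have b: "b \<in> Hom EM A B" by (simp add: Hom_group_def)
  note b' = EM_HomD(1)[OF b]
  show "a \<otimes>\<^bsub>Hom_group EM A B\<^esub> b \<in> carrier (Hom_group EM A B)"
    using module_map_add[OF a b] by (simp add: Hom_group_def EM_simps)
  show "a \<otimes>\<^bsub>Hom_group EM A B\<^esub> b = b \<otimes>\<^bsub>Hom_group EM A B\<^esub> a"
    using C.add_commute[OF a' b'] by (simp add: Hom_group_def EM_simps)
  fix d assume "d \<in> carrier (Hom_group EM A B)"
  then have "d \<in> Hom C (fst A) (fst B)" using EM_HomD(1) by (simp add: Hom_group_def)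
  then show "a \<otimes>\<^bsub>Hom_group EM A B\<^esub> b \<otimes>\<^bsub>Hom_group EM A B\<^esub> d = a \<otimes>\<^bsub>Hom_group EM A B\<^esub> (b \<otimes>\<^bsub>Hom_group EM A B\<^esub> d)"
    using C.add_assoc[OF a' b'] by (simp add: Hom_group_def EM_simps)
qed (use module_map_zero[OF A B] in \<open>simp add: Hom_group_def EM_simps\<close>)

text \<open>Negation is the inverse in a Hom-group, and so depends formally on its carrier; this
  identifies the module version with the base version.\<close>

lemma neg_mor_EM:
  assumes a: "a \<in> Hom EM A B"
  shows "neg_mor EM A B a = neg_mor C (fst A) (fst B) a"
proof -
  interpret comm_group "Hom_group EM A B"
    using comm_group_EM EM_HomD[OF a] by blast
  show ?thesis
    unfolding neg_mor_def[of EM]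
    using inv_equality[of "neg_mor C (fst A) (fst B) a" a] a module_map_neg[OF a] EM_HomD(1)[OF a]
      C.add_neg C.add_commute[OF EM_HomD(1)[OF a] C.neg_Hom[OF EM_HomD(1)[OF a]]]
    by (simp add: Hom_group_def EM_simps)
qed

text \<open>The action \<open>\<tau>\<close> on the base biproduct is the only one for which
  \<open>p1\<close> and \<open>p2\<close> are linear, namely
  \<open>p1 \<cdot> \<tau> = \<rho> \<cdot> M p1\<close> and likewise for \<open>p2\<close>. Its
  associativity is checked after each projection.\<close>

lemma biproduct_EM:
  assumes A: "A \<in> EM_Obj C M \<eta> \<mu>" and A': "A' \<in> EM_Obj C M \<eta> \<mu>"
  shows "\<exists>B i1 i2 p1 p2. is_biproduct EM A A' B i1 i2 p1 p2"
proof -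
  obtain X \<rho> X' \<rho>' where eq: "A = (X, \<rho>)" "A' = (X', \<rho>')" by (cases A, cases A') blast
  note H = EM_ObjD[OF A, unfolded eq fst_conv snd_conv] and H' = EM_ObjD[OF A', unfolded eq fst_conv snd_conv]
  obtain B i1 i2 p1 p2 where B: "is_biproduct C X X' B i1 i2 p1 p2"
    using C.biproduct_ex[OF H(1) H'(1)] by blast
  have b: "i1 \<in> Hom C X B" "i2 \<in> Hom C X' B" "p1 \<in> Hom C B X" "p2 \<in> Hom C B X'"
    "p1 \<cdot> i1 = ident C X" "p2 \<cdot> i2 = ident C X'" "p1 \<cdot> i2 = zero_mor C X' X" "p2 \<cdot> i1 = zero_mor C X X'"
    "(i1 \<cdot> p1) \<boxplus> (i2 \<cdot> p2) = ident C B"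
    using B unfolding is_biproduct_def by blast+
  have Bo: "B \<in> Obj C" using b(1) C.Hom_Obj by blast
  note Mb = ar_Hom[OF b(1)] ar_Hom[OF b(2)] ar_Hom[OF b(3)] ar_Hom[OF b(4)]
  have MX: "ob M X \<in> Obj C" "ob M X' \<in> Obj C" "ob M B \<in> Obj C" using ob_Obj H(1) H'(1) Bo by blast+
  define r1 where "r1 = \<rho> \<cdot> ar M p1"
  define r2 where "r2 = \<rho>' \<cdot> ar M p2"
  have r: "r1 \<in> Hom C (ob M B) X" "r2 \<in> Hom C (ob M B) X'"
    unfolding r1_def r2_def using C.comp_Hom Mb H(2) H'(2) by blast+
  define \<tau> where "\<tau> = (i1 \<cdot> r1) \<boxplus> (i2 \<cdot> r2)"
  have ir: "i1 \<cdot> r1 \<in> Hom C (ob M B) B" "i2 \<cdot> r2 \<in> Hom C (ob M B) B"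
    using C.comp_Hom b r by blast+
  have \<tau>: "\<tau> \<in> Hom C (ob M B) B" unfolding \<tau>_def using C.add_Hom[OF ir] .
  have p1: "p1 \<cdot> \<tau> = r1"
    unfolding \<tau>_def using C.comp_add[OF ir b(3)] C.comp_eq_left[OF b(5) r(1) b(1,3)]
      C.comp_eq_left[OF b(7) r(2) b(2,3)] C.ident_comp[OF r(1)] C.zero_comp[OF r(2) H(1)] C.add_zero[OF r(1)] by simp
  have p2: "p2 \<cdot> \<tau> = r2"
    unfolding \<tau>_def using C.comp_add[OF ir b(4)] C.comp_eq_left[OF b(8) r(1) b(1,4)]
      C.comp_eq_left[OF b(6) r(2) b(2,4)] C.ident_comp[OF r(2)] C.zero_comp[OF r(1) H'(1)] C.zero_add[OF r(2)] by simp
  have rM: "r1 \<cdot> ar M i1 = \<rho>" "r1 \<cdot> ar M i2 = zero_mor C (ob M X') X"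
    "r2 \<cdot> ar M i1 = zero_mor C (ob M X) X'" "r2 \<cdot> ar M i2 = \<rho>'"
    unfolding r1_def r2_def
    using C.comp_eq_right[OF ar_comp[OF b(1,3), symmetric] Mb(1,3) H(2)]
      C.comp_eq_right[OF ar_comp[OF b(2,3), symmetric] Mb(2,3) H(2)]
      C.comp_eq_right[OF ar_comp[OF b(1,4), symmetric] Mb(1,4) H'(2)]
      C.comp_eq_right[OF ar_comp[OF b(2,4), symmetric] Mb(2,4) H'(2)]
      b(5-8) ar_ident ar_zero H H' C.comp_ident C.comp_zero[OF H(2) MX(2)] C.comp_zero[OF H'(2) MX(1)] by simp_all
  have i1: "\<tau> \<cdot> ar M i1 = i1 \<cdot> \<rho>"
    unfolding \<tau>_def using C.add_comp[OF Mb(1) ir] C.comp_eq_right[OF rM(1) Mb(1) r(1) b(1)]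
      C.comp_eq_right[OF rM(3) Mb(1) r(2) b(2)] C.comp_zero[OF b(2) MX(1)] C.add_zero[OF C.comp_Hom[OF H(2) b(1)]] by simp
  have i2: "\<tau> \<cdot> ar M i2 = i2 \<cdot> \<rho>'"
    unfolding \<tau>_def using C.add_comp[OF Mb(2) ir] C.comp_eq_right[OF rM(2) Mb(2) r(1) b(1)]
      C.comp_eq_right[OF rM(4) Mb(2) r(2) b(2)] C.comp_zero[OF b(1) MX(2)] C.zero_add[OF C.comp_Hom[OF H'(2) b(2)]] by simp
  note e = eta_Hom[OF Bo] and m = mu_Hom[OF Bo] and MM = ar_Hom[OF \<tau>]
  have re: "r1 \<cdot> \<eta> B = p1" "r2 \<cdot> \<eta> B = p2"
    unfolding r1_def r2_def
    using C.comp_eq_right[OF eta_natural[OF b(3), symmetric] e Mb(3) H(2)] C.comp_eq_right[OF eta_natural[OF b(4), symmetric] e Mb(4) H'(2)]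
      C.comp_eq_left[OF H(3) b(3) eta_Hom[OF H(1)] H(2)] C.comp_eq_left[OF H'(3) b(4) eta_Hom[OF H'(1)] H'(2)]
      C.ident_comp[OF b(3)] C.ident_comp[OF b(4)] by simp_all
  have "\<tau> \<cdot> \<eta> B = ident C B"
    unfolding \<tau>_def using C.add_comp[OF e ir] C.comp_eq_right[OF re(1) e r(1) b(1)] C.comp_eq_right[OF re(2) e r(2) b(2)] b(9) by simp
  moreover have "\<tau> \<cdot> ar M \<tau> = \<tau> \<cdot> \<mu> B"
  proof -
    have *: "(\<rho> \<cdot> ar M p) \<cdot> ar M \<tau> = (\<rho> \<cdot> ar M p) \<cdot> \<mu> B"
      if p: "p \<in> Hom C B X" "p \<cdot> \<tau> = \<rho> \<cdot> ar M p" and H: "X \<in> Obj C" "\<rho> \<in> Hom C (ob M X) X" "\<rho> \<cdot> ar M \<rho> = \<rho> \<cdot> \<mu> X"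
      for p X \<rho>
    proof -
      note Mp = ar_Hom[OF p(1)]
      note MMp = ar_Hom[OF Mp] and M\<rho> = ar_Hom[OF H(2)]
      have "ar M p \<cdot> ar M \<tau> = ar M \<rho> \<cdot> ar M (ar M p)"
        using ar_comp[OF \<tau> p(1)] p(2) ar_comp[OF Mp H(2)] by simp
      then have "(\<rho> \<cdot> ar M p) \<cdot> ar M \<tau> = \<rho> \<cdot> (ar M \<rho> \<cdot> ar M (ar M p))"
        using C.comp_eq_right[OF _ MM Mp H(2)] by simp
      also have "\<dots> = \<rho> \<cdot> (\<mu> X \<cdot> ar M (ar M p))"
        using C.comp_eq_left[OF H(3) MMp M\<rho> H(2)] C.comp_assoc[OF MMp mu_Hom[OF H(1)] H(2)] by simp
      also have "\<dots> = (\<rho> \<cdot> ar M p) \<cdot> \<mu> B"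
        using mu_natural[OF p(1)] C.comp_assoc[OF m Mp H(2)] by simp
      finally show ?thesis .
    qed
    have "r1 \<cdot> ar M \<tau> = r1 \<cdot> \<mu> B" "r2 \<cdot> ar M \<tau> = r2 \<cdot> \<mu> B"
      using *[OF b(3) p1[unfolded r1_def] H(1,2,4)] *[OF b(4) p2[unfolded r2_def] H'(1,2,4)]
      unfolding r1_def r2_def by blast+
    then show ?thesis
      unfolding \<tau>_def using C.add_comp[OF MM ir] C.add_comp[OF m ir] C.comp_assoc[OF MM r(1) b(1)]
        C.comp_assoc[OF MM r(2) b(2)] C.comp_assoc[OF m r(1) b(1)] C.comp_assoc[OF m r(2) b(2)]
      by (simp add: \<tau>_def[symmetric])
  qed
  ultimately have "(B, \<tau>) \<in> EM_Obj C M \<eta> \<mu>" using EM_ObjI[OF Bo \<tau>] by blast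
  then have "is_biproduct EM A A' (B, \<tau>) i1 i2 p1 p2"
    unfolding is_biproduct_def EM_Hom_iff eq
    using A A' b p1 p2 i1 i2 by (simp add: eq EM_simps r1_def r2_def)
  then show ?thesis by blast
qed

lemma zero_object_EM: "\<exists>Z. is_zero_object EM Z"
proof -
  obtain Z where Z: "is_zero_object C Z" using C.zero_object_ex by blast
  then have Zo: "Z \<in> Obj C" unfolding is_zero_object_def by blast
  let ?z = "zero_mor C (ob M Z) Z"
  note z = C.zero_Hom[OF ob_Obj[OF Zo] Zo]
  have A: "(Z, ?z) \<in> EM_Obj C M \<eta> \<mu>"
    using EM_ObjI[OF Zo z] C.into_zero_object[OF Z C.comp_Hom[OF eta_Hom[OF Zo] z]]
      C.into_zero_object[OF Z C.ident_Hom[OF Zo]] C.into_zero_object[OF Z C.comp_Hom[OF mu_Hom[OF Zo] z]]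
      C.into_zero_object[OF Z C.comp_Hom[OF ar_Hom[OF z] z]] by simp
  have "\<exists>!f. f \<in> Hom EM B (Z, ?z)" "\<exists>!f. f \<in> Hom EM (Z, ?z) B" if B: "B \<in> EM_Obj C M \<eta> \<mu>" for B
    using module_map_zero[OF B A] module_map_zero[OF A B] C.into_zero_object[OF Z] C.from_zero_object[OF Z]
      EM_HomD(1)[of _ B "(Z, ?z)"] EM_HomD(1)[of _ "(Z, ?z)" B] unfolding fst_conv by metis+
  then show ?thesis unfolding is_zero_object_def EM_simps using A by blast
qed

lemma additive_EM: "additive_category EM"
proof -
  show ?thesis
  proof (intro additive_category.intro category_EM additive_category_axioms.intro)
    fix A B assume "A \<in> Obj EM" "B \<in> Obj EM"
    then show "comm_group (Hom_group EM A B)" "\<exists>D i1 i2 p1 p2. is_biproduct EM A B D i1 i2 p1 p2"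
      using comm_group_EM biproduct_EM by (simp_all add: EM_simps)
  next
    fix a a' b A B D assume "a \<in> Hom EM A B" "a' \<in> Hom EM A B" "b \<in> Hom EM B D"
    then show "b \<cdot>\<^bsub>EM\<^esub> (a \<boxplus>\<^bsub>EM\<^esub> a') = b \<cdot>\<^bsub>EM\<^esub> a \<boxplus>\<^bsub>EM\<^esub> b \<cdot>\<^bsub>EM\<^esub> a'"
      using C.comp_add[OF EM_HomD(1) EM_HomD(1) EM_HomD(1)] by (simp add: EM_simps)
  next
    fix a b b' A B D assume "a \<in> Hom EM A B" "b \<in> Hom EM B D" "b' \<in> Hom EM B D"
    then show "(b \<boxplus>\<^bsub>EM\<^esub> b') \<cdot>\<^bsub>EM\<^esub> a = b \<cdot>\<^bsub>EM\<^esub> a \<boxplus>\<^bsub>EM\<^esub> b' \<cdot>\<^bsub>EM\<^esub> a"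
      using C.add_comp[OF EM_HomD(1) EM_HomD(1) EM_HomD(1)] by (simp add: EM_simps)
  qed (rule zero_object_EM)
qed

lemma is_zero_object_EM_iff:
  "is_zero_object EM A \<longleftrightarrow> A \<in> EM_Obj C M \<eta> \<mu> \<and> is_zero_object C (fst A)"
  unfolding additive_category.is_zero_object_iff[OF additive_EM] C.is_zero_object_iff EM_simps
  using EM_ObjD(1)[of A] by blast

lemma free_Obj: "X \<in> Obj C \<Longrightarrow> free X \<in> EM_Obj C M \<eta> \<mu>"
  using EM_ObjI ob_Obj mu_Hom right_unit assoc by blast

lemma free_Hom: "f \<in> Hom C X Y \<Longrightarrow> ar M f \<in> Hom EM (free X) (free Y)"
  unfolding EM_Hom_iff using ar_Hom free_Obj C.Hom_Obj mu_natural by simp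

text \<open>Associativity of the action, read as linearity of the counit of the free-forgetful
  adjunction.\<close>

lemma action_Hom: "A \<in> EM_Obj C M \<eta> \<mu> \<Longrightarrow> snd A \<in> Hom EM (free (fst A)) A"
  unfolding EM_Hom_iff using EM_ObjD[of A] free_Obj by simp

text \<open>The forgetful functor is conservative: cancelling \<open>a\<close> on the left shows
  that its base inverse is linear.\<close>

lemma EM_iso:
  assumes a: "a \<in> Hom EM A B" and iso: "is_iso C (fst A) (fst B) a"
  shows "is_iso EM A B a"
proof -
  note H = EM_HomD[OF a] 
  note A = EM_ObjD[OF H(2)] and B = EM_ObjD[OF H(3)]
  obtain b where b: "b \<in> Hom C (fst B) (fst A)" "b \<cdot> a = ident C (fst A)" "a \<cdot> b = ident C (fst B)"
    using iso by (rule C.is_isoE)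
  have "a \<cdot> (b \<cdot> snd B) = snd B"
    using C.comp_eq_left[OF b(3) B(2) b(1) H(1)] C.ident_comp[OF B(2)] by simp
  moreover have "a \<cdot> (snd A \<cdot> ar M b) = snd B"
    using C.comp_eq_left[OF H(4) ar_Hom[OF b(1)] A(2) H(1)] C.comp_eq_right[OF ar_comp[OF b(1) H(1), symmetric] ar_Hom[OF b(1)] ar_Hom[OF H(1)] B(2)]
      b(3) ar_ident[OF B(1)] C.comp_ident[OF B(2)] by simp
  ultimately have "b \<cdot> snd B = snd A \<cdot> ar M b"
    using C.iso_cancel_left[OF iso C.comp_Hom[OF B(2) b(1)] C.comp_Hom[OF ar_Hom[OF b(1)] A(2)]] by simp
  then have "b \<in> Hom EM B A" unfolding EM_Hom_iff using b H by simp
  then show ?thesis unfolding is_iso_def using a b by (auto simp: EM_simps)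
qed

lemma EM_isoD: "is_iso EM A B a \<Longrightarrow> is_iso C (fst A) (fst B) a"
  unfolding is_iso_def by (auto simp: EM_simps EM_Hom_iff)

text \<open>A splitting \<open>Y\<close> in the base receives the action
  \<open>p \<cdot> \<rho> \<cdot> M i\<close>. Linearity of \<open>e\<close> gives
  \<open>i \<cdot> \<tau> = \<rho> \<cdot> M i\<close>, from which the associativity law follows by
  naturality of \<open>\<mu>\<close>.\<close>

lemma idempotent_complete_EM:
  assumes "idempotent_complete C"
  shows "idempotent_complete EM"
  unfolding idempotent_complete_def
proof (intro ballI impI)
  fix A e assume "A \<in> Obj EM" and e: "e \<in> Hom EM A A" and "e \<cdot>\<^bsub>EM\<^esub> e = e"
  then have A: "A \<in> EM_Obj C M \<eta> \<mu>" and ee: "e \<cdot> e = e" by (simp_all add: EM_simps)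
  obtain X \<rho> where eq: "A = (X, \<rho>)" by (cases A)
  note H = EM_ObjD[OF A, unfolded eq fst_conv snd_conv] and He = EM_HomD[OF e, unfolded eq fst_conv snd_conv]
  obtain Y p i where Y: "Y \<in> Obj C" "p \<in> Hom C X Y" "i \<in> Hom C Y X" "i \<cdot> p = e" "p \<cdot> i = ident C Y"
    using assms H(1) He(1) ee unfolding idempotent_complete_def by blast
  note Mi = ar_Hom[OF Y(3)] and Mp = ar_Hom[OF Y(2)]
  note \<rho>i = C.comp_Hom[OF Mi H(2)]
  define \<tau> where "\<tau> = p \<cdot> (\<rho> \<cdot> ar M i)"
  have \<tau>: "\<tau> \<in> Hom C (ob M Y) Y" unfolding \<tau>_def using C.comp_Hom[OF \<rho>i Y(2)] .
  have pe: "p \<cdot> e = p" and ei: "e \<cdot> i = i"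
    using C.comp_eq_left[OF Y(5) Y(2,3,2)] C.comp_eq_right[OF Y(5) Y(3,2,3)] Y(4) C.ident_comp[OF Y(2)] C.comp_ident[OF Y(3)] by simp_all
  have i: "i \<cdot> \<tau> = \<rho> \<cdot> ar M i"
    unfolding \<tau>_def using C.comp_eq_left[OF Y(4) \<rho>i Y(2,3)] C.comp_eq_left[OF He(4) Mi H(2) He(1)]
      C.comp_eq_right[OF ar_comp[OF Y(3) He(1), symmetric] Mi ar_Hom[OF He(1)] H(2)] ei by simp
  have p: "p \<cdot> \<rho> = \<tau> \<cdot> ar M p"
  proof -
    have "\<tau> \<cdot> ar M p = p \<cdot> ((\<rho> \<cdot> ar M i) \<cdot> ar M p)" unfolding \<tau>_def using C.comp_assoc[OF Mp \<rho>i Y(2)] by simp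
    also have "\<dots> = p \<cdot> (e \<cdot> \<rho>)"
      using C.comp_eq_right[OF ar_comp[OF Y(2,3), symmetric] Mp Mi H(2)] Y(4) He(4) by simp
    also have "\<dots> = p \<cdot> \<rho>" using C.comp_eq_left[OF pe H(2) He(1) Y(2)] .
    finally show ?thesis by simp
  qed
  note e = eta_Hom[OF Y(1)] and m = mu_Hom[OF Y(1)] and M\<tau> = ar_Hom[OF \<tau>]
  note MMi = ar_Hom[OF Mi] and M\<rho> = ar_Hom[OF H(2)]
  have "\<tau> \<cdot> \<eta> Y = p \<cdot> (\<rho> \<cdot> (\<eta> X \<cdot> i))"
    unfolding \<tau>_def using C.comp_assoc[OF e \<rho>i Y(2)] C.comp_eq_right[OF eta_natural[OF Y(3), symmetric] e Mi H(2)] by simp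
  also have "\<dots> = ident C Y" using C.comp_eq_left[OF H(3) Y(3) eta_Hom[OF H(1)] H(2)] C.ident_comp[OF Y(3)] Y(5) by simp
  finally have u: "\<tau> \<cdot> \<eta> Y = ident C Y" .
  have "\<tau> \<cdot> ar M \<tau> = p \<cdot> (\<rho> \<cdot> (ar M i \<cdot> ar M \<tau>))"
    using C.comp_assoc[OF M\<tau> \<rho>i Y(2)] C.comp_assoc[OF M\<tau> Mi H(2)] by (simp add: \<tau>_def)
  also have "\<dots> = p \<cdot> (\<rho> \<cdot> (ar M \<rho> \<cdot> ar M (ar M i)))"
    using ar_comp[OF \<tau> Y(3)] i ar_comp[OF Mi H(2)] by simp
  also have "\<dots> = p \<cdot> (\<rho> \<cdot> (\<mu> X \<cdot> ar M (ar M i)))"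
    using C.comp_eq_left[OF H(4) MMi M\<rho> H(2)] C.comp_assoc[OF MMi mu_Hom[OF H(1)] H(2)] by simp
  also have "\<dots> = \<tau> \<cdot> \<mu> Y"
    unfolding \<tau>_def using mu_natural[OF Y(3)] C.comp_assoc[OF m Mi H(2)] C.comp_assoc[OF m \<rho>i Y(2)] by simp
  finally have "(Y, \<tau>) \<in> EM_Obj C M \<eta> \<mu>" using EM_ObjI[OF Y(1) \<tau> u] by blast
  then have "(Y, \<tau>) \<in> Obj EM" "p \<in> Hom EM A (Y, \<tau>)" "i \<in> Hom EM (Y, \<tau>) A"
    unfolding eq EM_simps EM_Hom_iff using A Y i p eq by simp_all
  moreover have "i \<cdot>\<^bsub>EM\<^esub> p = e" "p \<cdot>\<^bsub>EM\<^esub> i = ident EM (Y, \<tau>)" using Y by (simp_all add: EM_simps)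
  ultimately show "\<exists>B\<in>Obj EM. \<exists>p\<in>Hom EM A B. \<exists>i\<in>Hom EM B A. i \<cdot>\<^bsub>EM\<^esub> p = e \<and> p \<cdot>\<^bsub>EM\<^esub> i = ident EM B"
    by blast
qed

end

section \<open>Suspension of modules\<close>

text \<open>The last assumptions unfold what it means for \<open>M\<close> to be exact and for
  \<open>\<eta>\<close> and \<open>\<mu>\<close> to respect suspension. Together, naturality,
  \<open>phi_eta\<close> and \<open>phi_mu\<close> make \<open>\<phi>\<close> a distributive law,
  which is what lifts \<open>\<Sigma>\<close> to modules.\<close>

locale stable_monad = triangulated_category C \<Sigma> \<Delta> + monad C M \<eta> \<mu>
  for C :: "('o, 'm) add_cat" (structure) and \<Sigma> \<Delta> M \<eta> \<mu> +
  fixes \<phi> :: "'o \<Rightarrow> 'm"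
  assumes phi_iso: "X \<in> Obj C \<Longrightarrow> is_iso C (ob M (ob \<Sigma> X)) (ob \<Sigma> (ob M X)) (\<phi> X)"
    and phi_natural: "f \<in> Hom C X Y \<Longrightarrow> \<phi> Y \<cdot> ar M (ar \<Sigma> f) = ar \<Sigma> (ar M f) \<cdot> \<phi> X"
    and phi_eta: "X \<in> Obj C \<Longrightarrow> \<phi> X \<cdot> \<eta> (ob \<Sigma> X) = ar \<Sigma> (\<eta> X)"
    and phi_mu: "X \<in> Obj C \<Longrightarrow> \<phi> X \<cdot> \<mu> (ob \<Sigma> X) = ar \<Sigma> (\<mu> X) \<cdot> (\<phi> (ob M X) \<cdot> ar M (\<phi> X))"
    and map_dist: "Triangle X Y Z f g h \<in> \<Delta> \<Longrightarrow>
      Triangle (ob M X) (ob M Y) (ob M Z) (ar M f) (ar M g) (\<phi> X \<cdot> ar M h) \<in> \<Delta>"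
begin

abbreviation S where "S \<equiv> EM_suspension C \<Sigma> \<phi>"

lemma phi_Hom: "X \<in> Obj C \<Longrightarrow> \<phi> X \<in> Hom C (ob M (ob \<Sigma> X)) (ob \<Sigma> (ob M X))"
  using phi_iso unfolding is_iso_def by blast

lemma susp_simps:
  "ob S A = (ob \<Sigma> (fst A), ar \<Sigma> (snd A) \<cdot> \<phi> (fst A))" "ar S a = ar \<Sigma> a"
  by (simp_all add: EM_suspension_def case_prod_beta)

lemma susp_Obj:
  assumes A: "A \<in> EM_Obj C M \<eta> \<mu>"
  shows "ob S A \<in> EM_Obj C M \<eta> \<mu>"
proof -
  obtain X \<rho> where eq: "A = (X, \<rho>)" by (cases A)
  note H = EM_ObjD[OF A, unfolded eq fst_conv snd_conv]
  note SX = \<Sigma>.ob_Obj[OF H(1)] and p = phi_Hom[OF H(1)] and S\<rho> = \<Sigma>.ar_Hom[OF H(2)]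
  note MS\<rho> = ar_Hom[OF S\<rho>] and Mp = ar_Hom[OF p] and SM\<rho> = \<Sigma>.ar_Hom[OF ar_Hom[OF H(2)]]
  note pM = phi_Hom[OF ob_Obj[OF H(1)]]
  have \<rho>p: "ar \<Sigma> \<rho> \<cdot> \<phi> X \<in> Hom C (ob M (ob \<Sigma> X)) (ob \<Sigma> X)" using comp_Hom[OF p S\<rho>] .
  have "(ar \<Sigma> \<rho> \<cdot> \<phi> X) \<cdot> \<eta> (ob \<Sigma> X) = ident C (ob \<Sigma> X)"
    using comp_eq_right[OF phi_eta[OF H(1)] eta_Hom[OF SX] p S\<rho>] \<Sigma>.ar_comp[OF eta_Hom[OF H(1)] H(2)]
      H(3) \<Sigma>.ar_ident[OF H(1)] by simp
  moreover have "(ar \<Sigma> \<rho> \<cdot> \<phi> X) \<cdot> ar M (ar \<Sigma> \<rho> \<cdot> \<phi> X) = (ar \<Sigma> \<rho> \<cdot> \<phi> X) \<cdot> \<mu> (ob \<Sigma> X)"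
  proof -
    have "(ar \<Sigma> \<rho> \<cdot> \<phi> X) \<cdot> ar M (ar \<Sigma> \<rho> \<cdot> \<phi> X) = ar \<Sigma> \<rho> \<cdot> (\<phi> X \<cdot> (ar M (ar \<Sigma> \<rho>) \<cdot> ar M (\<phi> X)))"
      using ar_comp[OF p S\<rho>] comp_assoc[OF comp_Hom[OF Mp MS\<rho>] p S\<rho>] by simp
    also have "\<dots> = ar \<Sigma> \<rho> \<cdot> (ar \<Sigma> (ar M \<rho>) \<cdot> (\<phi> (ob M X) \<cdot> ar M (\<phi> X)))"
      using comp_eq_left[OF phi_natural[OF H(2)] Mp MS\<rho> p] comp_assoc[OF Mp pM SM\<rho>] by simp
    also have "\<dots> = ar \<Sigma> (\<rho> \<cdot> ar M \<rho>) \<cdot> (\<phi> (ob M X) \<cdot> ar M (\<phi> X))"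
      using comp_assoc[OF comp_Hom[OF Mp pM] SM\<rho> S\<rho>] \<Sigma>.ar_comp[OF ar_Hom[OF H(2)] H(2)] by simp
    also have "\<dots> = ar \<Sigma> \<rho> \<cdot> (ar \<Sigma> (\<mu> X) \<cdot> (\<phi> (ob M X) \<cdot> ar M (\<phi> X)))"
      using comp_assoc[OF comp_Hom[OF Mp pM] \<Sigma>.ar_Hom[OF mu_Hom[OF H(1)]] S\<rho>] \<Sigma>.ar_comp[OF mu_Hom[OF H(1)] H(2)] H(4) by simp
    also have "\<dots> = (ar \<Sigma> \<rho> \<cdot> \<phi> X) \<cdot> \<mu> (ob \<Sigma> X)"
      using phi_mu[OF H(1)] comp_assoc[OF mu_Hom[OF SX] p S\<rho>] by simp
    finally show ?thesis .
  qed
  ultimately show ?thesis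
    unfolding susp_simps eq fst_conv snd_conv using EM_ObjI[OF SX \<rho>p] by blast
qed

text \<open>Linearity of \<open>\<Sigma> a\<close> is the suspension of the equation for
  \<open>a\<close>, composed with the isomorphism \<open>\<phi>\<close>. Faithfulness then gives the
  converse, by which desuspended morphisms are recognized as linear.\<close>

lemma susp_Hom_iff:
  assumes A: "A \<in> EM_Obj C M \<eta> \<mu>" and B: "B \<in> EM_Obj C M \<eta> \<mu>" and a: "a \<in> Hom C (fst A) (fst B)"
  shows "ar \<Sigma> a \<in> Hom EM (ob S A) (ob S B) \<longleftrightarrow> a \<in> Hom EM A B"
proof -
  note HA = EM_ObjD[OF A] and HB = EM_ObjD[OF B]
  note p = phi_Hom[OF HA(1)] and q = phi_Hom[OF HB(1)] and Sa = \<Sigma>.ar_Hom[OF a]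
  note SA = \<Sigma>.ar_Hom[OF HA(2)] and SB = \<Sigma>.ar_Hom[OF HB(2)] and SMa = \<Sigma>.ar_Hom[OF ar_Hom[OF a]]
  note aA = comp_Hom[OF HA(2) a] and aB = comp_Hom[OF ar_Hom[OF a] HB(2)]
  have "ar \<Sigma> a \<cdot> (ar \<Sigma> (snd A) \<cdot> \<phi> (fst A)) = ar \<Sigma> (a \<cdot> snd A) \<cdot> \<phi> (fst A)"
    using comp_assoc[OF p SA Sa] \<Sigma>.ar_comp[OF HA(2) a] by simp
  moreover have "(ar \<Sigma> (snd B) \<cdot> \<phi> (fst B)) \<cdot> ar M (ar \<Sigma> a) = ar \<Sigma> (snd B \<cdot> ar M a) \<cdot> \<phi> (fst A)"
    using comp_eq_right[OF phi_natural[OF a] ar_Hom[OF Sa] q SB] comp_assoc[OF p SMa SB]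
      \<Sigma>.ar_comp[OF ar_Hom[OF a] HB(2)] by simp
  moreover have "ar \<Sigma> (a \<cdot> snd A) \<cdot> \<phi> (fst A) = ar \<Sigma> (snd B \<cdot> ar M a) \<cdot> \<phi> (fst A) \<longleftrightarrow> a \<cdot> snd A = snd B \<cdot> ar M a"
    using iso_cancel_right[OF phi_iso[OF HA(1)] \<Sigma>.ar_Hom[OF aA] \<Sigma>.ar_Hom[OF aB]] suspension_faithful[OF aA aB] by metis
  ultimately show ?thesis
    using a Sa A B susp_Obj[OF A] susp_Obj[OF B] by (simp add: EM_Hom_iff susp_simps)
qed

lemma susp_Hom: "a \<in> Hom EM A B \<Longrightarrow> ar \<Sigma> a \<in> Hom EM (ob S A) (ob S B)"
  using susp_Hom_iff EM_HomD by metis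

lemma is_functor_susp: "is_functor EM EM S"
  by (intro is_functor.intro category_EM is_functor_axioms.intro)
    (auto simp: EM_simps susp_simps \<Sigma>.ar_ident dest: EM_ObjD(1) EM_HomD(1) intro: susp_Obj[unfolded susp_simps]
      susp_Hom[unfolded susp_simps] intro!: \<Sigma>.ar_comp)

lemma additive_functor_susp: "additive_functor EM EM S"
  by (intro additive_functor.intro is_functor_susp additive_EM additive_functor_axioms.intro)
    (use \<Sigma>.ar_add[OF EM_HomD(1) EM_HomD(1)] in \<open>simp add: EM_simps susp_simps\<close>)

lemma suspension_reflects_iso:
  assumes f: "f \<in> Hom C X Y" and iso: "is_iso C (ob \<Sigma> X) (ob \<Sigma> Y) (ar \<Sigma> f)"
  shows "is_iso C X Y f"
proof -
  have XY: "X \<in> Obj C" "Y \<in> Obj C" using f Hom_Obj by blast+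
  obtain g' where g': "g' \<in> Hom C (ob \<Sigma> Y) (ob \<Sigma> X)" "g' \<cdot> ar \<Sigma> f = ident C (ob \<Sigma> X)"
    "ar \<Sigma> f \<cdot> g' = ident C (ob \<Sigma> Y)"
    using iso by (rule is_isoE)
  obtain g where g: "g \<in> Hom C Y X" "ar \<Sigma> g = g'" using suspension_full[OF XY(2,1) g'(1)] .
  have "g \<cdot> f = ident C X" "f \<cdot> g = ident C Y"
    using suspension_faithful[OF comp_Hom[OF f g(1)] ident_Hom[OF XY(1)]]
      suspension_faithful[OF comp_Hom[OF g(1) f] ident_Hom[OF XY(2)]]
      \<Sigma>.ar_comp[OF f g(1)] \<Sigma>.ar_comp[OF g(1) f] g(2) g'(2,3) \<Sigma>.ar_ident XY by simp_all
  then show ?thesis using is_iso_inverse(1)[OF f g(1)] by blast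
qed

text \<open>The action of \<open>A\<close> is carried along \<open>b\<close> to
  \<open>\<Sigma> X\<close> and then desuspended: fullness yields \<open>\<rho>\<close> with
  \<open>b \<cdot> \<Sigma> \<rho> \<cdot> \<phi> = \<tau> \<cdot> M b\<close>. The module laws are
  verified after suspension, where \<open>b\<close> and \<open>\<phi>\<close> cancel.\<close>

lemma desuspend_action:
  assumes A: "A \<in> EM_Obj C M \<eta> \<mu>" and X: "X \<in> Obj C" and b: "is_iso C (ob \<Sigma> X) (fst A) b"
  shows "\<exists>\<rho>. (X, \<rho>) \<in> EM_Obj C M \<eta> \<mu> \<and> b \<in> Hom EM (ob S (X, \<rho>)) A"
proof -
  obtain Y \<tau> where eq: "A = (Y, \<tau>)" by (cases A)
  note H = EM_ObjD[OF A, unfolded eq fst_conv snd_conv]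
  have b: "is_iso C (ob \<Sigma> X) Y b" using b eq by simp
  obtain b' where b': "b \<in> Hom C (ob \<Sigma> X) Y" "b' \<in> Hom C Y (ob \<Sigma> X)" "b \<cdot> b' = ident C Y"
    using b by (rule is_isoE)
  note p = phi_Hom[OF X]
  obtain p' where p': "p' \<in> Hom C (ob \<Sigma> (ob M X)) (ob M (ob \<Sigma> X))" "p' \<cdot> \<phi> X = ident C (ob M (ob \<Sigma> X))"
    using phi_iso[OF X] by (rule is_isoE)
  note Mb = ar_Hom[OF b'(1)]
  note SX = \<Sigma>.ob_Obj[OF X]
  note t1 = comp_Hom[OF Mb H(2)]
  note t2 = comp_Hom[OF p'(1) t1]
  obtain \<rho> where \<rho>: "\<rho> \<in> Hom C (ob M X) X" "ar \<Sigma> \<rho> = b' \<cdot> ((\<tau> \<cdot> ar M b) \<cdot> p')"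
    using suspension_full[OF ob_Obj[OF X] X comp_Hom[OF t2 b'(2)]] .
  note S\<rho> = \<Sigma>.ar_Hom[OF \<rho>(1)]
  note \<rho>p = comp_Hom[OF p S\<rho>] and MS\<rho> = ar_Hom[OF S\<rho>] and Mp = ar_Hom[OF p]
  have "b \<cdot> ar \<Sigma> \<rho> = (\<tau> \<cdot> ar M b) \<cdot> p'"
    using \<rho>(2) comp_eq_left[OF b'(3) t2 b'(2,1)] ident_comp[OF t2] by simp
  then have key: "b \<cdot> (ar \<Sigma> \<rho> \<cdot> \<phi> X) = \<tau> \<cdot> ar M b"
    using comp_eq_left[OF _ p S\<rho> b'(1)] comp_eq_right[OF p'(2) p p'(1) t1] comp_ident[OF t1] by simp
  have b\<rho>: "b \<cdot> ar \<Sigma> \<rho> \<in> Hom C (ob \<Sigma> (ob M X)) Y" using comp_Hom[OF S\<rho> b'(1)] .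
  have key': "(b \<cdot> ar \<Sigma> \<rho>) \<cdot> \<phi> X = \<tau> \<cdot> ar M b" using key comp_assoc[OF p S\<rho> b'(1)] by simp
  have unit: "\<rho> \<cdot> \<eta> X = ident C X"
  proof -
    note e = eta_Hom[OF X] and Se = \<Sigma>.ar_Hom[OF eta_Hom[OF X]] and eS = eta_Hom[OF SX]
    note \<rho>e = comp_Hom[OF e \<rho>(1)]
    have "b \<cdot> ar \<Sigma> (\<rho> \<cdot> \<eta> X) = (b \<cdot> ar \<Sigma> \<rho>) \<cdot> (\<phi> X \<cdot> \<eta> (ob \<Sigma> X))"
      using \<Sigma>.ar_comp[OF e \<rho>(1)] comp_assoc[OF Se S\<rho> b'(1)] phi_eta[OF X] by simp
    also have "\<dots> = \<tau> \<cdot> (ar M b \<cdot> \<eta> (ob \<Sigma> X))"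
      using comp_eq_left[OF key' eS p b\<rho>] comp_assoc[OF eS Mb H(2)] by simp
    also have "\<dots> = (\<tau> \<cdot> \<eta> Y) \<cdot> b"
      using eta_natural[OF b'(1)] comp_assoc[OF b'(1) eta_Hom[OF H(1)] H(2)] by simp
    also have "\<dots> = b \<cdot> ar \<Sigma> (ident C X)"
      using H(3) ident_comp[OF b'(1)] \<Sigma>.ar_ident[OF X] comp_ident[OF b'(1)] by simp
    finally have "ar \<Sigma> (\<rho> \<cdot> \<eta> X) = ar \<Sigma> (ident C X)"
      using iso_cancel_left[OF b \<Sigma>.ar_Hom[OF \<rho>e] \<Sigma>.ar_Hom[OF ident_Hom[OF X]]] by blast
    then show ?thesis using suspension_faithful[OF \<rho>e ident_Hom[OF X]] by blast
  qed
  have assoc: "\<rho> \<cdot> ar M \<rho> = \<rho> \<cdot> \<mu> X"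
  proof -
    note m = mu_Hom[OF X] and M\<rho> = ar_Hom[OF \<rho>(1)]
    note Sm = \<Sigma>.ar_Hom[OF m] and SM\<rho> = \<Sigma>.ar_Hom[OF M\<rho>] and pM = phi_Hom[OF ob_Obj[OF X]] and mS = mu_Hom[OF SX]
    let ?q = "\<phi> (ob M X) \<cdot> ar M (\<phi> X)"
    note q = comp_Hom[OF Mp pM]
    \<comment> \<open>\<open>?q\<close> is the suspension comparison of \<open>M\<close> composed
      with itself; being invertible, it can be cancelled on the right.\<close>
    have qi: "is_iso C (ob M (ob M (ob \<Sigma> X))) (ob \<Sigma> (ob M (ob M X))) ?q"
      using is_iso_comp[OF ar_iso[OF phi_iso[OF X]] phi_iso[OF ob_Obj[OF X]]] .
    note MMb = ar_Hom[OF Mb] and M\<tau> = ar_Hom[OF H(2)]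
    have "(b \<cdot> ar \<Sigma> (\<rho> \<cdot> ar M \<rho>)) \<cdot> ?q = (b \<cdot> ar \<Sigma> \<rho>) \<cdot> (ar \<Sigma> (ar M \<rho>) \<cdot> ?q)"
      using \<Sigma>.ar_comp[OF M\<rho> \<rho>(1)] comp_assoc[OF SM\<rho> S\<rho> b'(1)] comp_assoc[OF q SM\<rho> b\<rho>] by simp
    also have "\<dots> = (b \<cdot> ar \<Sigma> \<rho>) \<cdot> (\<phi> X \<cdot> (ar M (ar \<Sigma> \<rho>) \<cdot> ar M (\<phi> X)))"
      using comp_eq_left[OF phi_natural[OF \<rho>(1), symmetric] Mp pM SM\<rho>] comp_assoc[OF Mp MS\<rho> p] by simp
    also have "\<dots> = (\<tau> \<cdot> ar M b) \<cdot> ar M (ar \<Sigma> \<rho> \<cdot> \<phi> X)"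
      using comp_eq_left[OF key' ar_Hom[OF \<rho>p] p b\<rho>] ar_comp[OF p S\<rho>] by simp
    also have "\<dots> = \<tau> \<cdot> (ar M \<tau> \<cdot> ar M (ar M b))"
      using comp_assoc[OF ar_Hom[OF \<rho>p] Mb H(2)] ar_comp[OF \<rho>p b'(1)] key ar_comp[OF Mb H(2)] by simp
    also have "\<dots> = \<tau> \<cdot> (\<mu> Y \<cdot> ar M (ar M b))"
      using comp_eq_left[OF H(4) MMb M\<tau> H(2)] comp_assoc[OF MMb mu_Hom[OF H(1)] H(2)] by simp
    also have "\<dots> = (\<tau> \<cdot> ar M b) \<cdot> \<mu> (ob \<Sigma> X)"
      using mu_natural[OF b'(1)] comp_assoc[OF mS Mb H(2)] by simp
    also have "\<dots> = (b \<cdot> ar \<Sigma> \<rho>) \<cdot> (ar \<Sigma> (\<mu> X) \<cdot> ?q)"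
      using comp_eq_right[OF phi_mu[OF X] mS p b\<rho>] key' by simp
    also have "\<dots> = (b \<cdot> ar \<Sigma> (\<rho> \<cdot> \<mu> X)) \<cdot> ?q"
      using \<Sigma>.ar_comp[OF m \<rho>(1)] comp_assoc[OF Sm S\<rho> b'(1)] comp_assoc[OF q Sm b\<rho>] by simp
    finally have "(b \<cdot> ar \<Sigma> (\<rho> \<cdot> ar M \<rho>)) \<cdot> ?q = (b \<cdot> ar \<Sigma> (\<rho> \<cdot> \<mu> X)) \<cdot> ?q" .
    then have "b \<cdot> ar \<Sigma> (\<rho> \<cdot> ar M \<rho>) = b \<cdot> ar \<Sigma> (\<rho> \<cdot> \<mu> X)"
      using iso_cancel_right[OF qi] comp_Hom[OF \<Sigma>.ar_Hom[OF comp_Hom[OF M\<rho> \<rho>(1)]] b'(1)]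
        comp_Hom[OF \<Sigma>.ar_Hom[OF comp_Hom[OF m \<rho>(1)]] b'(1)] by blast
    then have "ar \<Sigma> (\<rho> \<cdot> ar M \<rho>) = ar \<Sigma> (\<rho> \<cdot> \<mu> X)"
      using iso_cancel_left[OF b \<Sigma>.ar_Hom[OF comp_Hom[OF M\<rho> \<rho>(1)]] \<Sigma>.ar_Hom[OF comp_Hom[OF m \<rho>(1)]]] by blast
    then show ?thesis using suspension_faithful[OF comp_Hom[OF M\<rho> \<rho>(1)] comp_Hom[OF m \<rho>(1)]] by blast
  qed
  have "(X, \<rho>) \<in> EM_Obj C M \<eta> \<mu>" using EM_ObjI[OF X \<rho>(1) unit assoc] .
  moreover from this have "b \<in> Hom EM (ob S (X, \<rho>)) A"
    unfolding EM_Hom_iff using susp_Obj[of "(X, \<rho>)"] A b'(1) key by (simp add: susp_simps eq)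
  ultimately show ?thesis by blast
qed

lemma EM_iso_inverse:
  assumes "is_iso EM A B a"
  obtains b where "a \<in> Hom EM A B" "b \<in> Hom EM B A" "b \<cdot> a = ident C (fst A)" "a \<cdot> b = ident C (fst B)"
  using assms unfolding is_iso_def EM_simps by blast

text \<open>A base quasi-inverse \<open>\<Omega>\<close> is lifted by giving each
  \<open>\<Omega> Y\<close> the action for which the counit \<open>\<beta>\<close> is linear.
  Everything else is transported along \<open>\<beta>\<close> and tested after suspension.\<close>

lemma is_equivalence_susp: "is_equivalence EM EM S"
proof -
  obtain \<Omega> \<beta> where \<Omega>: "is_functor C C \<Omega>" and \<beta>: "nat_iso C C (\<Sigma> \<circ>\<^sub>F \<Omega>) id_func \<beta>"
    using \<Sigma>_equivalence unfolding is_equivalence_def by blast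
  interpret \<Omega>: is_functor C C \<Omega> by (rule \<Omega>)
  interpret \<beta>: nat_iso C C "\<Sigma> \<circ>\<^sub>F \<Omega>" id_func \<beta> by (rule \<beta>)
  have \<beta>_iso: "is_iso C (ob \<Sigma> (ob \<Omega> Y)) Y (\<beta> Y)" if "Y \<in> Obj C" for Y
    using \<beta>.component_iso[OF that] by (simp add: comp_func_def id_func_def)
  have \<beta>_nat: "\<beta> Y \<cdot> ar \<Sigma> (ar \<Omega> f) = f \<cdot> \<beta> X" if "f \<in> Hom C X Y" for f X Y
    using \<beta>.naturality[OF that] by (simp add: comp_func_def id_func_def)
  have "\<exists>\<rho>. (ob \<Omega> (fst A), \<rho>) \<in> EM_Obj C M \<eta> \<mu> \<and> \<beta> (fst A) \<in> Hom EM (ob S (ob \<Omega> (fst A), \<rho>)) A"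
    if "A \<in> EM_Obj C M \<eta> \<mu>" for A
    using desuspend_action[OF that \<Omega>.ob_Obj \<beta>_iso] EM_ObjD(1)[OF that] by blast
  then obtain r where r: "\<And>A. A \<in> EM_Obj C M \<eta> \<mu> \<Longrightarrow> (ob \<Omega> (fst A), r A) \<in> EM_Obj C M \<eta> \<mu> \<and>
      \<beta> (fst A) \<in> Hom EM (ob S (ob \<Omega> (fst A), r A)) A"
    by metis
  define G where "G = \<lparr>ob = (\<lambda>A. (ob \<Omega> (fst A), r A)), ar = ar \<Omega>\<rparr>"
  have G_simps: "fst (ob G A) = ob \<Omega> (fst A)" "ar G a = ar \<Omega> a" for A a by (simp_all add: G_def)
  have G_Obj: "ob G A \<in> EM_Obj C M \<eta> \<mu>" and \<beta>_Hom: "\<beta> (fst A) \<in> Hom EM (ob S (ob G A)) A"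
    if "A \<in> EM_Obj C M \<eta> \<mu>" for A using r[OF that] by (simp_all add: G_def)
  have \<beta>_EM: "is_iso EM (ob S (ob G A)) A (\<beta> (fst A))" if "A \<in> EM_Obj C M \<eta> \<mu>" for A
    using EM_iso[OF \<beta>_Hom[OF that]] \<beta>_iso EM_ObjD(1)[OF that] by (simp add: G_simps susp_simps)
  have G_Hom: "ar G a \<in> Hom EM (ob G A) (ob G B)" if a: "a \<in> Hom EM A B" for A B a
  proof -
    note H = EM_HomD[OF a]
    obtain b where b: "\<beta> (fst B) \<in> Hom EM (ob S (ob G B)) B" "b \<in> Hom EM B (ob S (ob G B))"
      "b \<cdot> \<beta> (fst B) = ident C (fst (ob S (ob G B)))"
      using \<beta>_EM[OF H(3)] by (rule EM_iso_inverse)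
    note \<Omega>a = \<Omega>.ar_Hom[OF H(1)]
    note S\<Omega>a = \<Sigma>.ar_Hom[OF \<Omega>a]
    \<comment> \<open>After suspension, \<open>\<Omega> a\<close> becomes the conjugate of
      \<open>a\<close> by the linear isomorphisms \<open>\<beta>\<close>, so it is linear.\<close>
    have "\<beta> (fst B) \<cdot> ar \<Sigma> (ar \<Omega> a) = a \<cdot> \<beta> (fst A)" using \<beta>_nat[OF H(1)] .
    moreover have "b \<cdot> (\<beta> (fst B) \<cdot> ar \<Sigma> (ar \<Omega> a)) = ar \<Sigma> (ar \<Omega> a)"
      using comp_eq_left[OF b(3) S\<Omega>a] EM_HomD(1)[OF b(1)] EM_HomD(1)[OF b(2)] ident_comp[OF S\<Omega>a]
      by (simp add: susp_simps G_simps)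
    ultimately have "ar \<Sigma> (ar \<Omega> a) = b \<cdot> (a \<cdot> \<beta> (fst A))" by simp
    also have "\<dots> \<in> Hom EM (ob S (ob G A)) (ob S (ob G B))"
      using module_map_comp[OF module_map_comp[OF \<beta>_Hom[OF H(2)] a] b(2)] .
    finally show ?thesis
      using susp_Hom_iff[OF G_Obj[OF H(2)] G_Obj[OF H(3)], of "ar \<Omega> a"] \<Omega>a by (simp add: G_simps)
  qed
  interpret S: is_functor EM EM S by (rule is_functor_susp)
  have G: "is_functor EM EM G"
    by (intro is_functor.intro category_EM is_functor_axioms.intro)
      (use G_Hom G_Obj in \<open>auto simp: EM_simps G_simps \<Omega>.ar_ident dest: EM_ObjD(1) EM_HomD(1) intro!: \<Omega>.ar_comp\<close>)
  interpret G: is_functor EM EM G by (rule G)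
  have id: "is_functor EM EM id_func"
    by (intro is_functor.intro category_EM is_functor_axioms.intro) (simp_all add: id_func_def)
  have SG: "is_functor EM EM (S \<circ>\<^sub>F G)"
    by (intro is_functor.intro category_EM is_functor_axioms.intro)
      (simp_all add: comp_func_def S.ob_Obj S.ar_Hom S.ar_ident S.ar_comp G.ob_Obj G.ar_Hom G.ar_ident G.ar_comp[OF _ ] S.ar_comp[OF G.ar_Hom G.ar_Hom])
  have GS: "is_functor EM EM (G \<circ>\<^sub>F S)"
    by (intro is_functor.intro category_EM is_functor_axioms.intro)
      (simp_all add: comp_func_def S.ob_Obj S.ar_Hom S.ar_ident S.ar_comp G.ob_Obj G.ar_Hom G.ar_ident G.ar_comp[OF S.ar_Hom S.ar_Hom])
  have "nat_iso EM EM (S \<circ>\<^sub>F G) id_func (\<lambda>A. \<beta> (fst A))"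
  proof (intro nat_iso.intro nat_trans.intro SG id nat_trans_axioms.intro nat_iso_axioms.intro)
    fix A B a assume a: "a \<in> Hom EM A B"
    show "\<beta> (fst B) \<cdot>\<^bsub>EM\<^esub> ar (S \<circ>\<^sub>F G) a = ar id_func a \<cdot>\<^bsub>EM\<^esub> \<beta> (fst A)"
      using \<beta>_nat[OF EM_HomD(1)[OF a]] by (simp add: EM_simps comp_func_def id_func_def susp_simps G_simps)
  qed (use \<beta>_Hom \<beta>_EM in \<open>simp_all add: EM_simps comp_func_def id_func_def\<close>)
  moreover
  \<comment> \<open>The unit isomorphism of the chosen equivalence need not be compatible with
    \<open>\<beta>\<close>. Desuspending \<open>\<beta>\<close> at \<open>\<Sigma> X\<close> gives
    one whose linearity and naturality follow from those of \<open>\<beta>\<close>.\<close>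
  have "\<exists>a. a \<in> Hom C (ob \<Omega> (ob \<Sigma> X)) X \<and> ar \<Sigma> a = \<beta> (ob \<Sigma> X)" if X: "X \<in> Obj C" for X
    using suspension_full[OF \<Omega>.ob_Obj[OF \<Sigma>.ob_Obj[OF X]] X] \<beta>_iso[OF \<Sigma>.ob_Obj[OF X]] unfolding is_iso_def by metis
  then obtain al where al: "\<And>X. X \<in> Obj C \<Longrightarrow> al X \<in> Hom C (ob \<Omega> (ob \<Sigma> X)) X"
    "\<And>X. X \<in> Obj C \<Longrightarrow> ar \<Sigma> (al X) = \<beta> (ob \<Sigma> X)"
    by metis
  have al_Hom: "al (fst A) \<in> Hom EM (ob G (ob S A)) A" if A: "A \<in> EM_Obj C M \<eta> \<mu>" for A
    using susp_Hom_iff[OF G_Obj[OF susp_Obj[OF A]] A, of "al (fst A)"] al[OF EM_ObjD(1)[OF A]]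
      \<beta>_Hom[OF susp_Obj[OF A]] by (simp add: G_simps susp_simps)
  have al_EM: "is_iso EM (ob G (ob S A)) A (al (fst A))" if A: "A \<in> EM_Obj C M \<eta> \<mu>" for A
    using EM_iso[OF al_Hom[OF A]] suspension_reflects_iso[OF al(1)] al(2) \<beta>_iso[OF \<Sigma>.ob_Obj] EM_ObjD(1)[OF A]
    by (simp add: G_simps susp_simps)
  have "nat_iso EM EM (G \<circ>\<^sub>F S) id_func (\<lambda>A. al (fst A))"
  proof (intro nat_iso.intro nat_trans.intro GS id nat_trans_axioms.intro nat_iso_axioms.intro)
    fix A B a assume "a \<in> Hom EM A B"
    then have a: "a \<in> Hom C (fst A) (fst B)" by (rule EM_HomD)
    then have o: "fst A \<in> Obj C" "fst B \<in> Obj C" using Hom_Obj by blast+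
    note Sa = \<Sigma>.ar_Hom[OF a]
    note \<Omega>Sa = \<Omega>.ar_Hom[OF Sa]
    have "ar \<Sigma> (al (fst B) \<cdot> ar \<Omega> (ar \<Sigma> a)) = ar \<Sigma> (a \<cdot> al (fst A))"
      using \<Sigma>.ar_comp[OF \<Omega>Sa al(1)[OF o(2)]] \<Sigma>.ar_comp[OF al(1)[OF o(1)] a] al(2) o \<beta>_nat[OF Sa] by simp
    then have "al (fst B) \<cdot> ar \<Omega> (ar \<Sigma> a) = a \<cdot> al (fst A)"
      using suspension_faithful comp_Hom[OF \<Omega>Sa al(1)[OF o(2)]] comp_Hom[OF al(1)[OF o(1)] a] by blast
    then show "al (fst B) \<cdot>\<^bsub>EM\<^esub> ar (G \<circ>\<^sub>F S) a = ar id_func a \<cdot>\<^bsub>EM\<^esub> al (fst A)"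
      by (simp add: EM_simps comp_func_def id_func_def susp_simps G_simps)
  qed (use al_Hom al_EM in \<open>simp_all add: EM_simps comp_func_def id_func_def\<close>)
  ultimately show ?thesis
    unfolding is_equivalence_def using is_functor_susp G by blast
qed

end

section \<open>Averaging and the triangulation\<close>

context separability_section
begin

lemma sigma_Hom: "X \<in> Obj C \<Longrightarrow> \<sigma> X \<in> Hom C (ob M X) (ob M (ob M X))"
  and sigma_natural: "f \<in> Hom C X Y \<Longrightarrow> \<sigma> Y \<cdot> ar M f = ar M (ar M f) \<cdot> \<sigma> X"
  using \<sigma>.component \<sigma>.naturality by (simp_all add: comp_func_def)

text \<open>\<open>\<sigma> \<cdot> \<eta>\<close> is the separability element of the monad. For
  \<open>M = A \<otimes> -\<close> it sends \<open>x\<close> to a sum of terms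
  \<open>e' \<otimes> e'' \<otimes> x\<close>, and \<open>sec\<close> sends \<open>x\<close> to the
  sum of the \<open>e' \<otimes> e'' x\<close>.\<close>

definition sec where "sec A = ar M (snd A) \<cdot> (\<sigma> (fst A) \<cdot> \<eta> (fst A))"

lemma sec_Hom_C:
  assumes A: "A \<in> EM_Obj C M \<eta> \<mu>"
  shows "sec A \<in> Hom C (fst A) (ob M (fst A))"
  unfolding sec_def using EM_ObjD[OF A] C.comp_Hom[OF C.comp_Hom[OF eta_Hom sigma_Hom] ar_Hom] by blast

text \<open>Associativity replaces \<open>\<rho> \<cdot> M \<rho>\<close> by
  \<open>\<rho> \<cdot> \<mu>\<close>; then \<open>\<mu>\<close> cancels \<open>\<sigma>\<close>,
  and the unit law remains.\<close>

lemma action_sec: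
  assumes A: "A \<in> EM_Obj C M \<eta> \<mu>"
  shows "snd A \<cdot> sec A = ident C (fst A)"
proof -
  obtain X \<rho> where eq: "A = (X, \<rho>)" by (cases A)
  note H = EM_ObjD[OF A, unfolded eq fst_conv snd_conv]
  note e = eta_Hom[OF H(1)] and s = sigma_Hom[OF H(1)] and m = mu_Hom[OF H(1)]
  have "\<rho> \<cdot> (ar M \<rho> \<cdot> (\<sigma> X \<cdot> \<eta> X)) = (\<rho> \<cdot> \<mu> X) \<cdot> (\<sigma> X \<cdot> \<eta> X)"
    using C.comp_eq_left[OF H(4) C.comp_Hom[OF e s] ar_Hom[OF H(2)] H(2)] .
  also have "\<dots> = \<rho> \<cdot> \<eta> X"
    using C.comp_assoc[OF C.comp_Hom[OF e s] m H(2)] C.comp_eq_left[OF sect[OF H(1)] e s m] C.ident_comp[OF e] by simp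
  finally show ?thesis using H(3) by (simp add: sec_def eq)
qed

lemma sec_natural:
  assumes a: "a \<in> Hom EM A B"
  shows "sec B \<cdot> a = ar M a \<cdot> sec A"
proof -
  obtain X \<rho> Y \<tau> where eq: "A = (X, \<rho>)" "B = (Y, \<tau>)" by (cases A, cases B) blast
  note H = EM_HomD[OF a, unfolded eq fst_conv snd_conv]
  note HA = EM_ObjD[OF H(2), unfolded fst_conv snd_conv] and HB = EM_ObjD[OF H(3), unfolded fst_conv snd_conv]
  note e = eta_Hom[OF HA(1)] and s = sigma_Hom[OF HA(1)] and e' = eta_Hom[OF HB(1)] and s' = sigma_Hom[OF HB(1)]
  note Ma = ar_Hom[OF H(1)] and M\<rho> = ar_Hom[OF HA(2)] and M\<tau> = ar_Hom[OF HB(2)]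
  note MMa = ar_Hom[OF Ma] and se = C.comp_Hom[OF e s]
  have "(ar M \<tau> \<cdot> (\<sigma> Y \<cdot> \<eta> Y)) \<cdot> a = ar M \<tau> \<cdot> (\<sigma> Y \<cdot> (\<eta> Y \<cdot> a))"
    using C.comp_assoc[OF H(1) C.comp_Hom[OF e' s'] M\<tau>] C.comp_assoc[OF H(1) e' s'] by simp
  also have "\<dots> = ar M \<tau> \<cdot> (ar M (ar M a) \<cdot> (\<sigma> X \<cdot> \<eta> X))"
    using eta_natural[OF H(1)] C.comp_eq_left[OF sigma_natural[OF H(1)] e Ma s'] C.comp_assoc[OF e s MMa] by simp
  also have "\<dots> = (ar M a \<cdot> ar M \<rho>) \<cdot> (\<sigma> X \<cdot> \<eta> X)"
    using C.comp_assoc[OF se MMa M\<tau>] ar_comp[OF Ma HB(2)] H(4) ar_comp[OF HA(2) H(1)] by simp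
  also have "\<dots> = ar M a \<cdot> (ar M \<rho> \<cdot> (\<sigma> X \<cdot> \<eta> X))"
    using C.comp_assoc[OF se M\<rho> Ma] by simp
  finally show ?thesis by (simp add: sec_def eq)
qed

text \<open>Both sides of the linearity equation equal \<open>M \<rho> \<cdot> \<sigma>\<close>. For
  one side, naturality of \<open>sec\<close> at the action reduces to the free module, whose section
  is \<open>\<sigma>\<close> by left linearity; the other side uses right linearity.\<close>

lemma sec_Hom:
  assumes A: "A \<in> EM_Obj C M \<eta> \<mu>"
  shows "sec A \<in> Hom EM A (free (fst A))"
proof -
  obtain X \<rho> where eq: "A = (X, \<rho>)" by (cases A)
  note H = EM_ObjD[OF A, unfolded eq fst_conv snd_conv]
  note MX = ob_Obj[OF H(1)]
  note e = eta_Hom[OF H(1)] and s = sigma_Hom[OF H(1)] and m = mu_Hom[OF H(1)]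
  note M\<rho> = ar_Hom[OF H(2)]
  note MM\<rho> = ar_Hom[OF M\<rho>] and eM = eta_Hom[OF MX] and sM = sigma_Hom[OF MX] and Me = ar_Hom[OF e] and Ms = ar_Hom[OF s]
  have eq1: "sec A \<cdot> \<rho> = ar M \<rho> \<cdot> \<sigma> X"
  proof -
    have "sec A \<cdot> \<rho> = ar M \<rho> \<cdot> sec (free X)"
      using sec_natural[OF action_Hom[OF A]] by (simp add: eq)
    also have "sec (free X) = \<sigma> X"
      unfolding sec_def fst_conv snd_conv
      using C.comp_eq_left[OF left_linear[OF H(1)] eM sM ar_Hom[OF m]] C.comp_eq_right[OF right_unit[OF H(1)] eM m s] C.comp_ident[OF s] by simp
    finally show ?thesis .
  qed
  have "\<mu> X \<cdot> ar M (sec A) = \<mu> X \<cdot> (ar M (ar M \<rho>) \<cdot> (ar M (\<sigma> X) \<cdot> ar M (\<eta> X)))"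
    using ar_comp[OF C.comp_Hom[OF e s] M\<rho>] ar_comp[OF e s] by (simp add: sec_def eq)
  also have "\<dots> = ar M \<rho> \<cdot> (\<mu> (ob M X) \<cdot> (ar M (\<sigma> X) \<cdot> ar M (\<eta> X)))"
    using C.comp_eq_left[OF mu_natural[OF H(2)] C.comp_Hom[OF Me Ms] MM\<rho> m] C.comp_assoc[OF C.comp_Hom[OF Me Ms] mu_Hom[OF MX] M\<rho>] by simp
  also have "\<dots> = ar M \<rho> \<cdot> \<sigma> X"
    using C.comp_eq_left[OF right_linear[OF H(1)] Me Ms mu_Hom[OF MX]] C.comp_eq_right[OF left_unit[OF H(1)] Me m s] C.comp_ident[OF s] by simp
  finally show ?thesis
    using eq1 A free_Obj[OF H(1)] sec_Hom_C[OF A] unfolding EM_Hom_iff by (simp add: eq)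
qed

text \<open>Separability provides a retraction of the base morphisms onto the module maps which is natural
  with respect to module maps, as averaging over a finite group of invertible order does.\<close>

definition avg where "avg A B c = snd B \<cdot> (ar M c \<cdot> sec A)"

lemma avg_Hom:
  assumes A: "A \<in> EM_Obj C M \<eta> \<mu>" and B: "B \<in> EM_Obj C M \<eta> \<mu>" and c: "c \<in> Hom C (fst A) (fst B)"
  shows "avg A B c \<in> Hom EM A B"
  unfolding avg_def using module_map_comp[OF module_map_comp[OF sec_Hom[OF A] free_Hom[OF c]] action_Hom[OF B]] .

lemma avg_module_map:
  assumes a: "a \<in> Hom EM A B"
  shows "avg A B a = a"
proof -
  note H = EM_HomD[OF a]
  note A = EM_ObjD[OF H(2)] and B = EM_ObjD[OF H(3)]
  show ?thesis
    unfolding avg_def using C.comp_eq_left[OF H(4)[symmetric] sec_Hom_C[OF H(2)] ar_Hom[OF H(1)] B(2)]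
      C.comp_eq_right[OF action_sec[OF H(2)] sec_Hom_C[OF H(2)] A(2) H(1)] C.comp_ident[OF H(1)] by simp
qed

text \<open>Naturality of \<open>sec\<close> moves \<open>a\<close> inside, just as linearity of
  \<open>b\<close> does in \<open>comp_avg\<close>. Hence an equation asserting that
  \<open>c \<cdot> a\<close> or \<open>b \<cdot> c\<close> is a given module map remains true when
  \<open>c\<close> is averaged.\<close>

lemma avg_comp:
  assumes a: "a \<in> Hom EM A B" and D: "D \<in> EM_Obj C M \<eta> \<mu>" and c: "c \<in> Hom C (fst B) (fst D)"
  shows "avg B D c \<cdot> a = avg A D (c \<cdot> a)"
proof -
  note H = EM_HomD[OF a] and Mc = ar_Hom[OF c]
  note s = sec_Hom_C[OF H(2)] and s' = sec_Hom_C[OF H(3)] and Ma = ar_Hom[OF H(1)]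
  have "(ar M c \<cdot> sec B) \<cdot> a = ar M (c \<cdot> a) \<cdot> sec A"
    using C.comp_eq_right[OF sec_natural[OF a] H(1) s' Mc] C.comp_assoc[OF s Ma Mc] ar_comp[OF H(1) c] by simp
  then show ?thesis
    unfolding avg_def using C.comp_eq_right[OF _ H(1) C.comp_Hom[OF s' Mc] EM_ObjD(2)[OF D]] by simp
qed

lemma comp_avg:
  assumes b: "b \<in> Hom EM B D" and A: "A \<in> EM_Obj C M \<eta> \<mu>" and c: "c \<in> Hom C (fst A) (fst B)"
  shows "b \<cdot> avg A B c = avg A D (b \<cdot> c)"
proof -
  note H = EM_HomD[OF b] and Mc = ar_Hom[OF c]
  note s = sec_Hom_C[OF A] and Mb = ar_Hom[OF H(1)] 
  note B = EM_ObjD(2)[OF H(2)] and D = EM_ObjD(2)[OF H(3)]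
  show ?thesis
    unfolding avg_def using C.comp_eq_left[OF H(4) C.comp_Hom[OF s Mc] B H(1)] C.comp_assoc[OF C.comp_Hom[OF s Mc] Mb D]
      C.comp_assoc[OF s Mc Mb] ar_comp[OF c H(1)] by simp
qed

end

context stable_monad
begin

text \<open>\<open>phi_mu\<close> read as linearity: \<open>\<phi>\<close> serves as the suspension
  comparison of the free functor.\<close>

lemma phi_module_map:
  assumes X: "X \<in> Obj C"
  shows "\<phi> X \<in> Hom EM (free (ob \<Sigma> X)) (ob S (free X))"
proof -
  note SX = \<Sigma>.ob_Obj[OF X]
  have "(ar \<Sigma> (\<mu> X) \<cdot> \<phi> (ob M X)) \<cdot> ar M (\<phi> X) = \<phi> X \<cdot> \<mu> (ob \<Sigma> X)"
    using phi_mu[OF X] comp_assoc[OF ar_Hom[OF phi_Hom[OF X]] phi_Hom[OF ob_Obj[OF X]] \<Sigma>.ar_Hom[OF mu_Hom[OF X]]] by simp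
  then show ?thesis
    unfolding EM_Hom_iff using free_Obj[OF SX] susp_Obj[OF free_Obj[OF X]] phi_Hom[OF X] by (simp add: susp_simps)
qed

text \<open>Detection leaves no other choice for the class of distinguished triangles.\<close>

definition EM_dist where
  "EM_dist = {T. is_triangle EM S T \<and> map_triangle C forgetful_functor (forgetful_comparison C \<Sigma>) T \<in> \<Delta>}"

lemma EM_dist_iff:
  "Triangle A B D f g h \<in> EM_dist \<longleftrightarrow> f \<in> Hom EM A B \<and> g \<in> Hom EM B D \<and> h \<in> Hom EM D (ob S A) \<and>
     Triangle (fst A) (fst B) (fst D) f g h \<in> \<Delta>"
proof -
  have "ident C (ob \<Sigma> (fst A)) \<cdot> h = h" if "h \<in> Hom EM D (ob S A)"
    using EM_HomD(1)[OF that] ident_comp by (simp add: susp_simps)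
  then show ?thesis
    by (auto simp: EM_dist_def forgetful_functor_def forgetful_comparison_def)
qed

lemma EM_dist_free:
  assumes T: "Triangle X Y Z f g h \<in> \<Delta>"
  shows "Triangle (free X) (free Y) (free Z) (ar M f) (ar M g) (\<phi> X \<cdot> ar M h) \<in> EM_dist"
  using pre.dist_Hom[OF T] map_dist[OF T] module_map_comp[OF free_Hom phi_module_map] free_Hom
  by (simp add: EM_dist_iff)

lemma EM_dist_rotate:
  assumes "is_triangle EM S (Triangle A B D f g h)"
  shows "Triangle A B D f g h \<in> EM_dist \<longleftrightarrow>
    Triangle B D (ob S A) g h (neg_mor EM (ob S A) (ob S B) (ar S f)) \<in> EM_dist"
proof -
  have H: "f \<in> Hom EM A B" "g \<in> Hom EM B D" "h \<in> Hom EM D (ob S A)" using assms by auto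
  note Sf = susp_Hom[OF H(1)]
  show ?thesis
    using H EM_HomD(1)[OF H(1)] EM_HomD(1)[OF H(2)] EM_HomD(1)[OF H(3)] neg_mor_EM[OF Sf] module_map_neg[OF Sf]
      pre.dist_rotate[of "fst A" "fst B" "fst D" f g h]
    by (simp add: EM_dist_iff susp_simps)
qed

end

section \<open>The triangulation axioms for modules over a separable stable monad\<close>

locale separable_stable_monad = stable_monad C \<Sigma> \<Delta> M \<eta> \<mu> \<phi> + separability_section C M \<eta> \<mu> \<sigma>
  for C :: "('o, 'm) add_cat" (structure) and \<Sigma> \<Delta> M \<eta> \<mu> \<phi> \<sigma>
begin

lemma EM_dist_complete:
  assumes T: "Triangle A B D f g h \<in> EM_dist" and T': "Triangle A' B' D' f' g' h' \<in> EM_dist"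
    and a: "a \<in> Hom EM A A'" and b: "b \<in> Hom EM B B'" and eq: "b \<cdot> f = f' \<cdot> a"
  obtains c where "c \<in> Hom EM D D'" "c \<cdot> g = g' \<cdot> b" "ar \<Sigma> a \<cdot> h = h' \<cdot> c"
proof -
  have H: "f \<in> Hom EM A B" "g \<in> Hom EM B D" "h \<in> Hom EM D (ob S A)" "Triangle (fst A) (fst B) (fst D) f g h \<in> \<Delta>"
    and H': "f' \<in> Hom EM A' B'" "g' \<in> Hom EM B' D'" "h' \<in> Hom EM D' (ob S A')" "Triangle (fst A') (fst B') (fst D') f' g' h' \<in> \<Delta>"
    using T T' by (simp_all add: EM_dist_iff)
  obtain c where c: "c \<in> Hom C (fst D) (fst D')" "c \<cdot> g = g' \<cdot> b" "ar \<Sigma> a \<cdot> h = h' \<cdot> c"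
    using pre.dist_completeE[OF H(4) H'(4) EM_HomD(1)[OF a] EM_HomD(1)[OF b] eq] .
  note D = EM_HomD(3)[OF H(2)] and D' = EM_HomD(3)[OF H'(2)]
  have "avg D D' c \<cdot> g = g' \<cdot> b"
    using avg_comp[OF H(2) D' c(1)] c(2) avg_module_map[OF module_map_comp[OF b H'(2)]] by simp
  moreover have "h' \<cdot> avg D D' c = ar \<Sigma> a \<cdot> h"
    using comp_avg[OF H'(3) D c(1)] c(3) avg_module_map[OF module_map_comp[OF H(3) susp_Hom[OF a]]] by simp
  ultimately show thesis using that avg_Hom[OF D D' c(1)] by simp
qed

lemma EM_dist_cone:
  assumes ic: "idempotent_complete C" and f: "f \<in> Hom EM A B"
  shows "\<exists>D g h. Triangle A B D f g h \<in> EM_dist"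
proof -
  obtain X \<rho> Y \<tau> where eq: "A = (X, \<rho>)" "B = (Y, \<tau>)" by (cases A, cases B) blast
  note F = EM_HomD[OF f]
  note A = EM_ObjD[OF F(2), unfolded eq fst_conv snd_conv] and B = EM_ObjD[OF F(3), unfolded eq fst_conv snd_conv]
  note fC = F(1)[unfolded eq fst_conv]
  \<comment> \<open>This base cone carries no action, but applying \<open>M\<close> makes it a
    distinguished triangle of free modules.\<close>
  obtain Z g0 h0 where "Triangle X Y Z f g0 h0 \<in> \<Delta>" using pre.dist_cone[OF fC] by blast
  note T' = EM_dist_free[OF this]
  define f' g' h' where "f' = ar M f" and "g' = ar M g0" and "h' = \<phi> X \<cdot> ar M h0"
  note T' = T'[folded f'_def g'_def h'_def]
  have H': "f' \<in> Hom EM (free X) (free Y)" "g' \<in> Hom EM (free Y) (free Z)" "h' \<in> Hom EM (free Z) (ob S (free X))"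
    and T'C: "Triangle (ob M X) (ob M Y) (ob M Z) f' g' h' \<in> \<Delta>"
    using T' by (simp_all add: EM_dist_iff)
  note H'C = pre.dist_Hom[OF T'C]
  define s t where "s = sec A" and "t = sec B"
  have s: "s \<in> Hom EM A (free X)" and t: "t \<in> Hom EM B (free Y)"
    using sec_Hom[OF F(2)] sec_Hom[OF F(3)] by (simp_all add: s_def t_def eq)
  have sC: "s \<in> Hom C X (ob M X)" and tC: "t \<in> Hom C Y (ob M Y)"
    using EM_HomD(1)[OF s] EM_HomD(1)[OF t] by (simp_all add: eq)
  have \<rho>: "\<rho> \<in> Hom EM (free X) A" and \<tau>: "\<tau> \<in> Hom EM (free Y) B"
    using action_Hom[OF F(2)] action_Hom[OF F(3)] by (simp_all add: eq)
  have \<rho>s: "\<rho> \<cdot> s = ident C X" and \<tau>t: "\<tau> \<cdot> t = ident C Y"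
    using action_sec[OF F(2)] action_sec[OF F(3)] by (simp_all add: eq s_def t_def)
  have tf: "t \<cdot> f = f' \<cdot> s" using sec_natural[OF f] by (simp add: s_def t_def f'_def)
  have f\<rho>: "f \<cdot> \<rho> = \<tau> \<cdot> f'" using F(4) by (simp add: f'_def eq)
  \<comment> \<open>The idempotents that cut \<open>X\<close> and \<open>Y\<close> out of their free
    modules; they commute with \<open>M f\<close> because sections and actions are natural.\<close>
  define a b where "a = s \<cdot> \<rho>" and "b = t \<cdot> \<tau>"
  have a: "a \<in> Hom EM (free X) (free X)" and b: "b \<in> Hom EM (free Y) (free Y)"
    unfolding a_def b_def using module_map_comp[OF \<rho> s] module_map_comp[OF \<tau> t] .
  have aC: "a \<in> Hom C (ob M X) (ob M X)" and bC: "b \<in> Hom C (ob M Y) (ob M Y)"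
    using EM_HomD(1)[OF a] EM_HomD(1)[OF b] by simp_all
  have \<rho>a: "\<rho> \<cdot> a = \<rho>" and bt: "b \<cdot> t = t"
    using comp_eq_left[OF \<rho>s A(2) sC A(2)] ident_comp[OF A(2)] comp_eq_right[OF \<tau>t tC B(2) tC] comp_ident[OF tC]
    by (simp_all add: a_def b_def)
  have aa: "a \<cdot> a = a" and bb: "b \<cdot> b = b"
    using comp_eq_right[OF \<rho>a aC A(2) sC] comp_eq_left[OF bt B(2) tC bC] by (simp_all add: a_def b_def)
  have bf: "b \<cdot> f' = f' \<cdot> a"
    unfolding a_def b_def using comp_eq_right[OF f\<rho>[symmetric] H'C(1) B(2) tC] comp_eq_left[OF tf A(2) fC tC]
      comp_assoc[OF A(2) sC H'C(1)] by simp
  obtain c where c: "c \<in> Hom EM (free Z) (free Z)" "c \<cdot> g' = g' \<cdot> b" "ar \<Sigma> a \<cdot> h' = h' \<cdot> c"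
    using EM_dist_complete[OF T' T' a b bf] .
  have cC: "c \<in> Hom C (ob M Z) (ob M Z)" using EM_HomD(1)[OF c(1)] by simp
  note Sa = \<Sigma>.ar_Hom[OF aC]
  \<comment> \<open>Since \<open>a\<close> and \<open>b\<close> are idempotent, \<open>c\<close> and
    \<open>c \<cdot> c\<close> have the same composites with \<open>g'\<close> and
    \<open>h'\<close>. Their difference therefore kills \<open>g'\<close>, is killed by
    \<open>h'\<close>, and squares to zero.\<close>
  let ?d = "(c \<cdot> c) \<boxplus> neg_mor C (ob M Z) (ob M Z) c"
  note cc = comp_Hom[OF cC cC]
  have d: "?d \<in> Hom C (ob M Z) (ob M Z)" using add_Hom[OF cc neg_Hom[OF cC]] .
  have dg: "?d \<cdot> g' = zero_mor C (ob M Y) (ob M Z)"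
  proof -
    have "(c \<cdot> c) \<cdot> g' = c \<cdot> g'"
      using comp_eq_right[OF c(2) H'C(2) cC cC] comp_eq_left[OF c(2) bC H'C(2) cC] comp_eq_right[OF bb bC bC H'C(2)] c(2) by simp
    then show ?thesis using diff_comp_zero[OF H'C(2) cc cC] by simp
  qed
  have hd: "h' \<cdot> ?d = zero_mor C (ob M Z) (ob \<Sigma> (ob M X))"
  proof -
    have Saa: "ar \<Sigma> a \<cdot> ar \<Sigma> a = ar \<Sigma> a" using \<Sigma>.ar_comp[OF aC aC] aa by simp
    have "h' \<cdot> (c \<cdot> c) = h' \<cdot> c"
      using comp_eq_left[OF c(3)[symmetric] cC cC H'C(3)] comp_eq_right[OF c(3)[symmetric] cC H'C(3) Sa]
        comp_eq_left[OF Saa H'C(3) Sa Sa] c(3) by simp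
    then show ?thesis using comp_diff_zero[OF cc cC H'C(3)] by simp
  qed
  obtain k where k: "k \<in> Hom C (ob \<Sigma> (ob M X)) (ob M Z)" "?d = k \<cdot> h'"
    using pre.weak_cokernel[OF T'C d dg] .
  have dd: "?d \<cdot> ?d = zero_mor C (ob M Z) (ob M Z)"
    using comp_eq_right[OF hd d H'C(3) k(1)] k(2) comp_zero[OF k(1) H'C(6)] by simp
  interpret E: additive_category EM by (rule additive_EM)
  \<comment> \<open>The lifting takes place among module endomorphisms, so that \<open>e\<close> is
    linear. The form \<open>c + x d\<close> keeps the equation with \<open>g'\<close>, and the form
    \<open>c + d x\<close> keeps the one with \<open>h'\<close>.\<close>
  obtain x e where e: "x \<in> Hom EM (free Z) (free Z)" "e \<in> Hom EM (free Z) (free Z)" "e \<cdot> e = e"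
    "e = c \<boxplus> (x \<cdot> ?d)" "e = c \<boxplus> (?d \<cdot> x)"
    using E.idempotent_lift[OF c(1)] dd neg_mor_EM[OF c(1)] by (auto simp: EM_simps)
  have xC: "x \<in> Hom C (ob M Z) (ob M Z)" and eC: "e \<in> Hom C (ob M Z) (ob M Z)"
    using EM_HomD(1)[OF e(1)] EM_HomD(1)[OF e(2)] by simp_all
  have eg: "e \<cdot> g' = g' \<cdot> b"
    using e(4) add_comp[OF H'C(2) cC comp_Hom[OF d xC]] comp_eq_right[OF dg H'C(2) d xC] comp_zero[OF xC H'C(5)]
      add_zero[OF comp_Hom[OF H'C(2) cC]] c(2) by simp
  have he: "h' \<cdot> e = ar \<Sigma> a \<cdot> h'"
    using e(5) comp_add[OF cC comp_Hom[OF xC d] H'C(3)] comp_eq_left[OF hd xC d H'C(3)] zero_comp[OF xC]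
      \<Sigma>.ob_Obj[OF H'C(4)] add_zero[OF comp_Hom[OF cC H'C(3)]] c(3) by simp
  obtain D p i where p: "p \<in> Hom EM (free Z) D" and i: "i \<in> Hom EM D (free Z)"
    and ip: "i \<cdot> p = e" and pi: "p \<cdot> i = ident C (fst D)"
    using idempotent_complete_EM[OF ic] e(2,3) E.Hom_Obj[OF e(2)] unfolding idempotent_complete_def EM_simps by blast
  have pC: "p \<in> Hom C (ob M Z) (fst D)" and iC: "i \<in> Hom C (fst D) (ob M Z)"
    using EM_HomD(1)[OF p] EM_HomD(1)[OF i] by simp_all
  have pe: "p \<cdot> e = p" and ei: "e \<cdot> i = i"
    using comp_eq_left[OF pi pC iC pC] comp_eq_right[OF pi iC pC iC] ip ident_comp[OF pC] comp_ident[OF iC] by simp_all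
  \<comment> \<open>The maps of the big triangle, restricted and projected to the retracts. By the
    equations that follow, \<open>(s, t, i)\<close> and \<open>(\<rho>, \<tau>, p)\<close> are
    morphisms of triangles, exhibiting the new one as a retract of a distinguished one.\<close>
  define g h where "g = p \<cdot> (g' \<cdot> t)" and "h = ar \<Sigma> \<rho> \<cdot> (h' \<cdot> i)"
  have g: "g \<in> Hom EM B D" unfolding g_def using module_map_comp[OF module_map_comp[OF t H'(2)] p] .
  have h: "h \<in> Hom EM D (ob S A)" unfolding h_def using module_map_comp[OF module_map_comp[OF i H'(3)] susp_Hom[OF \<rho>]] .
  have gC: "g \<in> Hom C Y (fst D)" and hC: "h \<in> Hom C (fst D) (ob \<Sigma> X)"
    using EM_HomD(1)[OF g] EM_HomD(1)[OF h] by (simp_all add: eq susp_simps)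
  note S\<rho> = \<Sigma>.ar_Hom[OF A(2)] and Ss = \<Sigma>.ar_Hom[OF sC] and g't = comp_Hom[OF tC H'C(2)] and h'i = comp_Hom[OF iC H'C(3)]
  have ig: "i \<cdot> g = g' \<cdot> t"
    unfolding g_def using comp_eq_left[OF ip g't pC iC] comp_eq_left[OF eg tC H'C(2) eC] comp_eq_right[OF bt tC bC H'C(2)] by simp
  have Ssh: "ar \<Sigma> s \<cdot> h = h' \<cdot> i"
  proof -
    have "ar \<Sigma> s \<cdot> h = ar \<Sigma> a \<cdot> (h' \<cdot> i)"
      unfolding h_def using comp_assoc[OF h'i S\<rho> Ss] \<Sigma>.ar_comp[OF A(2) sC] by (simp add: a_def)
    then show ?thesis using comp_eq_left[OF he[symmetric] iC H'C(3) Sa] comp_eq_right[OF ei iC eC H'C(3)] by simp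
  qed
  have g\<tau>: "p \<cdot> g' = g \<cdot> \<tau>"
  proof -
    have "g \<cdot> \<tau> = p \<cdot> (g' \<cdot> b)"
      unfolding g_def b_def using comp_assoc[OF B(2) g't pC] comp_assoc[OF B(2) tC H'C(2)] by simp
    then show ?thesis using eg comp_eq_left[OF pe H'C(2) eC pC] by simp
  qed
  have hp: "ar \<Sigma> \<rho> \<cdot> h' = h \<cdot> p"
  proof -
    have "h \<cdot> p = ar \<Sigma> \<rho> \<cdot> (h' \<cdot> e)"
      unfolding h_def using comp_assoc[OF pC h'i S\<rho>] comp_eq_right[OF ip pC iC H'C(3)] by simp
    then show ?thesis
      using he comp_eq_left[OF _ H'C(3) Sa S\<rho>] \<Sigma>.ar_comp[OF aC A(2)] \<rho>a by simp
  qed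
  have "Triangle X Y (fst D) f g h \<in> \<Delta>"
    by (rule pre.dist_retract[OF T'C, where a = s and b = t and c = i and a' = \<rho> and b' = \<tau> and c' = p])
      (use fC gC hC sC tC iC pC A(2) B(2) tf ig Ssh f\<rho> g\<tau> hp \<rho>s \<tau>t pi in simp_all)
  then have "Triangle A B D f g h \<in> EM_dist" using f g h by (simp add: EM_dist_iff eq)
  then show ?thesis by blast
qed

lemma pretriangulated_EM:
  assumes ic: "idempotent_complete C"
  shows "pretriangulated_category EM S EM_dist"
proof (intro pretriangulated_category.intro additive_functor_susp additive_EM pretriangulated_category_axioms.intro)
  show "is_triangle EM S T" if "T \<in> EM_dist" for T using that by (simp add: EM_dist_def)
next
  fix T T' a b c
  assume T: "T \<in> EM_dist" and T': "is_triangle EM S T'" and i: "is_triangle_iso EM S T T' a b c"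
  obtain A B D f g h where eq: "T = Triangle A B D f g h" by (cases T)
  obtain A' B' D' f' g' h' where eq': "T' = Triangle A' B' D' f' g' h'" by (cases T')
  have "Triangle (fst A') (fst B') (fst D') f' g' h' \<in> \<Delta>"
    by (rule pre.dist_iso[of "Triangle (fst A) (fst B) (fst D) f g h" _ a b c])
      (use T T' i EM_HomD(1)[of h' D' "ob S A'"] in \<open>auto simp: eq eq' EM_dist_iff EM_simps susp_simps intro: EM_isoD EM_HomD(1)\<close>)
  then show "T' \<in> EM_dist" using T' by (simp add: eq' EM_dist_iff)
next
  fix A Z assume "A \<in> Obj EM" and Z: "is_zero_object EM Z"
  then have A: "A \<in> EM_Obj C M \<eta> \<mu>" by (simp add: EM_simps)
  have Z': "Z \<in> EM_Obj C M \<eta> \<mu>" "is_zero_object C (fst Z)" using Z by (simp_all add: is_zero_object_EM_iff)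
  interpret E: category EM by (rule category_EM)
  show "Triangle A A Z (ident EM A) (zero_mor EM A Z) (zero_mor EM Z (ob S A)) \<in> EM_dist"
    using pre.dist_ident[OF EM_ObjD(1)[OF A] Z'(2)] E.ident_Hom[of A] A module_map_zero[OF A Z'(1)]
      module_map_zero[OF Z'(1) susp_Obj[OF A]]
    by (simp add: EM_dist_iff EM_simps susp_simps)
next
  fix f A B assume "f \<in> Hom EM A B"
  then show "\<exists>D g h. Triangle A B D f g h \<in> EM_dist" using EM_dist_cone[OF ic] by blast
next
  fix A B D f g h assume "is_triangle EM S (Triangle A B D f g h)"
  then show "Triangle A B D f g h \<in> EM_dist \<longleftrightarrow>
    Triangle B D (ob S A) g h (neg_mor EM (ob S A) (ob S B) (ar S f)) \<in> EM_dist" by (rule EM_dist_rotate)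
next
  fix A B D f g h A' B' D' f' g' h' a b
  assume T: "Triangle A B D f g h \<in> EM_dist" and T': "Triangle A' B' D' f' g' h' \<in> EM_dist"
    and ab: "a \<in> Hom EM A A'" "b \<in> Hom EM B B'" "b \<cdot>\<^bsub>EM\<^esub> f = f' \<cdot>\<^bsub>EM\<^esub> a"
  obtain c where "c \<in> Hom EM D D'" "c \<cdot> g = g' \<cdot> b" "ar \<Sigma> a \<cdot> h = h' \<cdot> c"
    using EM_dist_complete[OF T T' ab(1,2)] ab(3) by (auto simp: EM_simps)
  then show "\<exists>c. is_triangle_morphism EM S (Triangle A B D f g h) (Triangle A' B' D' f' g' h') a b c"
    using ab by (auto simp: EM_simps susp_simps)
qed

text \<open>The base octahedron yields an isomorphism \<open>\<chi>\<close> from the cone \<open>K\<close> of \<open>n \<cdot> i2\<close> in modules to \<open>R\<close>.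
  Its average is \<open>\<chi> \<cdot> (1 + \<epsilon>)\<close> with \<open>\<epsilon>^3 = 0\<close>, hence still an isomorphism.\<close>

lemma split_octahedron_EM:
  assumes ic: "idempotent_complete C" and B: "is_biproduct EM P Q B i1 i2 p1 p2"
    and T: "Triangle Y B W m n w \<in> EM_dist" and T1: "Triangle Y P R (p1 \<cdot> m) s t \<in> EM_dist"
  shows "\<exists>u. u \<in> Hom EM W R \<and> u \<cdot> n = s \<cdot> p1 \<and> t \<cdot> u = w \<and>
    Triangle Q W R (n \<cdot> i2) u (neg_mor EM R (ob S Q) (ar \<Sigma> (p2 \<cdot> m) \<cdot> t)) \<in> EM_dist"
proof -
  have b: "i1 \<in> Hom EM P B" "i2 \<in> Hom EM Q B" "p1 \<in> Hom EM B P" "p2 \<in> Hom EM B Q"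
    and BC: "is_biproduct C (fst P) (fst Q) (fst B) i1 i2 p1 p2"
    using B EM_HomD(1) unfolding is_biproduct_def EM_simps by blast+
  have H: "m \<in> Hom EM Y B" "n \<in> Hom EM B W" "w \<in> Hom EM W (ob S Y)" and TC: "Triangle (fst Y) (fst B) (fst W) m n w \<in> \<Delta>"
    using T by (simp_all add: EM_dist_iff)
  have H1: "s \<in> Hom EM P R" "t \<in> Hom EM R (ob S Y)" and T1C: "Triangle (fst Y) (fst P) (fst R) (p1 \<cdot> m) s t \<in> \<Delta>"
    using T1 by (simp_all add: EM_dist_iff)
  note W = EM_HomD(3)[OF H(2)] and R = EM_HomD(3)[OF H1(1)]
  define v where "v = neg_mor C (fst R) (ob \<Sigma> (fst Q)) (ar \<Sigma> (p2 \<cdot> m) \<cdot> t)"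
  note tv = module_map_comp[OF H1(2) susp_Hom[OF module_map_comp[OF H(1) b(4)]]]
  have vE: "v = neg_mor EM R (ob S Q) (ar \<Sigma> (p2 \<cdot> m) \<cdot> t)"
    using neg_mor_EM[OF tv] by (simp add: v_def susp_simps)
  have v: "v \<in> Hom EM R (ob S Q)" using module_map_neg[OF tv] by (simp add: v_def susp_simps)
  \<comment> \<open>Of the maps in this base triangle, \<open>n \<cdot> i2\<close> and
    \<open>v\<close> are already linear; only \<open>u\<close> has to be averaged.\<close>
  obtain u where u: "u \<in> Hom C (fst W) (fst R)" "u \<cdot> n = s \<cdot> p1" "t \<cdot> u = w"
    and Tu: "Triangle (fst Q) (fst W) (fst R) (n \<cdot> i2) u v \<in> \<Delta>"
    using pre.split_octahedron[OF BC TC T1C] by (auto simp: v_def)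
  define u' where "u' = avg W R u"
  have u': "u' \<in> Hom EM W R" unfolding u'_def using avg_Hom[OF W R u(1)] .
  have u'n: "u' \<cdot> n = s \<cdot> p1"
    unfolding u'_def using avg_comp[OF H(2) R u(1)] u(2) avg_module_map[OF module_map_comp[OF b(3) H1(1)]] by simp
  have tu': "t \<cdot> u' = w"
    unfolding u'_def using comp_avg[OF H1(2) W u(1)] u(3) avg_module_map[OF H(3)] by simp
  obtain K g h where K: "Triangle Q W K (n \<cdot> i2) g h \<in> EM_dist"
    using EM_dist_cone[OF ic module_map_comp[OF b(2) H(2)]] by blast
  have g: "g \<in> Hom EM W K" and h: "h \<in> Hom EM K (ob S Q)" and KC: "Triangle (fst Q) (fst W) (fst K) (n \<cdot> i2) g h \<in> \<Delta>"
    using K by (simp_all add: EM_dist_iff)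
  note KO = EM_HomD(3)[OF g]
  obtain \<chi> where \<chi>: "is_iso C (fst K) (fst R) \<chi>" "\<chi> \<cdot> g = u" "v \<cdot> \<chi> = h"
    using pre.dist_iso_over[OF KC Tu] .
  obtain \<psi> where \<psi>: "\<chi> \<in> Hom C (fst K) (fst R)" "\<psi> \<in> Hom C (fst R) (fst K)" "\<psi> \<cdot> \<chi> = ident C (fst K)" "\<chi> \<cdot> \<psi> = ident C (fst R)"
    using \<chi>(1) by (rule is_isoE)
  define \<chi>' where "\<chi>' = avg K R \<chi>"
  have \<chi>': "\<chi>' \<in> Hom EM K R" unfolding \<chi>'_def using avg_Hom[OF KO R \<psi>(1)] .
  have \<chi>'g: "\<chi>' \<cdot> g = u'" unfolding \<chi>'_def u'_def using avg_comp[OF g R \<psi>(1)] \<chi>(2) by simp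
  have v\<chi>': "v \<cdot> \<chi>' = h" unfolding \<chi>'_def using comp_avg[OF v KO \<psi>(1)] \<chi>(3) avg_module_map[OF h] by simp
  note \<chi>'C = EM_HomD(1)[OF \<chi>'] and u'C = EM_HomD(1)[OF u']
  note HC = pre.dist_Hom[OF TC] and H1C = pre.dist_Hom[OF T1C] and GC = pre.dist_Hom[OF KC] and VC = pre.dist_Hom[OF Tu]
  define \<delta> where "\<delta> = \<chi>' \<boxplus> neg_mor C (fst K) (fst R) \<chi>"
  have \<delta>: "\<delta> \<in> Hom C (fst K) (fst R)" unfolding \<delta>_def using add_Hom[OF \<chi>'C neg_Hom[OF \<psi>(1)]] .
  \<comment> \<open>The relative error of averaging, so that
    \<open>\<chi>' = \<chi> \<cdot> (1 + \<epsilon>)\<close>. It factors through \<open>g\<close>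
    because both \<open>\<chi>\<close> and \<open>\<chi>'\<close> turn \<open>v\<close> into
    \<open>h\<close>.\<close>
  define \<epsilon> where "\<epsilon> = \<psi> \<cdot> \<delta>"
  have \<epsilon>: "\<epsilon> \<in> Hom C (fst K) (fst K)" unfolding \<epsilon>_def using comp_Hom[OF \<delta> \<psi>(2)] .
  have \<chi>\<epsilon>: "\<chi> \<cdot> \<epsilon> = \<delta>" unfolding \<epsilon>_def using comp_eq_left[OF \<psi>(4) \<delta> \<psi>(2,1)] ident_comp[OF \<delta>] by simp
  have v\<delta>: "v \<cdot> \<delta> = zero_mor C (fst K) (ob \<Sigma> (fst Q))"
    unfolding \<delta>_def using comp_diff_zero[OF \<chi>'C \<psi>(1) VC(3)] v\<chi>' \<chi>(3) by simp
  have h\<epsilon>: "h \<cdot> \<epsilon> = zero_mor C (fst K) (ob \<Sigma> (fst Q))"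
    using comp_eq_left[OF \<chi>(3) \<epsilon> \<psi>(1) VC(3)] \<chi>\<epsilon> v\<delta> by simp
  obtain \<kappa> where \<kappa>: "\<kappa> \<in> Hom C (fst K) (fst W)" "\<epsilon> = g \<cdot> \<kappa>"
    using weak_kernel[OF KC \<epsilon> h\<epsilon>] .
  have \<delta>g: "\<delta> \<cdot> g = u' \<boxplus> neg_mor C (fst W) (fst R) u"
    unfolding \<delta>_def using add_comp[OF GC(2) \<chi>'C neg_Hom[OF \<psi>(1)]] neg_comp[OF GC(2) \<psi>(1)] \<chi>(2) \<chi>'g by simp
  note uu = add_Hom[OF u'C neg_Hom[OF u(1)]]
  have "(\<delta> \<cdot> g) \<cdot> n = zero_mor C (fst B) (fst R)"
    unfolding \<delta>g using diff_comp_zero[OF HC(2) u'C u(1)] u(2) u'n by simp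
  then have "(\<epsilon> \<cdot> g) \<cdot> n = zero_mor C (fst B) (fst K)"
    unfolding \<epsilon>_def using comp_assoc[OF GC(2) \<delta> \<psi>(2)] comp_eq_right[OF _ HC(2) comp_Hom[OF GC(2) \<delta>] \<psi>(2)]
      comp_zero[OF \<psi>(2) HC(5)] by simp
  \<comment> \<open>Both \<open>u\<close> and \<open>u'\<close> have composite
    \<open>s \<cdot> p1\<close> with \<open>n\<close>, so \<open>\<epsilon> \<cdot> g\<close>
    vanishes on \<open>n\<close> and factors through \<open>w\<close>.\<close>
  then obtain \<alpha> where \<alpha>: "\<alpha> \<in> Hom C (ob \<Sigma> (fst Y)) (fst K)" "\<epsilon> \<cdot> g = \<alpha> \<cdot> w"
    using pre.weak_cokernel[OF TC comp_Hom[OF GC(2) \<epsilon>]] by blast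
  have t\<delta>g: "t \<cdot> (\<delta> \<cdot> g) = zero_mor C (fst W) (ob \<Sigma> (fst Y))"
    unfolding \<delta>g using comp_diff_zero[OF u'C u(1) H1C(3)] u(3) tu' by simp
  \<comment> \<open>Both \<open>u\<close> and \<open>u'\<close> have composite \<open>w\<close> with
    \<open>t\<close>, so \<open>t \<cdot> \<delta>\<close> vanishes on \<open>g\<close>, and hence
    on \<open>\<epsilon> = g \<cdot> \<kappa>\<close>. As
    \<open>\<epsilon> \<cdot> \<epsilon>\<close> factors through \<open>t \<cdot> \<delta>\<close>,
    the cube of \<open>\<epsilon>\<close> is zero.\<close>
  have t\<delta>\<epsilon>: "(t \<cdot> \<delta>) \<cdot> \<epsilon> = zero_mor C (fst K) (ob \<Sigma> (fst Y))"
  proof -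
    have "(t \<cdot> \<delta>) \<cdot> \<epsilon> = ((t \<cdot> \<delta>) \<cdot> g) \<cdot> \<kappa>"
      unfolding \<kappa>(2) using comp_assoc[OF \<kappa>(1) GC(2) comp_Hom[OF \<delta> H1C(3)]] .
    also have "(t \<cdot> \<delta>) \<cdot> g = zero_mor C (fst W) (ob \<Sigma> (fst Y))" using t\<delta>g comp_assoc[OF GC(2) \<delta> H1C(3)] by simp
    finally show ?thesis using zero_comp[OF \<kappa>(1) \<Sigma>.ob_Obj[OF HC(4)]] by simp
  qed
  have "\<epsilon> \<cdot> \<epsilon> = (\<epsilon> \<cdot> g) \<cdot> \<kappa>" using \<kappa>(2) comp_assoc[OF \<kappa>(1) GC(2) \<epsilon>] by simp
  also have "\<dots> = \<alpha> \<cdot> (w \<cdot> \<kappa>)" using \<alpha>(2) comp_assoc[OF \<kappa>(1) HC(3) \<alpha>(1)] by simp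
  also have "w \<cdot> \<kappa> = t \<cdot> \<delta>"
  proof -
    have "w \<cdot> \<kappa> = t \<cdot> (u \<cdot> \<kappa>)" using u(3) comp_assoc[OF \<kappa>(1) u(1) H1C(3)] by simp
    also have "u \<cdot> \<kappa> = \<chi> \<cdot> \<epsilon>" using \<chi>(2) \<kappa>(2) comp_assoc[OF \<kappa>(1) GC(2) \<psi>(1)] by simp
    finally show ?thesis using \<chi>\<epsilon> by simp
  qed
  finally have \<epsilon>\<epsilon>: "\<epsilon> \<cdot> \<epsilon> = \<alpha> \<cdot> (t \<cdot> \<delta>)" .
  have "\<epsilon> \<cdot> (\<epsilon> \<cdot> \<epsilon>) = (\<alpha> \<cdot> (t \<cdot> \<delta>)) \<cdot> \<epsilon>" using comp_assoc[OF \<epsilon> \<epsilon> \<epsilon>] \<epsilon>\<epsilon> by simp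
  also have "\<dots> = zero_mor C (fst K) (fst K)"
    using comp_eq_right[OF t\<delta>\<epsilon> \<epsilon> comp_Hom[OF \<delta> H1C(3)] \<alpha>(1)] comp_zero[OF \<alpha>(1) GC(6)] by simp
  finally have "is_iso C (fst K) (fst K) (ident C (fst K) \<boxplus> \<epsilon>)" by (rule nilpotent_iso[OF \<epsilon>])
  then have "is_iso C (fst K) (fst R) (\<chi> \<cdot> (ident C (fst K) \<boxplus> \<epsilon>))" using is_iso_comp \<chi>(1) by blast
  moreover have "\<chi> \<cdot> (ident C (fst K) \<boxplus> \<epsilon>) = \<chi>'"
    using comp_add[OF ident_Hom[OF GC(6)] \<epsilon> \<psi>(1)] comp_ident[OF \<psi>(1)] \<chi>\<epsilon> add_diff_cancel[OF \<psi>(1) \<chi>'C] by (simp add: \<delta>_def)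
  ultimately have "is_iso C (fst K) (fst R) \<chi>'" by simp
  from pre.dist_iso_third[OF KC this VC(3) v\<chi>'] have "Triangle (fst Q) (fst W) (fst R) (n \<cdot> i2) u' v \<in> \<Delta>"
    by (simp add: \<chi>'g)
  then have "Triangle Q W R (n \<cdot> i2) u' v \<in> EM_dist"
    using u' v module_map_comp[OF b(2) H(2)] by (simp add: EM_dist_iff)
  then show ?thesis using u' u'n tu' vE by blast
qed

theorem triangulated_EM:
  assumes ic: "idempotent_complete C"
  shows "triangulated_category EM S EM_dist"
proof -
  interpret E: split_octahedral_category EM S EM_dist
    by (intro split_octahedral_category.intro pretriangulated_EM ic split_octahedral_category_axioms.intro)
      (use split_octahedron_EM[OF ic] in \<open>simp add: EM_simps susp_simps\<close>)
  show ?thesis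
    by (intro triangulated_category.intro additive_functor_susp additive_EM triangulated_category_axioms.intro
      is_equivalence_susp; (rule E.dist_triangle E.dist_ident E.dist_cone E.dist_rotate | erule (2) E.dist_iso
        | erule (4) E.dist_complete | erule (2) E.octahedron); assumption)
qed

end

section \<open>The free and forgetful functors, and uniqueness\<close>

context separable_stable_monad
begin

lemma triangulated_functor_free:
  assumes "triangulated_category EM S EM_dist"
  shows "triangulated_functor C \<Sigma> \<Delta> EM S EM_dist (free_functor M \<mu>) \<phi>"
proof -
  have F: "is_functor C EM (free_functor M \<mu>)"
    by (intro is_functor.intro category_axioms category_EM is_functor_axioms.intro)
      (simp_all add: free_functor_def EM_simps free_Obj free_Hom ar_ident ar_comp)
  have aF: "additive_functor C EM (free_functor M \<mu>)"
    by (intro additive_functor.intro F additive_category_axioms additive_EM additive_functor_axioms.intro)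
      (simp add: free_functor_def EM_simps ar_add)
  interpret F: is_functor C EM "free_functor M \<mu>" by (rule F)
  interpret S: is_functor EM EM S by (rule is_functor_susp)
  have FS: "is_functor C EM (free_functor M \<mu> \<circ>\<^sub>F \<Sigma>)"
    by (intro is_functor.intro category_axioms category_EM is_functor_axioms.intro)
      (simp_all add: comp_func_def \<Sigma>.ob_Obj \<Sigma>.ar_Hom \<Sigma>.ar_ident \<Sigma>.ar_comp F.ob_Obj F.ar_Hom F.ar_ident
        F.ar_comp[OF \<Sigma>.ar_Hom \<Sigma>.ar_Hom])
  have SF: "is_functor C EM (S \<circ>\<^sub>F free_functor M \<mu>)"
    by (intro is_functor.intro category_axioms category_EM is_functor_axioms.intro)
      (simp_all add: comp_func_def S.ob_Obj S.ar_Hom S.ar_ident F.ob_Obj F.ar_Hom F.ar_ident F.ar_comp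
        S.ar_comp[OF F.ar_Hom F.ar_Hom])
  have "nat_iso C EM (free_functor M \<mu> \<circ>\<^sub>F \<Sigma>) (S \<circ>\<^sub>F free_functor M \<mu>) \<phi>"
    by (intro nat_iso.intro nat_trans.intro FS SF nat_trans_axioms.intro nat_iso_axioms.intro)
      (use EM_iso[OF phi_module_map] phi_module_map phi_natural phi_iso
        in \<open>simp_all add: comp_func_def free_functor_def susp_simps EM_simps\<close>)
  moreover have "map_triangle EM (free_functor M \<mu>) \<phi> T \<in> EM_dist" if "T \<in> \<Delta>" for T
    using that EM_dist_free by (cases T) (simp add: free_functor_def EM_simps)
  ultimately show ?thesis
    by (intro triangulated_functor.intro triangulated_category_axioms assms aF triangulated_functor_axioms.intro)
qed

lemma triangulated_functor_forgetful:
  assumes "triangulated_category EM S EM_dist"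
  shows "triangulated_functor EM S EM_dist C \<Sigma> \<Delta> forgetful_functor (forgetful_comparison C \<Sigma>)"
proof -
  have U: "is_functor EM C forgetful_functor"
    by (intro is_functor.intro category_axioms category_EM is_functor_axioms.intro)
      (simp_all add: forgetful_functor_def EM_simps EM_HomD EM_ObjD(1))
  have aU: "additive_functor EM C forgetful_functor"
    by (intro additive_functor.intro U additive_category_axioms additive_EM additive_functor_axioms.intro)
      (simp add: forgetful_functor_def EM_simps)
  have US: "is_functor EM C (forgetful_functor \<circ>\<^sub>F S)"
    by (intro is_functor.intro category_axioms category_EM is_functor_axioms.intro)
      (auto simp: forgetful_functor_def comp_func_def EM_simps susp_simps EM_ObjD(1) \<Sigma>.ob_Obj \<Sigma>.ar_ident
        dest!: EM_HomD(1) intro: \<Sigma>.ar_Hom \<Sigma>.ar_comp)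
  have SU: "is_functor EM C (\<Sigma> \<circ>\<^sub>F forgetful_functor)"
    by (intro is_functor.intro category_axioms category_EM is_functor_axioms.intro)
      (auto simp: forgetful_functor_def comp_func_def EM_simps susp_simps EM_ObjD(1) \<Sigma>.ob_Obj \<Sigma>.ar_ident
        dest!: EM_HomD(1) intro: \<Sigma>.ar_Hom \<Sigma>.ar_comp)
  have "nat_iso EM C (forgetful_functor \<circ>\<^sub>F S) (\<Sigma> \<circ>\<^sub>F forgetful_functor) (forgetful_comparison C \<Sigma>)"
  proof (intro nat_iso.intro nat_trans.intro US SU nat_trans_axioms.intro nat_iso_axioms.intro)
    fix A assume "A \<in> Obj EM"
    then have "ob \<Sigma> (fst A) \<in> Obj C" using EM_ObjD(1) \<Sigma>.ob_Obj by (simp add: EM_simps)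
    then show "forgetful_comparison C \<Sigma> A \<in> Hom C (ob (forgetful_functor \<circ>\<^sub>F S) A) (ob (\<Sigma> \<circ>\<^sub>F forgetful_functor) A)"
      and "is_iso C (ob (forgetful_functor \<circ>\<^sub>F S) A) (ob (\<Sigma> \<circ>\<^sub>F forgetful_functor) A) (forgetful_comparison C \<Sigma> A)"
      by (simp_all add: forgetful_comparison_def forgetful_functor_def comp_func_def susp_simps ident_Hom is_iso_ident)
  next
    fix A B a assume "a \<in> Hom EM A B"
    then have "ar \<Sigma> a \<in> Hom C (ob \<Sigma> (fst A)) (ob \<Sigma> (fst B))" using EM_HomD(1) \<Sigma>.ar_Hom by blast
    then show "forgetful_comparison C \<Sigma> B \<cdot> ar (forgetful_functor \<circ>\<^sub>F S) a = ar (\<Sigma> \<circ>\<^sub>F forgetful_functor) a \<cdot> forgetful_comparison C \<Sigma> A"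
      by (simp add: forgetful_comparison_def forgetful_functor_def comp_func_def susp_simps comp_ident ident_comp)
  qed
  then show ?thesis
    by (intro triangulated_functor.intro triangulated_category_axioms assms aU triangulated_functor_axioms.intro)
      (simp_all add: EM_dist_def)
qed

text \<open>Detection fixes membership for every triangle of modules, and a triangulation contains
  nothing but triangles; so it determines the whole set.\<close>

lemma detected_iff:
  assumes "triangulated_category EM S \<Delta>'"
  shows "detected_by_forgetful C \<Sigma> \<Delta> M \<phi> \<eta> \<mu> \<Delta>' \<longleftrightarrow> \<Delta>' = EM_dist"
  using triangulated_category.dist_triangle[OF assms]
  unfolding detected_by_forgetful_def EM_dist_def by blast

end

lemma separable_stable_monad_if_stably_separable:
  assumes "stably_separable C \<Sigma> \<Delta> M \<phi> \<eta> \<mu>"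
  obtains \<sigma> where "separable_stable_monad C \<Sigma> \<Delta> M \<eta> \<mu> \<phi> \<sigma>"
proof -
  obtain \<sigma> where T: "triangulated_category C \<Sigma> \<Delta>" and M: "monad C M \<eta> \<mu>"
    and F: "triangulated_functor C \<Sigma> \<Delta> C \<Sigma> \<Delta> M \<phi>"
    and \<eta>: "triangulated_nat_trans C \<Sigma> \<Delta> C \<Sigma> \<Delta> id_func (id_comparison C \<Sigma>) M \<phi> \<eta>"
    and \<mu>: "triangulated_nat_trans C \<Sigma> \<Delta> C \<Sigma> \<Delta> (M \<circ>\<^sub>F M) (comp_comparison C M \<phi> M \<phi>) M \<phi> \<mu>"
    and \<sigma>: "separability_section C M \<eta> \<mu> \<sigma>"
    using assms unfolding stably_separable_def by blast
  interpret triangulated_category C \<Sigma> \<Delta> by (rule T)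
  interpret F: triangulated_functor C \<Sigma> \<Delta> C \<Sigma> \<Delta> M \<phi> by (rule F)
  have "stable_monad C \<Sigma> \<Delta> M \<eta> \<mu> \<phi>"
  proof (intro stable_monad.intro T M stable_monad_axioms.intro)
    fix X assume X: "X \<in> Obj C"
    show "is_iso C (ob M (ob \<Sigma> X)) (ob \<Sigma> (ob M X)) (\<phi> X)"
      using F.component_iso[OF X] by (simp add: comp_func_def)
    have "ar \<Sigma> (\<eta> X) \<in> Hom C (ob \<Sigma> X) (ob \<Sigma> (ob M X))"
      using \<Sigma>.ar_Hom monad.eta_Hom[OF M X] by blast
    then show "\<phi> X \<cdot>\<^bsub>C\<^esub> \<eta> (ob \<Sigma> X) = ar \<Sigma> (\<eta> X)"
      using triangulated_nat_trans.suspension_compat[OF \<eta> X] comp_ident by (simp add: id_comparison_def)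
    show "\<phi> X \<cdot>\<^bsub>C\<^esub> \<mu> (ob \<Sigma> X) = ar \<Sigma> (\<mu> X) \<cdot>\<^bsub>C\<^esub> (\<phi> (ob M X) \<cdot>\<^bsub>C\<^esub> ar M (\<phi> X))"
      using triangulated_nat_trans.suspension_compat[OF \<mu> X] by (simp add: comp_comparison_def)
  next
    fix f X Y assume "f \<in> Hom C X Y"
    then show "\<phi> Y \<cdot>\<^bsub>C\<^esub> ar M (ar \<Sigma> f) = ar \<Sigma> (ar M f) \<cdot>\<^bsub>C\<^esub> \<phi> X"
      using F.naturality by (simp add: comp_func_def)
  next
    fix X Y Z f g h assume "Triangle X Y Z f g h \<in> \<Delta>"
    then show "Triangle (ob M X) (ob M Y) (ob M Z) (ar M f) (ar M g) (\<phi> X \<cdot>\<^bsub>C\<^esub> ar M h) \<in> \<Delta>"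
      using F.map_dist by fastforce
  qed
  then show thesis using that separable_stable_monad.intro \<sigma> by blast
qed

theorem corollary6p5:
  fixes C :: "('o, 'm) add_cat"
    and \<Sigma> :: "('o, 'm, 'o, 'm) func"
    and \<Delta> :: "('o, 'm) triangle set"
    and M :: "('o, 'm, 'o, 'm) func"
    and \<phi> \<eta> \<mu> :: "'o \<Rightarrow> 'm"
  assumes "triangulated_category C \<Sigma> \<Delta>"
    and "idempotent_complete C"
    and "stably_separable C \<Sigma> \<Delta> M \<phi> \<eta> \<mu>"
  shows "(\<exists>!\<Delta>\<^sub>M. triangulated_category (EM_category C M \<eta> \<mu>) (EM_suspension C \<Sigma> \<phi>) \<Delta>\<^sub>M \<and>
               detected_by_forgetful C \<Sigma> \<Delta> M \<phi> \<eta> \<mu> \<Delta>\<^sub>M) \<and>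
         (\<forall>\<Delta>\<^sub>M. triangulated_category (EM_category C M \<eta> \<mu>) (EM_suspension C \<Sigma> \<phi>) \<Delta>\<^sub>M \<and>
               detected_by_forgetful C \<Sigma> \<Delta> M \<phi> \<eta> \<mu> \<Delta>\<^sub>M \<longrightarrow>
            triangulated_functor C \<Sigma> \<Delta>
              (EM_category C M \<eta> \<mu>) (EM_suspension C \<Sigma> \<phi>) \<Delta>\<^sub>M (free_functor M \<mu>) \<phi> \<and>
            triangulated_functor (EM_category C M \<eta> \<mu>) (EM_suspension C \<Sigma> \<phi>) \<Delta>\<^sub>M
              C \<Sigma> \<Delta> forgetful_functor (forgetful_comparison C \<Sigma>))"
proof -
  obtain \<sigma> where "separable_stable_monad C \<Sigma> \<Delta> M \<eta> \<mu> \<phi> \<sigma>"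
    using assms(3) by (rule separable_stable_monad_if_stably_separable)
  then interpret separable_stable_monad C \<Sigma> \<Delta> M \<eta> \<mu> \<phi> \<sigma> .
  note tri = triangulated_EM[OF assms(2)]
  \<comment> \<open>Existence, uniqueness and the claims about functors all reduce to the single
    class \<open>EM_dist\<close>.\<close>
  have "triangulated_category EM S \<Delta>' \<and> detected_by_forgetful C \<Sigma> \<Delta> M \<phi> \<eta> \<mu> \<Delta>' \<longleftrightarrow> \<Delta>' = EM_dist" for \<Delta>'
    using detected_iff tri by blast
  then show ?thesis
    using triangulated_functor_free[OF tri] triangulated_functor_forgetful[OF tri] by auto
qed

end
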